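(* Let $(A,\mathfrak m)$ be a local ring with infinite residue field $K$, let $I$ be an ideal of $A$, and let $i$ and $p$ be positive integers. Suppose that the number $v(I^i)$ of minimal generators of $I^i$ satisfies $v(I^i)<\binom{i+p}{i}$. Then: (a) There are elements $h_1,\dots,h_p\in I$ such that $I^i=(h_1,\dots,h_p)I^{i-1}$. Moreover: (b) If $I=I_1\cdots I_s$, where $I_1,\dots,I_s$ are ideals of $A$, then $h_1,\dots,h_p$ as in (a) can be chosen so that each $h_j$ is of the form $l_1\cdots l_s$ with $l_t\in I_t$ for $t=1,\dots,s$ (the $l_t$ depending on $j$). (c) Assume $\operatorname{char}(K)=0$. If $I=J^b$, where $J$ is an ideal of $A$ and $b$ is a positive integer, then $h_1,\dots,h_p$ as in (a) can be chosen so that each $h_j$ is of the form $l^b$ with $l\in J$ (depending on $j$). (d) Assume $\operatorname{char}(K)=0$. If $I=I_1^{b_1}\cdots I_s^{b_s}$, where $I_1,\dots,I_s$ are ideals of $A$ and $b_1,\dots,b_s$ are positive integers, then $h_1,\dots,h_p$ as in (a) can be chosen so that each $h_j$ is of the form $l_1^{b_1}\cdots l_s^{b_s}$ with $l_t\in I_t$ for $t=1,\dots,s$ (the $l_t$ depending on $j$). (e) Assume $\operatorname{char}(K)=0$. If $I=I_1(I_1+I_2)\cdots(I_1+\dots+I_s)$, where $I_1,\dots,I_s$ are ideals of $A$, then $h_1,\dots,h_p$ as in (a) can be chosen so that each $h_j$ is of the form $l_1(l_1+l_2)\cdots(l_1+\dots+l_s)$ with $l_t\in I_t$ for $t=1,\dots,s$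 (the $l_t$ depending on $j$).
   Context: For an ideal $H$ of $A$, $v(H)$ denotes the minimal number of generators of $H$; the hypothesis $v(I^i)<\binom{i+p}{i}$ includes that $I^i$ is finitely generated (the ideal $I$ itself is not assumed to be finitely generated). By convention $I^0=A$. *)

theory Defs
  imports "HOL-Algebra.Algebra" "HOL-Library.Extended_Nat"
begin

text \<open>Local rings are commutative, but not assumed to be Noetherian.\<close>

locale local_ring = cring A + maximalideal \<mm> A for A (structure) and \<mm> +
  assumes maximalideal_unique: "maximalideal J A \<Longrightarrow> J = \<mm>"

text \<open>The additive order of \<open>\<one>\<close>; \<^const>\<open>group.ord\<close> is \<open>0\<close> on elements of infinite order.\<close>

definition ring_char :: "('a, 'b) ring_scheme \<Rightarrow> nat"
  where "ring_char R = group.ord (add_monoid R) \<one>\<^bsub>R\<^esub>"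

text \<open>The value is \<open>\<infinity>\<close>, the infimum of the empty set, if \<open>H\<close> is not finitely generated.\<close>

definition min_gens :: "('a, 'b) ring_scheme \<Rightarrow> 'a set \<Rightarrow> enat"
  where "min_gens R H =
    (INF S \<in> {S. finite S \<and> S \<subseteq> carrier R \<and> Idl\<^bsub>R\<^esub> S = H}. enat (card S))"

text \<open>
  Sums, products and powers of ideals are those of the semiring \<^term>\<open>ideals_set R\<close>, whose
  multiplicative unit is \<^term>\<open>carrier R\<close>; in particular \<open>I\<close> to the power \<open>0\<close> is the whole ring.
\<close>

end

(*
  Fix a set V of generators of I such that any two members of V are joined by a polynomial path
  inside V (all products l_1 ... l_s, or all l_1^b_1 ... l_s^b_s, and so on; polarization shows that
  they generate I).  Let M be a graded module over the fiber cone of I, generated in degree 0.  By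
  induction on i + p, if dim M_i < binom(i + p, i), then M_i = (v_1, ..., v_p) M_{i-1} for suitable
  v_j in V.  For v in V the number dim M_i is the sum of the dimensions of the degree i parts of
  M / v M and of v M, the latter being generated in degree 1, and binom(i + p, i) is
  binom(i + p - 1, i) + binom(i - 1 + p, i - 1).  If M / v M satisfies the bound for p - 1 for some v,
  then adjoin v to the sequence obtained for M / v M.  Otherwise v M satisfies the bound for i - 1 for
  every v.  A sequence that is good for v M remains good at all but finitely many residue classes of
  the parameter of a polynomial path, so one sequence is good for the finitely many v that are needed
  to span M_i, because the residue field is infinite.  The theorem is the case of the fiber cone
  itself, by Nakayama's lemma.
*)

theory Submission
  imports Defs
begin

section \<open>Ideals and units\<close>

text \<open>No quotient module is ever formed. A graded component is a pair of ideals
  \<open>L k\<close> inside \<open>N k\<close> with \<open>\<mm>\<close> times \<open>N k\<close>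
  inside \<open>L k\<close>; passing to M / v M enlarges \<open>L\<close>, and passing to v M shifts
  the degree by one. Modules are needed from the start because v M is not an algebra. Genericity
  usually refers to a Zariski open subset of a finite-dimensional parameter space. If a sequence is
  good for v M, then v M_{i-1} = (v_1, ..., v_p) v M_{i-2}, which lies in (v_1, ..., v_p) M_{i-1}.
  Summing over the v that span M_i finishes the second alternative, but only if the same sequence
  serves all of them; this is why a common sequence has to be found. Characteristic zero enters only
  through polarization: it recovers a product of elements from values of a product of linear forms
  up to a positive integer, such as b! for b-th powers, and this integer has to be a unit.\<close>

lemma (in cring) cring_idealI:
  assumes "Y \<subseteq> carrier R" "\<zero> \<in> Y"
    and "\<And>x y. x \<in> Y \<Longrightarrow> y \<in> Y \<Longrightarrow> x \<oplus> y \<in> Y"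
    and mult: "\<And>a x. a \<in> carrier R \<Longrightarrow> x \<in> Y \<Longrightarrow> a \<otimes> x \<in> Y"
  shows "ideal Y R"
proof (rule idealI)
  show "subgroup Y (add_monoid R)"
  proof (rule add.subgroupI)
    fix x assume x: "x \<in> Y"
    then have "(\<ominus> \<one>) \<otimes> x \<in> Y" by (intro mult) auto
    then show "\<ominus> x \<in> Y" using x assms(1) by (simp add: l_minus subset_iff)
  qed (use assms in auto)
next
  fix a x assume "a \<in> Y" "x \<in> carrier R"
  moreover from this have "a \<otimes> x = x \<otimes> a"
    using assms(1) by (intro m_comm) auto
  ultimately show "x \<otimes> a \<in> Y" "a \<otimes> x \<in> Y"
    using mult[of x a] by simp_all
qed (rule ring_axioms)

lemma (in ring) ideal_minus_closed:
  assumes "ideal Y R" "x \<in> Y" "y \<in> Y"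
  shows "x \<ominus> y \<in> Y"
proof -
  interpret ideal Y R by fact
  show ?thesis using assms by (simp add: a_minus_def)
qed

lemma (in ring) ideal_add_closed:
  assumes "ideal Y R" "x \<in> Y" "y \<in> Y"
  shows "x \<oplus> y \<in> Y"
proof -
  interpret ideal Y R by fact
  show ?thesis using assms by simp
qed

lemma (in ring) ideal_zero_closed: "ideal Y R \<Longrightarrow> \<zero> \<in> Y"
  by (simp add: additive_subgroup.zero_closed ideal.axioms(1))

lemma (in ring) ideal_subset_carrier: "ideal Y R \<Longrightarrow> Y \<subseteq> carrier R"
  by (simp add: additive_subgroup.a_subset ideal.axioms(1))

lemma (in ring) ideal_unit_cancel:
  assumes "ideal Y R" "u \<in> Units R" "y \<in> carrier R" "u \<otimes> y \<in> Y"
  shows "y \<in> Y"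
proof -
  have "y = (inv u \<otimes> u) \<otimes> y" using assms by simp
  also have "\<dots> = inv u \<otimes> (u \<otimes> y)" using assms by (intro m_assoc) auto
  also have "\<dots> \<in> Y" using assms by (auto intro: ideal.I_l_closed[OF assms(1,4)])
  finally show ?thesis .
qed

text \<open>Reduces claims about multiples to generators: multiplication by \<open>g\<close> sends a
  generated ideal into \<open>Y\<close> as soon as the generators lie in this ideal.\<close>

lemma (in cring) ideal_colon:
  assumes "ideal Y R" "g \<in> carrier R"
  shows "ideal {z \<in> carrier R. g \<otimes> z \<in> Y} R"
proof (rule cring_idealI)
  fix a x assume "a \<in> carrier R" and "x \<in> {z \<in> carrier R. g \<otimes> z \<in> Y}"
  then show "a \<otimes> x \<in> {z \<in> carrier R. g \<otimes> z \<in> Y}"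
    using assms ideal.I_l_closed[OF assms(1), of "g \<otimes> x" a] by (simp add: m_lcomm)
qed (use assms in \<open>auto simp: r_distr ideal_zero_closed intro: ideal_add_closed\<close>)

lemma (in cring) Idl_mono:
  assumes "T \<subseteq> carrier R" "S \<subseteq> Idl T"
  shows "Idl S \<subseteq> Idl T"
  using assms by (intro genideal_minimal genideal_ideal)

text \<open>Splitting off one generator at a time lets inductions over finite generating sets avoid
  explicit linear combinations.\<close>

lemma (in cring) mem_Idl_insertD:
  assumes "S \<subseteq> carrier R" "s \<in> carrier R" "x \<in> Idl (insert s S)"
  obtains a z where "a \<in> carrier R" "z \<in> Idl S" "x = a \<otimes> s \<oplus> z"
proof -
  let ?X = "{a \<otimes> s \<oplus> z |a z. a \<in> carrier R \<and> z \<in> Idl S}"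
  have S: "ideal (Idl S) R" by (rule genideal_ideal) fact
  note c = subsetD[OF ideal_subset_carrier[OF S]]
  have "ideal ?X R"
  proof (rule cring_idealI)
    show "\<zero> \<in> ?X" using assms ideal_zero_closed[OF S]
      by (auto intro!: exI[of _ \<zero>])
  next
    fix x y assume "x \<in> ?X" "y \<in> ?X"
    then obtain a z b w where "a \<in> carrier R" "z \<in> Idl S" "x = a \<otimes> s \<oplus> z"
      "b \<in> carrier R" "w \<in> Idl S" "y = b \<otimes> s \<oplus> w" by auto
    moreover from this have "x \<oplus> y = (a \<oplus> b) \<otimes> s \<oplus> (z \<oplus> w)"
      using assms c by (simp add: l_distr a_ac)
    ultimately show "x \<oplus> y \<in> ?X" using ideal_add_closed[OF S] by blast
  next
    fix b x assume "b \<in> carrier R" "x \<in> ?X"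
    then obtain a z where "a \<in> carrier R" "z \<in> Idl S" "x = a \<otimes> s \<oplus> z" by auto
    moreover from this have "b \<otimes> x = (b \<otimes> a) \<otimes> s \<oplus> b \<otimes> z"
      using assms c \<open>b \<in> _\<close> by (simp add: r_distr m_assoc)
    ultimately show "b \<otimes> x \<in> ?X"
      using ideal.I_l_closed[OF S] \<open>b \<in> _\<close> by blast
  qed (use assms c in auto)
  moreover have "S \<subseteq> ?X"
  proof
    fix y assume y: "y \<in> S"
    then have "y = \<zero> \<otimes> s \<oplus> y" "y \<in> Idl S"
      using assms genideal_self[OF assms(1)] by auto
    then show "y \<in> ?X" by blast
  qed
  moreover have "s \<in> ?X"
  proof -
    have "s = \<one> \<otimes> s \<oplus> \<zero>" using assms by simp
    then show ?thesis using ideal_zero_closed[OF S] by blast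
  qed
  ultimately have "Idl (insert s S) \<subseteq> ?X" by (intro genideal_minimal) auto
  then show ?thesis using assms(3) that by auto
qed

text \<open>Zorn's lemma applies because properness, expressed as absence of \<open>\<one>\<close>,
  passes to unions of chains.\<close>

lemma (in cring) proper_ideal_subset_maximalideal:
  assumes "ideal Y R" "\<one> \<notin> Y"
  obtains M where "maximalideal M R" "Y \<subseteq> M"
proof -
  let ?P = "{J. ideal J R \<and> Y \<subseteq> J \<and> \<one> \<notin> J}"
  have "\<exists>M\<in>?P. \<forall>J\<in>?P. M \<subseteq> J \<longrightarrow> J = M"
  proof (rule subset_Zorn_nonempty)
    show "?P \<noteq> {}" using assms by auto
    fix C assume C: "C \<noteq> {}" "subset.chain ?P C"
    then have sub: "C \<subseteq> ?P" by (simp add: subset.chain_def)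
    have tot: "x \<in> C \<Longrightarrow> y \<in> C \<Longrightarrow> x \<subseteq> y \<or> y \<subseteq> x" for x y
      using C(2) by (auto simp: subset_chain_def)
    have "ideal (\<Union>C) R"
    proof (rule cring_idealI)
      show "\<Union>C \<subseteq> carrier R" using sub ideal_subset_carrier by (force dest!: subsetD)
      show "\<zero> \<in> \<Union>C" 
      proof -
        obtain J where "J \<in> C" using C(1) by blast
        then show ?thesis using sub ideal_zero_closed[of J] by auto
      qed
      fix x y assume "x \<in> \<Union>C" "y \<in> \<Union>C"
      then obtain J where "J \<in> C" "x \<in> J" "y \<in> J" using tot by blast
      moreover from this have "ideal J R" using sub by auto
      ultimately show "x \<oplus> y \<in> \<Union>C" using ideal_add_closed by auto
    next
      fix a x assume a: "a \<in> carrier R" and "x \<in> \<Union>C"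
      then obtain J where J: "J \<in> C" "x \<in> J" by blast
      then have "ideal J R" using sub by auto
      then show "a \<otimes> x \<in> \<Union>C" using ideal.I_l_closed[OF _ J(2) a] J(1) by auto
    qed
    then show "\<Union>C \<in> ?P" using C(1) sub by blast
  qed
  then obtain M where "M \<in> ?P" and "\<forall>J\<in>?P. M \<subseteq> J \<longrightarrow> J = M" ..
  then have M: "ideal M R" "Y \<subseteq> M" "\<one> \<notin> M"
    and max: "\<And>J. \<lbrakk>ideal J R; Y \<subseteq> J; \<one> \<notin> J; M \<subseteq> J\<rbrakk> \<Longrightarrow> J = M" by simp_all
  have "maximalideal M R"
  proof (rule maximalidealI)
    show "carrier R \<noteq> M" using M(3) by auto
    fix J assume "ideal J R" "M \<subseteq> J" "J \<subseteq> carrier R"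
    then show "J = M \<or> J = carrier R"
      using max[of J] M(2) ideal.one_imp_carrier[of J R] by (metis order_trans)
  qed (fact M)
  with M that show ?thesis by blast
qed

context local_ring
begin

lemma one_notin_maximal: "\<one> \<notin> \<mm>"
  using I_notcarr one_imp_carrier by auto

text \<open>A nonunit generates a proper principal ideal, and the only maximal ideal that can
  contain it is \<open>\<mm>\<close>.\<close>

lemma Units_if_notin_maximal:
  assumes "x \<in> carrier A" "x \<notin> \<mm>"
  shows "x \<in> Units A"
proof (rule ccontr)
  assume nu: "x \<notin> Units A"
  have "\<one> \<notin> PIdl x"
  proof
    assume "\<one> \<in> PIdl x"
    then obtain y where "y \<in> carrier A" "y \<otimes> x = \<one>" by (auto simp: cgenideal_def)
    moreover from this have "x \<otimes> y = \<one>" using m_comm[OF assms(1)] by simp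
    ultimately show False using nu assms(1) by (auto simp: Units_def)
  qed
  then obtain M where "maximalideal M A" "PIdl x \<subseteq> M"
    using proper_ideal_subset_maximalideal cgenideal_ideal assms(1) by blast
  then show False
    using maximalideal_unique cgenideal_self[OF assms(1)] assms(2) by blast
qed

lemma maximal_prime:
  assumes "a \<in> carrier A" "b \<in> carrier A" "a \<otimes> b \<in> \<mm>"
  shows "a \<in> \<mm> \<or> b \<in> \<mm>"
  using assms ideal_unit_cancel[OF is_ideal Units_if_notin_maximal, of a b] by blast

end

section \<open>Polynomial functions\<close>

text \<open>Polynomials of degree at most \<open>d\<close> in Horner form, as functions that matter
  on the carrier only. The coefficients, and not just the values, are required to lie in
  \<open>N\<close>; this is what later allows a polynomial to be split along generators of an
  ideal.\<close>

primrec (in ring) poly_fun :: "'a set \<Rightarrow> nat \<Rightarrow> ('a \<Rightarrow> 'a) set"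
  where
    "poly_fun N 0 = {f. \<exists>c\<in>N. \<forall>t\<in>carrier R. f t = c}"
  | "poly_fun N (Suc d) =
      {f. \<exists>c\<in>N. \<exists>g\<in>poly_fun N d. \<forall>t\<in>carrier R. f t = c \<oplus> t \<otimes> g t}"

definition (in ring) poly_funs :: "'a set \<Rightarrow> ('a \<Rightarrow> 'a) set"
  where "poly_funs N = (\<Union>d. poly_fun N d)"

context cring
begin

lemma poly_fun_SucI:
  assumes "c \<in> N" "g \<in> poly_fun N d" "\<And>t. t \<in> carrier R \<Longrightarrow> f t = c \<oplus> t \<otimes> g t"
  shows "f \<in> poly_fun N (Suc d)"
  using assms by auto

lemma poly_fun_cong:
  "f \<in> poly_fun N d \<Longrightarrow> (\<And>t. t \<in> carrier R \<Longrightarrow> g t = f t) \<Longrightarrow> g \<in> poly_fun N d"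
  by (cases d) auto

lemma poly_fun_closed:
  assumes "ideal N R"
  shows "f \<in> poly_fun N d \<Longrightarrow> t \<in> carrier R \<Longrightarrow> f t \<in> N"
proof (induction d arbitrary: f)
  case (Suc d)
  then obtain c g where "c \<in> N" "g \<in> poly_fun N d" "f t = c \<oplus> t \<otimes> g t" by auto
  with Suc show ?case
    by (simp add: ideal_add_closed[OF assms] ideal.I_l_closed[OF assms])
qed auto

lemma poly_fun_carrier:
  "ideal N R \<Longrightarrow> f \<in> poly_fun N d \<Longrightarrow> t \<in> carrier R \<Longrightarrow> f t \<in> carrier R"
  using poly_fun_closed ideal_subset_carrier by blast

lemma poly_fun_const: "ideal N R \<Longrightarrow> c \<in> N \<Longrightarrow> (\<lambda>_. c) \<in> poly_fun N d"
proof (induction d arbitrary: c)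
  case (Suc d)
  then have "(\<lambda>_. \<zero>) \<in> poly_fun N d" by (simp add: ideal_zero_closed)
  moreover have "c \<in> carrier R" using Suc.prems ideal_subset_carrier by blast
  ultimately show ?case using Suc.prems by (intro poly_fun_SucI[of c _ "\<lambda>_. \<zero>"]) auto
qed auto

lemma poly_fun_Suc:
  "ideal N R \<Longrightarrow> f \<in> poly_fun N d \<Longrightarrow> f \<in> poly_fun N (Suc d)"
proof (induction d arbitrary: f)
  case 0
  then obtain c where c: "c \<in> N" "\<forall>t\<in>carrier R. f t = c" by auto
  show ?case by (rule poly_fun_cong[OF poly_fun_const[OF 0(1) c(1)]]) (use c in auto)
next
  case (Suc d)
  then obtain c g where cg: "c \<in> N" "g \<in> poly_fun N d" "\<forall>t\<in>carrier R. f t = c \<oplus> t \<otimes> g t" by auto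
  then have "g \<in> poly_fun N (Suc d)" using Suc by blast
  with cg(1) show ?case by (rule poly_fun_SucI) (use cg(3) in blast)
qed

lemma poly_fun_mono:
  assumes "ideal N R" "f \<in> poly_fun N d" "d \<le> e"
  shows "f \<in> poly_fun N e"
  using assms(3) by (induction e rule: dec_induct) (simp_all only: assms poly_fun_Suc)

lemma poly_fun_add:
  assumes N: "ideal N R"
  shows "f \<in> poly_fun N d \<Longrightarrow> g \<in> poly_fun N d \<Longrightarrow> (\<lambda>t. f t \<oplus> g t) \<in> poly_fun N d"
proof (induction d arbitrary: f g)
  case 0
  then show ?case using ideal_add_closed[OF N] by auto
next
  case (Suc d)
  then obtain c f' b g' where f: "c \<in> N" "f' \<in> poly_fun N d" "\<forall>t\<in>carrier R. f t = c \<oplus> t \<otimes> f' t"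
    and g: "b \<in> N" "g' \<in> poly_fun N d" "\<forall>t\<in>carrier R. g t = b \<oplus> t \<otimes> g' t" by auto
  have "f t \<oplus> g t = (c \<oplus> b) \<oplus> t \<otimes> (f' t \<oplus> g' t)" if t: "t \<in> carrier R" for t
  proof -
    have "f' t \<in> carrier R" "g' t \<in> carrier R" "c \<in> carrier R" "b \<in> carrier R"
      using poly_fun_carrier[OF N f(2) t] poly_fun_carrier[OF N g(2) t]
        f(1) g(1) ideal_subset_carrier[OF N] by auto
    then show ?thesis using f(3) g(3) t by (simp add: r_distr a_ac)
  qed
  moreover have "(\<lambda>t. f' t \<oplus> g' t) \<in> poly_fun N d" using Suc.IH f g by blast
  moreover have "c \<oplus> b \<in> N" using f g ideal_add_closed[OF N] by blast
  ultimately show ?case by (intro poly_fun_SucI)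
qed

lemma poly_fun_times_var:
  assumes N: "ideal N R" and "f \<in> poly_fun N d"
  shows "(\<lambda>t. t \<otimes> f t) \<in> poly_fun N (Suc d)"
proof -
  have "t \<otimes> f t = \<zero> \<oplus> t \<otimes> f t" if "t \<in> carrier R" for t
    using that poly_fun_closed[OF assms that] ideal_subset_carrier[OF N] by auto
  then show ?thesis using assms(2) ideal_zero_closed[OF N] by (intro poly_fun_SucI)
qed

lemma poly_fun_cmult:
  assumes N: "ideal N R" and M: "ideal M R" and c: "c \<in> carrier R" "\<And>y. y \<in> M \<Longrightarrow> c \<otimes> y \<in> N"
  shows "f \<in> poly_fun M d \<Longrightarrow> (\<lambda>t. c \<otimes> f t) \<in> poly_fun N d"
proof (induction d arbitrary: f)
  case 0
  then show ?case using c by auto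
next
  case (Suc d)
  then obtain b g where f: "b \<in> M" "g \<in> poly_fun M d" "\<forall>t\<in>carrier R. f t = b \<oplus> t \<otimes> g t" by auto
  have "c \<otimes> f t = c \<otimes> b \<oplus> t \<otimes> (c \<otimes> g t)" if t: "t \<in> carrier R" for t
  proof -
    have "g t \<in> carrier R" "b \<in> carrier R"
      using poly_fun_carrier[OF M f(2) t] f(1) ideal_subset_carrier[OF M] by auto
    then show ?thesis using f(3) t c(1) by (simp add: r_distr m_lcomm)
  qed
  then show ?case using Suc.IH[OF f(2)] c(2)[OF f(1)] by (intro poly_fun_SucI)
qed

lemma poly_fun_mult:
  assumes N: "ideal N R" and M: "ideal M R" and L: "ideal L R"
    and NML: "\<And>x y. x \<in> N \<Longrightarrow> y \<in> M \<Longrightarrow> x \<otimes> y \<in> L"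
    and g: "g \<in> poly_fun M e"
  shows "f \<in> poly_fun N d \<Longrightarrow> (\<lambda>t. f t \<otimes> g t) \<in> poly_fun L (d + e)"
proof (induction d arbitrary: f)
  case 0
  then obtain c where c: "c \<in> N" "\<forall>t\<in>carrier R. f t = c" by auto
  then have "(\<lambda>t. c \<otimes> g t) \<in> poly_fun L e"
    using NML ideal_subset_carrier[OF N] by (intro poly_fun_cmult[OF L M _ _ g]) auto
  then show ?case using c by (auto intro: poly_fun_cong)
next
  case (Suc d)
  then obtain c f' where f: "c \<in> N" "f' \<in> poly_fun N d" "\<forall>t\<in>carrier R. f t = c \<oplus> t \<otimes> f' t" by auto
  have "(\<lambda>t. c \<otimes> g t) \<in> poly_fun L e"
    using NML f(1) ideal_subset_carrier[OF N] by (intro poly_fun_cmult[OF L M _ _ g]) auto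
  then have "(\<lambda>t. c \<otimes> g t) \<in> poly_fun L (Suc (d + e))" by (rule poly_fun_mono[OF L]) simp
  moreover have "(\<lambda>t. t \<otimes> (f' t \<otimes> g t)) \<in> poly_fun L (Suc (d + e))"
    by (intro poly_fun_times_var L Suc.IH f)
  ultimately have "(\<lambda>t. c \<otimes> g t \<oplus> t \<otimes> (f' t \<otimes> g t)) \<in> poly_fun L (Suc (d + e))"
    by (rule poly_fun_add[OF L])
  then have "(\<lambda>t. f t \<otimes> g t) \<in> poly_fun L (Suc (d + e))"
  proof (rule poly_fun_cong)
    fix t assume t: "t \<in> carrier R"
    have "f' t \<in> carrier R" "c \<in> carrier R" "g t \<in> carrier R"
      using poly_fun_carrier[OF N f(2) t] poly_fun_carrier[OF M g t]
        f(1) ideal_subset_carrier[OF N] by auto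
    then show "f t \<otimes> g t = c \<otimes> g t \<oplus> t \<otimes> (f' t \<otimes> g t)"
      using f(3) t by (simp add: l_distr m_assoc)
  qed
  then show ?case by simp
qed

text \<open>The factor theorem, run along the Horner form: if f(t) = c + t g(t), then f(t) -
  f(\<tau>) = (t - \<tau>) g(t) + \<tau> (g(t) - g(\<tau>)), and the recursion continues with g. It
  serves both to bound roots modulo \<open>\<mm>\<close> and to interpolate membership in an
  ideal.\<close>

lemma poly_fun_diff_factor:
  assumes N: "ideal N R" and \<tau>: "\<tau> \<in> carrier R"
  shows "f \<in> poly_fun N (Suc d) \<Longrightarrow>
    \<exists>q\<in>poly_fun N d. \<forall>t\<in>carrier R. f t \<ominus> f \<tau> = (t \<ominus> \<tau>) \<otimes> q t"
proof (induction d arbitrary: f)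
  case 0
  then obtain c b where f: "c \<in> N" "\<forall>t\<in>carrier R. f t = c \<oplus> t \<otimes> b" "b \<in> N"
    by fastforce
  have "f t \<ominus> f \<tau> = (t \<ominus> \<tau>) \<otimes> b" if t: "t \<in> carrier R" for t
  proof -
    have "b \<in> carrier R" "c \<in> carrier R" using f ideal_subset_carrier[OF N] by auto
    then show ?thesis using f \<tau> t by simp algebra
  qed
  then show ?case using f(3) by auto
next
  case (Suc d)
  then obtain c g where f: "c \<in> N" "g \<in> poly_fun N (Suc d)" "\<forall>t\<in>carrier R. f t = c \<oplus> t \<otimes> g t"
    by (subst (asm) poly_fun.simps) blast
  obtain q where q: "q \<in> poly_fun N d" "\<forall>t\<in>carrier R. g t \<ominus> g \<tau> = (t \<ominus> \<tau>) \<otimes> q t"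
    using Suc.IH[OF f(2)] by blast
  have "(\<lambda>t. \<tau> \<otimes> q t) \<in> poly_fun N (Suc d)"
    by (intro poly_fun_cmult[OF N N \<tau> ideal.I_l_closed[OF N]] poly_fun_Suc N q \<tau>)
  then have "(\<lambda>t. g t \<oplus> \<tau> \<otimes> q t) \<in> poly_fun N (Suc d)"
    by (rule poly_fun_add[OF N f(2)])
  moreover have "f t \<ominus> f \<tau> = (t \<ominus> \<tau>) \<otimes> (g t \<oplus> \<tau> \<otimes> q t)" if t: "t \<in> carrier R" for t
  proof -
    have c: "g t \<in> carrier R" "g \<tau> \<in> carrier R" "q t \<in> carrier R" "c \<in> carrier R"
      using poly_fun_carrier[OF N f(2) t] poly_fun_carrier[OF N f(2) \<tau>]
        poly_fun_carrier[OF N q(1) t] f(1) ideal_subset_carrier[OF N] by auto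
    have "f t \<ominus> f \<tau> = (t \<ominus> \<tau>) \<otimes> g t \<oplus> \<tau> \<otimes> (g t \<ominus> g \<tau>)"
      using c f(3) t \<tau> by simp algebra
    also have "\<dots> = (t \<ominus> \<tau>) \<otimes> g t \<oplus> \<tau> \<otimes> ((t \<ominus> \<tau>) \<otimes> q t)" using q(2) t by simp
    also have "\<dots> = (t \<ominus> \<tau>) \<otimes> (g t \<oplus> \<tau> \<otimes> q t)" using c t \<tau> by algebra
    finally show ?thesis .
  qed
  ultimately show ?case by (intro bexI[of _ "\<lambda>t. g t \<oplus> \<tau> \<otimes> q t"] ballI)
qed

text \<open>The coordinate with respect to \<open>s\<close> is not unique, so a pointwise choice
  need not be polynomial in \<open>t\<close>. Choosing it for each coefficient separately makes it
  polynomial.\<close>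

lemma poly_fun_insert_decomp:
  assumes S: "S \<subseteq> carrier R" and s: "s \<in> carrier R"
  shows "f \<in> poly_fun (Idl (insert s S)) d \<Longrightarrow>
    \<exists>\<alpha>\<in>poly_fun (carrier R) d. \<exists>g\<in>poly_fun (Idl S) d. \<forall>t\<in>carrier R. f t = \<alpha> t \<otimes> s \<oplus> g t"
proof (induction d arbitrary: f)
  case 0
  then obtain c where c: "c \<in> Idl (insert s S)" "\<forall>t\<in>carrier R. f t = c" by auto
  obtain a z where "a \<in> carrier R" "z \<in> Idl S" "c = a \<otimes> s \<oplus> z"
    using mem_Idl_insertD[OF S s c(1)] by blast
  then show ?case using c(2)
    by (intro bexI[of _ "\<lambda>_. a"] bexI[of _ "\<lambda>_. z"]) auto
next
  case (Suc d)
  then obtain c h where c: "c \<in> Idl (insert s S)" and h: "h \<in> poly_fun (Idl (insert s S)) d"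
    and f: "\<forall>t\<in>carrier R. f t = c \<oplus> t \<otimes> h t" by auto
  obtain a z where az: "a \<in> carrier R" "z \<in> Idl S" "c = a \<otimes> s \<oplus> z"
    using mem_Idl_insertD[OF S s c(1)] by blast
  obtain \<alpha> g where \<alpha>: "\<alpha> \<in> poly_fun (carrier R) d" and g: "g \<in> poly_fun (Idl S) d"
    and hg: "\<forall>t\<in>carrier R. h t = \<alpha> t \<otimes> s \<oplus> g t"
    using Suc.IH[OF h] by blast
  have I: "ideal (Idl S) R" by (rule genideal_ideal[OF S])
  have "(\<lambda>t. a \<oplus> t \<otimes> \<alpha> t) \<in> poly_fun (carrier R) (Suc d)"
    using az(1) \<alpha> by auto
  moreover have "(\<lambda>t. z \<oplus> t \<otimes> g t) \<in> poly_fun (Idl S) (Suc d)"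
    using az(2) g by auto
  moreover have "\<forall>t\<in>carrier R. f t = (a \<oplus> t \<otimes> \<alpha> t) \<otimes> s \<oplus> (z \<oplus> t \<otimes> g t)"
  proof
    fix t assume t: "t \<in> carrier R"
    have "\<alpha> t \<in> carrier R" "g t \<in> carrier R" "z \<in> carrier R"
      using poly_fun_carrier[OF oneideal \<alpha> t] poly_fun_carrier[OF I g t]
        az(2) ideal_subset_carrier[OF I] by auto
    then show "f t = (a \<oplus> t \<otimes> \<alpha> t) \<otimes> s \<oplus> (z \<oplus> t \<otimes> g t)"
      using az t s f hg by simp algebra
  qed
  ultimately show ?case by (intro bexI[of _ "\<lambda>t. a \<oplus> t \<otimes> \<alpha> t"] bexI[of _ "\<lambda>t. z \<oplus> t \<otimes> g t"])
qed

lemma poly_funs_closed: "ideal N R \<Longrightarrow> f \<in> poly_funs N \<Longrightarrow> t \<in> carrier R \<Longrightarrow> f t \<in> N"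
  by (auto simp: poly_funs_def poly_fun_closed)

lemma poly_funs_const: "ideal N R \<Longrightarrow> c \<in> N \<Longrightarrow> (\<lambda>_. c) \<in> poly_funs N"
  by (auto simp: poly_funs_def poly_fun_const simp del: poly_fun.simps)

lemma poly_funs_id: "(\<lambda>t. t) \<in> poly_funs (carrier R)"
proof -
  have "(\<lambda>t. t \<otimes> \<one>) \<in> poly_fun (carrier R) (Suc 0)"
    by (intro poly_fun_times_var oneideal poly_fun_const) auto
  then have "(\<lambda>t. t) \<in> poly_fun (carrier R) (Suc 0)" by (rule poly_fun_cong) simp
  then show ?thesis by (auto simp only: poly_funs_def)
qed

lemma poly_funs_cong:
  "f \<in> poly_funs N \<Longrightarrow> (\<And>t. t \<in> carrier R \<Longrightarrow> g t = f t) \<Longrightarrow> g \<in> poly_funs N"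
  unfolding poly_funs_def using poly_fun_cong by blast

lemma poly_funs_mult:
  assumes "ideal N R" "ideal M R" "ideal L R"
    and "\<And>x y. x \<in> N \<Longrightarrow> y \<in> M \<Longrightarrow> x \<otimes> y \<in> L"
    and "f \<in> poly_funs N" "g \<in> poly_funs M"
  shows "(\<lambda>t. f t \<otimes> g t) \<in> poly_funs L"
  using assms(5,6) poly_fun_mult[OF assms(1-4)] unfolding poly_funs_def by blast

lemma poly_funs_add:
  assumes N: "ideal N R" and "f \<in> poly_funs N" "g \<in> poly_funs N"
  shows "(\<lambda>t. f t \<oplus> g t) \<in> poly_funs N"
proof -
  obtain d e where "f \<in> poly_fun N d" "g \<in> poly_fun N e"
    using assms by (auto simp: poly_funs_def)
  then have "f \<in> poly_fun N (max d e)" "g \<in> poly_fun N (max d e)"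
    by (auto intro: poly_fun_mono[OF N])
  then show ?thesis using poly_fun_add[OF N] unfolding poly_funs_def by blast
qed

lemma poly_funs_mult_left:
  assumes "ideal N R" "f \<in> poly_funs (carrier R)" "g \<in> poly_funs N"
  shows "(\<lambda>t. f t \<otimes> g t) \<in> poly_funs N"
  by (rule poly_funs_mult[OF oneideal assms(1,1) _ assms(2,3)])
    (rule ideal.I_l_closed[OF assms(1)])

lemma poly_funs_minus:
  assumes N: "ideal N R" and f: "f \<in> poly_funs N" and g: "g \<in> poly_funs N"
  shows "(\<lambda>t. f t \<ominus> g t) \<in> poly_funs N"
proof -
  have "(\<lambda>t. (\<lambda>_. \<ominus> \<one>) t \<otimes> g t) \<in> poly_funs N"
    by (intro poly_funs_mult_left N g poly_funs_const oneideal) auto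
  then have "(\<lambda>t. f t \<oplus> \<ominus> \<one> \<otimes> g t) \<in> poly_funs N"
    by (intro poly_funs_add N f)
  then show ?thesis
  proof (rule poly_funs_cong)
    fix t assume "t \<in> carrier R"
    then have "f t \<in> carrier R" "g t \<in> carrier R"
      using poly_funs_closed[OF N f] poly_funs_closed[OF N g] ideal_subset_carrier[OF N] by auto
    then show "f t \<ominus> g t = f t \<oplus> \<ominus> \<one> \<otimes> g t" by algebra
  qed
qed

lemma poly_funs_insert_decomp:
  assumes "S \<subseteq> carrier R" "s \<in> carrier R" "f \<in> poly_funs (Idl (insert s S))"
  obtains \<alpha> g where "\<alpha> \<in> poly_funs (carrier R)" "g \<in> poly_funs (Idl S)"
    "\<And>t. t \<in> carrier R \<Longrightarrow> f t = \<alpha> t \<otimes> s \<oplus> g t"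
proof -
  obtain d where "f \<in> poly_fun (Idl (insert s S)) d" using assms(3) by (auto simp: poly_funs_def)
  from poly_fun_insert_decomp[OF assms(1,2) this] that show ?thesis
    by (auto simp: poly_funs_def)
qed

end

section \<open>Exceptional sets of parameters modulo the maximal ideal\<close>

context local_ring
begin

text \<open>Sets of ring elements that meet only finitely many residue classes play the role of the
  proper Zariski closed subsets of the affine line over the residue field.\<close>

definition small :: "'a set \<Rightarrow> bool"
  where "small B \<longleftrightarrow> finite ((\<lambda>t. \<mm> +> t) ` B)"

lemma small_empty: "small {}"
  by (simp add: small_def)

lemma small_mono: "small C \<Longrightarrow> B \<subseteq> C \<Longrightarrow> small B"
  unfolding small_def by (meson finite_subset image_mono)

lemma small_Un: "small B \<Longrightarrow> small C \<Longrightarrow> small (B \<union> C)"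
  unfolding small_def by (simp add: image_Un)

lemma small_UN: "finite F \<Longrightarrow> (\<And>k. k \<in> F \<Longrightarrow> small (B k)) \<Longrightarrow> small (\<Union>k\<in>F. B k)"
  by (induction F rule: finite_induct) (auto intro: small_Un simp: small_empty)

lemma small_coset:
  assumes "\<tau> \<in> carrier A"
  shows "small {t \<in> carrier A. t \<ominus> \<tau> \<in> \<mm>}"
proof -
  have "(\<lambda>t. \<mm> +> t) ` {t \<in> carrier A. t \<ominus> \<tau> \<in> \<mm>} \<subseteq> {\<mm> +> \<tau>}"
    using quotient_eq_iff_same_a_r_cos[OF is_ideal _ assms] by auto
  then show ?thesis unfolding small_def using finite_subset by blast
qed

lemma carrier_not_small:
  assumes "infinite (carrier (A Quot \<mm>))"
  shows "\<not> small (carrier A)"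
proof -
  have "carrier (A Quot \<mm>) = (\<lambda>t. \<mm> +> t) ` carrier A"
    by (auto simp: FactRing_def A_RCOSETS_def')
  then show ?thesis using assms by (simp add: small_def)
qed

text \<open>Each root modulo \<open>\<mm>\<close> splits off a linear factor. The cofactor is still
  outside \<open>\<mm>\<close> at \<open>a\<close>, and \<open>\<mm>\<close> is prime, so the
  remaining roots are roots of a polynomial of smaller degree.\<close>

lemma poly_fun_roots_small:
  assumes "a \<in> carrier A"
  shows "f \<in> poly_fun (carrier A) d \<Longrightarrow> f a \<notin> \<mm> \<Longrightarrow> small {t \<in> carrier A. f t \<in> \<mm>}"
proof (induction d arbitrary: f)
  case 0
  then have "{t \<in> carrier A. f t \<in> \<mm>} = {}" using assms by auto
  then show ?case by (simp only: small_empty)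
next
  case (Suc d)
  show ?case
  proof (cases "{t \<in> carrier A. f t \<in> \<mm>} = {}")
    case True
    then show ?thesis by (simp only: small_empty)
  next
    case False
    then obtain \<tau> where \<tau>: "\<tau> \<in> carrier A" "f \<tau> \<in> \<mm>" by auto
    obtain q where q: "q \<in> poly_fun (carrier A) d"
      and fq: "\<And>t. t \<in> carrier A \<Longrightarrow> f t \<ominus> f \<tau> = (t \<ominus> \<tau>) \<otimes> q t"
      using poly_fun_diff_factor[OF oneideal \<tau>(1) Suc.prems(1)] by auto
    have f: "f t \<in> carrier A" and qc: "q t \<in> carrier A" if "t \<in> carrier A" for t
      using poly_fun_carrier[OF oneideal Suc.prems(1) that] poly_fun_carrier[OF oneideal q that] by auto
    have "q a \<notin> \<mm>"
    proof
      assume "q a \<in> \<mm>"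
      then have "f a \<ominus> f \<tau> \<in> \<mm>" using fq[OF assms] assms \<tau>(1) I_l_closed by simp
      then have "f a \<ominus> f \<tau> \<oplus> f \<tau> \<in> \<mm>" using \<tau>(2) by simp
      moreover have "f a \<ominus> f \<tau> \<oplus> f \<tau> = f a" using f[OF assms] f[OF \<tau>(1)] by algebra
      ultimately show False using Suc.prems(2) by simp
    qed
    then have "small ({t \<in> carrier A. t \<ominus> \<tau> \<in> \<mm>} \<union> {t \<in> carrier A. q t \<in> \<mm>})"
      by (intro small_Un small_coset \<tau> Suc.IH q)
    moreover have "{t \<in> carrier A. f t \<in> \<mm>} \<subseteq>
      {t \<in> carrier A. t \<ominus> \<tau> \<in> \<mm>} \<union> {t \<in> carrier A. q t \<in> \<mm>}"
    proof
      fix t assume "t \<in> {t \<in> carrier A. f t \<in> \<mm>}"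
      then have t: "t \<in> carrier A" "f t \<in> \<mm>" by auto
      have "(t \<ominus> \<tau>) \<otimes> q t \<in> \<mm>"
        using ideal_minus_closed[OF is_ideal t(2) \<tau>(2)] fq[OF t(1)] by simp
      then show "t \<in> {t \<in> carrier A. t \<ominus> \<tau> \<in> \<mm>} \<union> {t \<in> carrier A. q t \<in> \<mm>}"
        using maximal_prime[of "t \<ominus> \<tau>" "q t"] t(1) \<tau>(1) qc by auto
    qed
    ultimately show ?thesis by (rule small_mono)
  qed
qed

lemma poly_funs_roots_small:
  "a \<in> carrier A \<Longrightarrow> f \<in> poly_funs (carrier A) \<Longrightarrow> f a \<notin> \<mm> \<Longrightarrow> small {t \<in> carrier A. f t \<in> \<mm>}"
  unfolding poly_funs_def using poly_fun_roots_small by blast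

text \<open>Interpolation without a Vandermonde determinant: the difference quotient at a good point
  \<open>s\<close> again has values in \<open>E\<close> off a small set, because differences of
  noncongruent parameters are units. Induction on the degree then covers all parameters.\<close>

lemma poly_fun_mem_ideal:
  assumes inf: "infinite (carrier (A Quot \<mm>))" and E: "ideal E A"
  shows "f \<in> poly_fun (carrier A) d \<Longrightarrow> small B \<Longrightarrow>
    (\<And>t. t \<in> carrier A \<Longrightarrow> t \<notin> B \<Longrightarrow> f t \<in> E) \<Longrightarrow> t \<in> carrier A \<Longrightarrow> f t \<in> E"
proof (induction d arbitrary: f B t)
  case (0 f B t)
  obtain s where "s \<in> carrier A" "s \<notin> B"
    using carrier_not_small[OF inf] small_mono[OF 0(2)] by blast
  then show ?case using 0 by auto
next
  case (Suc d f B t)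
  obtain s where s: "s \<in> carrier A" "s \<notin> B"
    using carrier_not_small[OF inf] small_mono[OF Suc.prems(2)] by blast
  obtain q where q: "q \<in> poly_fun (carrier A) d"
    and fq: "\<And>t. t \<in> carrier A \<Longrightarrow> f t \<ominus> f s = (t \<ominus> s) \<otimes> q t"
    using poly_fun_diff_factor[OF oneideal s(1) Suc.prems(1)] by auto
  have "q t \<in> E"
  proof (rule Suc.IH[OF q])
    \<comment> \<open>The residue class of \<open>s\<close> joins the exceptional set, so that
      \<open>r \<ominus> s\<close> is invertible at every other parameter \<open>r\<close>.\<close>
    show "small (B \<union> {t \<in> carrier A. t \<ominus> s \<in> \<mm>})"
      by (intro small_Un small_coset s Suc.prems)
    fix r assume r: "r \<in> carrier A" "r \<notin> B \<union> {t \<in> carrier A. t \<ominus> s \<in> \<mm>}"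
    then have "r \<ominus> s \<in> Units A" using s by (intro Units_if_notin_maximal) auto
    moreover have "(r \<ominus> s) \<otimes> q r \<in> E"
      using fq[OF r(1)] ideal_minus_closed[OF E Suc.prems(3) Suc.prems(3), of r s] r s by simp
    ultimately show "q r \<in> E"
      using ideal_unit_cancel[OF E] poly_fun_carrier[OF oneideal q r(1)] by blast
  qed fact
  then have "f s \<oplus> (t \<ominus> s) \<otimes> q t \<in> E"
    using Suc.prems s by (intro ideal_add_closed[OF E] ideal.I_l_closed[OF E]) auto
  moreover have "f s \<oplus> (f t \<ominus> f s) = f t"
    using poly_fun_carrier[OF oneideal Suc.prems(1)] s(1) Suc.prems(4) by algebra
  ultimately show ?case using fq[OF Suc.prems(4)] by simp
qed

section \<open>Generation modulo an ideal\<close>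

lemma exchange_generator:
  assumes L: "ideal L A" and x: "x \<in> carrier A" "x \<notin> L"
  shows "finite S \<Longrightarrow> S \<subseteq> carrier A \<Longrightarrow> (\<And>c s. c \<in> \<mm> \<Longrightarrow> s \<in> S \<Longrightarrow> c \<otimes> s \<in> L) \<Longrightarrow> x \<in> Idl (L \<union> S) \<Longrightarrow>
    \<exists>s\<in>S. s \<in> Idl (L \<union> insert x (S - {s}))"
proof (induction S rule: finite_induct)
  case empty
  then show ?case using x genideal_minimal[OF L, of L] by auto
next
  case (insert s S)
  note Lc = ideal_subset_carrier[OF L]
  have c: "L \<union> S \<subseteq> carrier A" "s \<in> carrier A" using insert.prems(1) Lc by auto
  have c': "L \<union> insert x S \<subseteq> carrier A" using c x by auto
  have I: "ideal (Idl (L \<union> S)) A" "ideal (Idl (L \<union> insert x S)) A"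
    using c c' by (intro genideal_ideal; simp)+
  have sub: "Idl (L \<union> S) \<subseteq> Idl (L \<union> insert x S)"
    using c' by (intro subset_Idl_subset) auto
  obtain a z where az: "a \<in> carrier A" "z \<in> Idl (L \<union> S)" "x = a \<otimes> s \<oplus> z"
    using mem_Idl_insertD[OF c, of x] insert.prems(3) by auto
  have zc: "z \<in> carrier A" using az(2) ideal_subset_carrier[OF I(1)] by auto
  show ?case
  proof (cases "a \<in> \<mm>")
    case True
    then have "a \<otimes> s \<in> Idl (L \<union> S)" using insert.prems(2) genideal_self[OF c(1)] by auto
    then have "x \<in> Idl (L \<union> S)" using az ideal_add_closed[OF I(1)] by simp
    then obtain s' where s': "s' \<in> S" "s' \<in> Idl (L \<union> insert x (S - {s'}))"
      using insert.IH insert.prems by auto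
    have "Idl (L \<union> insert x (S - {s'})) \<subseteq> Idl (L \<union> insert x (insert s S - {s'}))"
      using c x by (intro subset_Idl_subset) auto
    then show ?thesis using s' by blast
  next
    case False
    have "a \<otimes> s = x \<ominus> z" using az(1,3) zc c(2) by algebra
    moreover have "x \<ominus> z \<in> Idl (L \<union> insert x S)"
      using az(2) sub genideal_self[OF c'] by (intro ideal_minus_closed[OF I(2)]) auto
    ultimately have "s \<in> Idl (L \<union> insert x S)"
      using ideal_unit_cancel[OF I(2) Units_if_notin_maximal[OF az(1) False] c(2)] by simp
    moreover have "insert s S - {s} = S" using insert.hyps by auto
    ultimately show ?thesis by auto
  qed
qed

text \<open>For ideals \<open>L\<close> inside \<open>N\<close> with \<open>\<mm>\<close> times
  \<open>N\<close> inside \<open>L\<close>, this bounds the dimension of N / L over the residue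
  field by \<open>n\<close>.\<close>

definition gen_mod :: "'a set \<Rightarrow> 'a set \<Rightarrow> nat \<Rightarrow> bool"
  where "gen_mod L N n \<longleftrightarrow> (\<exists>S. finite S \<and> S \<subseteq> N \<and> card S \<le> n \<and> N \<subseteq> Idl\<^bsub>A\<^esub> (L \<union> S))"

text \<open>Additivity of the dimension over the residue field, for \<open>N / L\<close> and its subspace \<open>M / L\<close>.\<close>

lemma gen_mod_split:
  assumes M: "ideal M A" and N: "ideal N A" "M \<subseteq> N"
  shows "ideal L A \<Longrightarrow> L \<subseteq> M \<Longrightarrow> (\<And>c y. c \<in> \<mm> \<Longrightarrow> y \<in> N \<Longrightarrow> c \<otimes> y \<in> L) \<Longrightarrow> gen_mod L N n \<Longrightarrow>
    \<exists>a b. a + b = n \<and> gen_mod M N a \<and> gen_mod L M b"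
proof (induction n arbitrary: L)
  case 0
  then have "N \<subseteq> Idl L" by (auto simp: gen_mod_def)
  then have "N \<subseteq> L" using genideal_minimal[OF 0(1), of L] by auto
  then have "N \<subseteq> M" "M \<subseteq> L" using N(2) 0(2) by auto
  then have "N \<subseteq> Idl M" "M \<subseteq> Idl L"
    using genideal_self[OF ideal_subset_carrier[OF M]]
      genideal_self[OF ideal_subset_carrier[OF 0(1)]] by (meson order_trans)+
  then have "gen_mod M N 0" "gen_mod L M 0"
    by (auto simp: gen_mod_def intro!: exI[of _ "{}"])
  then show ?case by auto
next
  case (Suc n)
  note Lc = ideal_subset_carrier[OF Suc.prems(1)] and Nc = ideal_subset_carrier[OF N(1)]
  obtain S where S: "finite S" "S \<subseteq> N" "card S \<le> Suc n" "N \<subseteq> Idl (L \<union> S)"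
    using Suc.prems(4) by (auto simp: gen_mod_def)
  show ?case
  proof (cases "M \<subseteq> L")
    case True
    then have "gen_mod L M 0" "M = L"
      using genideal_self[OF Lc] Suc.prems by (auto simp: gen_mod_def intro!: exI[of _ "{}"])
    then show ?thesis using Suc.prems(4) by (intro exI[of _ "Suc n"] exI[of _ 0]) simp
  next
    case False
    then obtain x where x: "x \<in> M" "x \<notin> L" by blast
    have xc: "x \<in> carrier A" using x N Nc by auto
    have Sc: "L \<union> S \<subseteq> carrier A" using S Lc Nc by auto
    obtain s where s: "s \<in> S" "s \<in> Idl (L \<union> insert x (S - {s}))"
    proof -
      have "S \<subseteq> carrier A" "x \<in> Idl (L \<union> S)" using S N Nc x by auto
      moreover have "c \<otimes> s \<in> L" if "c \<in> \<mm>" "s \<in> S" for c s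
        using Suc.prems(3) S(2) that by auto
      ultimately show ?thesis
        using exchange_generator[OF Suc.prems(1) xc x(2) S(1)] that by blast
    qed
    \<comment> \<open>Adjoining \<open>x\<close> to the denominator uses up one dimension of N / L,
      and that dimension belongs to M / L. Hence the recursion leaves \<open>a\<close> unchanged,
      and \<open>b\<close> grows by one on the way back.\<close>
    define L1 where "L1 = Idl (insert x L)"
    have xL: "insert x L \<subseteq> carrier A" using xc Lc by auto
    have L1: "ideal L1 A" unfolding L1_def by (rule genideal_ideal[OF xL])
    have LL1: "insert x L \<subseteq> L1" unfolding L1_def by (rule genideal_self[OF xL])
    have L1M: "L1 \<subseteq> M" unfolding L1_def using x Suc.prems by (intro genideal_minimal[OF M]) auto
    have c1: "L1 \<union> (S - {s}) \<subseteq> carrier A" using ideal_subset_carrier[OF L1] Sc by auto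
    have "Idl (L \<union> S) \<subseteq> Idl (L1 \<union> (S - {s}))"
    proof (rule Idl_mono[OF c1])
      have "Idl (L \<union> insert x (S - {s})) \<subseteq> Idl (L1 \<union> (S - {s}))"
        using LL1 by (intro subset_Idl_subset[OF c1]) auto
      then show "L \<union> S \<subseteq> Idl (L1 \<union> (S - {s}))"
        using s(2) LL1 genideal_self[OF c1] by blast
    qed
    then have "gen_mod L1 N n"
      using S s(1) by (auto simp: gen_mod_def intro!: exI[of _ "S - {s}"])
    then obtain a b where ab: "a + b = n" "gen_mod M N a" "gen_mod L1 M b"
    proof -
      have "c \<otimes> y \<in> L1" if "c \<in> \<mm>" "y \<in> N" for c y
        using Suc.prems(3)[OF that] LL1 by auto
      from Suc.IH[OF L1 L1M this] \<open>gen_mod L1 N n\<close> that show ?thesis by auto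
    qed
    obtain S2 where S2: "finite S2" "S2 \<subseteq> M" "card S2 \<le> b" "M \<subseteq> Idl (L1 \<union> S2)"
      using ab(3) by (auto simp: gen_mod_def)
    have c2: "L \<union> insert x S2 \<subseteq> carrier A" using Lc xc S2 N Nc by auto
    have "Idl (L1 \<union> S2) \<subseteq> Idl (L \<union> insert x S2)"
    proof (rule Idl_mono[OF c2])
      have "L1 \<subseteq> Idl (L \<union> insert x S2)"
        unfolding L1_def by (rule subset_Idl_subset[OF c2]) auto
      then show "L1 \<union> S2 \<subseteq> Idl (L \<union> insert x S2)" using genideal_self[OF c2] by auto
    qed
    moreover have "card (insert x S2) \<le> Suc b" using S2 by (simp add: card_insert_if)
    ultimately have "gen_mod L M (Suc b)"
      using S2 x by (auto simp: gen_mod_def intro!: exI[of _ "insert x S2"])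
    then show ?thesis using ab by (intro exI[of _ a] exI[of _ "Suc b"]) auto
  qed
qed

text \<open>Generators modulo \<open>Q\<close> are discarded one by one. The hypothesis writes a
  generator as s = a s + z with \<open>a\<close> in \<open>\<mm>\<close> and \<open>z\<close> in the
  ideal generated by \<open>Q\<close> and the other generators; since 1 - a is a unit,
  \<open>s\<close> is redundant.\<close>

lemma nakayama:
  assumes N: "ideal N A" and Q: "ideal Q A"
    and NQ: "N \<subseteq> Idl (Q \<union> {c \<otimes> y |c y. c \<in> \<mm> \<and> y \<in> N})"
  shows "finite S \<Longrightarrow> S \<subseteq> N \<Longrightarrow> N \<subseteq> Idl (Q \<union> S) \<Longrightarrow> N \<subseteq> Q"
proof (induction S rule: finite_induct)
  case empty
  then show ?case using genideal_minimal[OF Q, of Q] by auto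
next
  case (insert s S)
  note Nc = ideal_subset_carrier[OF N]
  have sc: "s \<in> carrier A" and c: "Q \<union> S \<subseteq> carrier A"
    using insert.prems(1) Nc ideal_subset_carrier[OF Q] by auto
  define Z where "Z = Idl (Q \<union> S)"
  have Z: "ideal Z A" unfolding Z_def by (rule genideal_ideal[OF c])
  note Zc = subsetD[OF ideal_subset_carrier[OF Z]]
  \<comment> \<open>\<open>B\<close> contains \<open>Q\<close> and all products of
    \<open>\<mm>\<close> and \<open>N\<close>, because every element of \<open>N\<close> is a
    multiple of \<open>s\<close> plus an element of \<open>Z\<close>.\<close>
  define B where "B = {a \<otimes> s \<oplus> z |a z. a \<in> \<mm> \<and> z \<in> Z}"
  have BI: "a \<otimes> s \<oplus> z \<in> B" if "a \<in> \<mm>" "z \<in> Z" for a z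
    using that unfolding B_def by auto
  have B: "ideal B A"
  proof (rule cring_idealI)
    show "B \<subseteq> carrier A" using sc Zc by (auto simp: B_def)
    have "\<zero> = \<zero> \<otimes> s \<oplus> \<zero>" using sc by simp
    then show "\<zero> \<in> B" using BI[OF zero_closed ideal_zero_closed[OF Z]] by simp
  next
    fix x y assume "x \<in> B" "y \<in> B"
    then obtain a z b w where "a \<in> \<mm>" "z \<in> Z" "x = a \<otimes> s \<oplus> z" "b \<in> \<mm>" "w \<in> Z" "y = b \<otimes> s \<oplus> w"
      unfolding B_def by auto
    moreover from this have "x \<oplus> y = (a \<oplus> b) \<otimes> s \<oplus> (z \<oplus> w)"
      using sc Zc by (simp add: l_distr a_ac)
    ultimately show "x \<oplus> y \<in> B" using BI ideal_add_closed[OF Z] by simp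
  next
    fix b x assume b: "b \<in> carrier A" and "x \<in> B"
    then obtain a z where az: "a \<in> \<mm>" "z \<in> Z" "x = a \<otimes> s \<oplus> z" unfolding B_def by auto
    moreover from this have "b \<otimes> x = (b \<otimes> a) \<otimes> s \<oplus> b \<otimes> z"
      using sc Zc b by (simp add: r_distr m_assoc)
    moreover have "b \<otimes> a \<in> \<mm>" "b \<otimes> z \<in> Z"
      using b az I_l_closed ideal.I_l_closed[OF Z] by auto
    ultimately show "b \<otimes> x \<in> B" using BI by simp
  qed
  have "Idl (Q \<union> {c \<otimes> y |c y. c \<in> \<mm> \<and> y \<in> N}) \<subseteq> B"
  proof (rule genideal_minimal[OF B], rule Un_least)
    show "Q \<subseteq> B"
    proof
      fix q assume q: "q \<in> Q"
      then have "q \<in> Z" unfolding Z_def using genideal_self[OF c] by auto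
      moreover from this have "q = \<zero> \<otimes> s \<oplus> q" using sc Zc by simp
      ultimately show "q \<in> B" using BI[of \<zero> q] by simp
    qed
    show "{c \<otimes> y |c y. c \<in> \<mm> \<and> y \<in> N} \<subseteq> B"
    proof
      fix v assume "v \<in> {c \<otimes> y |c y. c \<in> \<mm> \<and> y \<in> N}"
      then obtain d y where d: "d \<in> \<mm>" "y \<in> N" "v = d \<otimes> y" by auto
      then obtain a z where az: "a \<in> carrier A" "z \<in> Z" "y = a \<otimes> s \<oplus> z"
        using mem_Idl_insertD[OF c sc, of y] insert.prems(2) unfolding Z_def by auto
      have "v = (d \<otimes> a) \<otimes> s \<oplus> d \<otimes> z" using d az sc Zc by (simp add: r_distr m_assoc)
      moreover have "d \<otimes> a \<in> \<mm>" "d \<otimes> z \<in> Z"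
        using d az I_r_closed ideal.I_l_closed[OF Z] by auto
      ultimately show "v \<in> B" using BI by simp
    qed
  qed
  then have "s \<in> B" using NQ insert.prems(1) by auto
  then obtain a z where az: "a \<in> \<mm>" "z \<in> Z" "s = a \<otimes> s \<oplus> z" unfolding B_def by auto
  have ac: "a \<in> carrier A" using az(1) by simp
  have "(\<one> \<ominus> a) \<otimes> s = s \<ominus> a \<otimes> s" using ac sc by algebra
  also have "\<dots> = z" 
  proof -
    have "s \<ominus> a \<otimes> s = (a \<otimes> s \<oplus> z) \<ominus> a \<otimes> s" using az(3) by simp
    also have "\<dots> = z" using ac sc Zc[OF az(2)] by algebra
    finally show ?thesis .
  qed
  finally have "(\<one> \<ominus> a) \<otimes> s \<in> Z" using az by simp
  moreover have "\<one> \<ominus> a \<notin> \<mm>"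
  proof
    assume "\<one> \<ominus> a \<in> \<mm>"
    then have "\<one> \<ominus> a \<oplus> a \<in> \<mm>" using az by simp
    moreover have "\<one> \<ominus> a \<oplus> a = \<one>" using ac by algebra
    ultimately show False using one_notin_maximal by simp
  qed
  ultimately have "s \<in> Z"
    using ideal_unit_cancel[OF Z Units_if_notin_maximal sc, of "\<one> \<ominus> a"] ac by simp
  then have "Idl (Q \<union> insert s S) \<subseteq> Z"
    using genideal_self[OF c] unfolding Z_def by (intro Idl_mono[OF c]) auto
  then have "N \<subseteq> Idl (Q \<union> S)" using insert.prems(2) unfolding Z_def by simp
  then show ?case using insert.IH insert.prems(1) by simp
qed

text \<open>Fraction-free Gaussian elimination: \<open>y\<close> is replaced by \<open>\<alpha>\<^sub>1 y - \<alpha> y\<^sub>1\<close>, where \<open>\<alpha>\<close> and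
  \<open>\<alpha>\<^sub>1\<close> are the coefficients of the generator \<open>s\<close> in \<open>y\<close> and in the pivot \<open>y\<^sub>1\<close>.\<close>

lemma spanning_open:
  assumes L: "ideal L A" and a: "a \<in> carrier A"
  shows "finite S \<Longrightarrow> S \<subseteq> carrier A \<Longrightarrow> Y \<subseteq> poly_funs (Idl (L \<union> S)) \<Longrightarrow>
    (\<And>c y. c \<in> \<mm> \<Longrightarrow> y \<in> Idl (L \<union> S) \<Longrightarrow> c \<otimes> y \<in> L) \<Longrightarrow>
    Idl (L \<union> S) \<subseteq> Idl (L \<union> (\<lambda>y. y a) ` Y) \<Longrightarrow>
    small {t \<in> carrier A. \<not> Idl (L \<union> S) \<subseteq> Idl (L \<union> (\<lambda>y. y t) ` Y)}"
proof (induction S arbitrary: Y rule: finite_induct)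
  case empty
  have "Idl L \<subseteq> Idl (L \<union> (\<lambda>y. y t) ` Y)" if t: "t \<in> carrier A" for t
  proof (rule subset_Idl_subset)
    have I: "ideal (Idl L) A" by (rule genideal_ideal[OF ideal_subset_carrier[OF L]])
    then have "y t \<in> carrier A" if "y \<in> Y" for y
      using poly_funs_closed[OF _ _ t, of "Idl L" y] empty.prems(2) that
        ideal_subset_carrier[of "Idl L"] by auto
    then show "L \<union> (\<lambda>y. y t) ` Y \<subseteq> carrier A" using ideal_subset_carrier[OF L] by auto
  qed auto
  then have "{t \<in> carrier A. \<not> Idl (L \<union> {}) \<subseteq> Idl (L \<union> (\<lambda>y. y t) ` Y)} = {}" by auto
  then show ?case by (simp only: small_empty)
next
  case (insert s S)
  define N where "N = Idl (L \<union> insert s S)"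
  define M where "M = Idl (L \<union> S)"
  have sc: "s \<in> carrier A" and c: "L \<union> S \<subseteq> carrier A" and c': "L \<union> insert s S \<subseteq> carrier A"
    using insert.prems(1) ideal_subset_carrier[OF L] by auto
  have N: "ideal N A" and M: "ideal M A"
    unfolding N_def M_def using c c' by (intro genideal_ideal; simp)+
  have MN: "M \<subseteq> N" unfolding N_def M_def by (rule subset_Idl_subset[OF c']) auto
  have LM: "L \<union> S \<subseteq> M" unfolding M_def by (rule genideal_self[OF c])
  have sN: "s \<in> N" unfolding N_def using genideal_self[OF c'] by auto
  have YN: "Y \<subseteq> poly_funs N" using insert.prems(2) by (simp add: N_def)
  have mN: "c \<otimes> y \<in> L" if "c \<in> \<mm>" "y \<in> N" for c y
    using insert.prems(3) that by (simp add: N_def)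
  have NY: "N \<subseteq> Idl (L \<union> (\<lambda>y. y a) ` Y)" using insert.prems(4) by (simp add: N_def)
  have Yt: "y t \<in> N" if "y \<in> Y" "t \<in> carrier A" for y t
    using poly_funs_closed[OF N _ that(2)] YN that(1) by blast
  have Yc: "L \<union> (\<lambda>y. y t) ` Y \<subseteq> carrier A" if "t \<in> carrier A" for t
    using Yt[OF _ that] ideal_subset_carrier[OF N] ideal_subset_carrier[OF L] by auto
  show ?case
  proof (cases "s \<in> M")
    case True
    have "N \<subseteq> M"
      unfolding N_def using True LM by (intro genideal_minimal M) auto
    then have "N = M" using MN by blast
    then show ?thesis
      using insert.IH[of Y] insert.prems unfolding N_def M_def by simp
  next
    case False
    \<comment> \<open>A pivot exists because values inside \<open>M\<close> cannot generate
      \<open>s\<close>, which lies outside \<open>M\<close>.\<close>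
    have "\<exists>y\<in>Y. y a \<notin> M"
    proof (rule ccontr)
      assume "\<not> (\<exists>y\<in>Y. y a \<notin> M)"
      then have "Idl (L \<union> (\<lambda>y. y a) ` Y) \<subseteq> M" using LM by (intro genideal_minimal M) auto
      then show False using NY sN False by auto
    qed
    then obtain y1 where y1: "y1 \<in> Y" "y1 a \<notin> M" by blast
    have "\<forall>y\<in>Y. \<exists>\<alpha> g. \<alpha> \<in> poly_funs (carrier A) \<and> g \<in> poly_funs M \<and>
      (\<forall>t\<in>carrier A. y t = \<alpha> t \<otimes> s \<oplus> g t)"
    proof
      fix y assume "y \<in> Y"
      then have "y \<in> poly_funs (Idl (insert s (L \<union> S)))" using YN by (auto simp: N_def)
      from poly_funs_insert_decomp[OF c sc this]
      show "\<exists>\<alpha> g. \<alpha> \<in> poly_funs (carrier A) \<and> g \<in> poly_funs M \<and>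
          (\<forall>t\<in>carrier A. y t = \<alpha> t \<otimes> s \<oplus> g t)"
        unfolding M_def by metis
    qed
    then obtain \<alpha> g where \<alpha>: "\<And>y. y \<in> Y \<Longrightarrow> \<alpha> y \<in> poly_funs (carrier A)"
      and g: "\<And>y. y \<in> Y \<Longrightarrow> g y \<in> poly_funs M"
      and yt: "\<And>y t. y \<in> Y \<Longrightarrow> t \<in> carrier A \<Longrightarrow> y t = \<alpha> y t \<otimes> s \<oplus> g y t"
      by metis
    have \<alpha>c: "\<alpha> y t \<in> carrier A" and gM: "g y t \<in> M" if "y \<in> Y" "t \<in> carrier A" for y t
      using poly_funs_closed[OF oneideal \<alpha>[OF that(1)] that(2)]
        poly_funs_closed[OF M g[OF that(1)] that(2)] by auto
    have gc: "g y t \<in> carrier A" if "y \<in> Y" "t \<in> carrier A" for y t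
      using gM[OF that] ideal_subset_carrier[OF M] by blast
    \<comment> \<open>Written with the remainders \<open>g\<close>, the new family visibly has
      coefficients in \<open>M\<close>, so the induction hypothesis can be applied to it. The next
      fact rewrites it as a combination of the old family.\<close>
    define e where "e y t = \<alpha> y1 t \<otimes> g y t \<ominus> \<alpha> y t \<otimes> g y1 t" for y t
    have e: "e y t = \<alpha> y1 t \<otimes> y t \<ominus> \<alpha> y t \<otimes> y1 t" if "y \<in> Y" "t \<in> carrier A" for y t
    proof -
      have "\<alpha> y1 t \<otimes> (\<alpha> y t \<otimes> s \<oplus> g y t) \<ominus> \<alpha> y t \<otimes> (\<alpha> y1 t \<otimes> s \<oplus> g y1 t) = e y t"
        using \<alpha>c[OF that] \<alpha>c[OF y1(1) that(2)] gc[OF that] gc[OF y1(1) that(2)] sc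
        unfolding e_def by algebra
      then show ?thesis using yt[OF that] yt[OF y1(1) that(2)] by simp
    qed
    have eM: "e y \<in> poly_funs M" if "y \<in> Y" for y
      unfolding e_def using \<alpha> g that y1(1) by (intro poly_funs_minus poly_funs_mult_left M) auto
    have Ec: "L \<union> (\<lambda>y. y t) ` e ` Y \<subseteq> carrier A" if "t \<in> carrier A" for t
      using poly_funs_closed[OF M eM that] ideal_subset_carrier[OF M] ideal_subset_carrier[OF L] by auto
    have y1a: "\<alpha> y1 a \<notin> \<mm>"
    proof
      assume "\<alpha> y1 a \<in> \<mm>"
      then have "\<alpha> y1 a \<otimes> s \<in> M" using mN sN LM by blast
      then have "y1 a \<in> M" using yt[OF y1(1) a] gM[OF y1(1) a] ideal_add_closed[OF M] by simp
      then show False using y1(2) by simp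
    qed
    define K where "K = Idl (L \<union> (\<lambda>y. y a) ` e ` Y)"
    have K: "ideal K A" unfolding K_def by (rule genideal_ideal[OF Ec[OF a]])
    have LK: "L \<union> (\<lambda>y. y a) ` e ` Y \<subseteq> K" unfolding K_def by (rule genideal_self[OF Ec[OF a]])
    have KM: "K \<subseteq> M"
      unfolding K_def using LM poly_funs_closed[OF M eM a] by (intro genideal_minimal M) auto
    \<comment> \<open>\<open>Z\<close> is an ideal containing \<open>L\<close> and all values at
      \<open>a\<close>, hence all of \<open>N\<close>. For \<open>z\<close> in \<open>M\<close> the
      multiplier \<open>\<beta>\<close> must lie in \<open>\<mm>\<close>, as the pivot value is
      outside \<open>M\<close>; so the term with \<open>\<beta>\<close> is in \<open>L\<close>, and
      \<open>z\<close> in \<open>K\<close> follows since the pivot coefficient is a unit. Thus the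
      reduced family generates \<open>M\<close> at \<open>a\<close>.\<close>
    define Z where "Z = {z \<in> carrier A. \<exists>\<beta>\<in>carrier A. \<alpha> y1 a \<otimes> z \<ominus> \<beta> \<otimes> y1 a \<in> K}"
    note ya = \<alpha>c[OF y1(1) a]
    have y1c: "y1 a \<in> carrier A" using Yt[OF y1(1) a] ideal_subset_carrier[OF N] by auto
    have ZI: "z \<in> Z" if "z \<in> carrier A" "\<beta> \<in> carrier A" "\<alpha> y1 a \<otimes> z \<ominus> \<beta> \<otimes> y1 a \<in> K" for z \<beta>
      using that unfolding Z_def by auto
    have LZ: "L \<subseteq> Z"
    proof
      fix z assume z: "z \<in> L"
      then have zc: "z \<in> carrier A" using ideal_subset_carrier[OF L] by auto
      have "\<alpha> y1 a \<otimes> z \<ominus> \<zero> \<otimes> y1 a = \<alpha> y1 a \<otimes> z" using zc y1c ya by algebra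
      moreover have "\<alpha> y1 a \<otimes> z \<in> K" using ideal.I_l_closed[OF K _ ya] LK z by auto
      ultimately show "z \<in> Z" using zc by (intro ZI[of z \<zero>]) auto
    qed
    have "ideal Z A"
    proof (rule cring_idealI)
      show "Z \<subseteq> carrier A" by (auto simp: Z_def)
      show "\<zero> \<in> Z" using LZ ideal_zero_closed[OF L] by auto
    next
      fix z w assume "z \<in> Z" "w \<in> Z"
      then obtain \<beta> \<gamma> where *: "z \<in> carrier A" "w \<in> carrier A" "\<beta> \<in> carrier A" "\<gamma> \<in> carrier A"
        "\<alpha> y1 a \<otimes> z \<ominus> \<beta> \<otimes> y1 a \<in> K" "\<alpha> y1 a \<otimes> w \<ominus> \<gamma> \<otimes> y1 a \<in> K" by (auto simp: Z_def)
      have "\<alpha> y1 a \<otimes> (z \<oplus> w) \<ominus> (\<beta> \<oplus> \<gamma>) \<otimes> y1 a =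
        (\<alpha> y1 a \<otimes> z \<ominus> \<beta> \<otimes> y1 a) \<oplus> (\<alpha> y1 a \<otimes> w \<ominus> \<gamma> \<otimes> y1 a)"
        using *(1-4) y1c ya by algebra
      then show "z \<oplus> w \<in> Z"
        using ideal_add_closed[OF K *(5,6)] *(1-4) by (intro ZI[of _ "\<beta> \<oplus> \<gamma>"]) auto
    next
      fix b z assume b: "b \<in> carrier A" and "z \<in> Z"
      then obtain \<beta> where *: "z \<in> carrier A" "\<beta> \<in> carrier A"
        "\<alpha> y1 a \<otimes> z \<ominus> \<beta> \<otimes> y1 a \<in> K" by (auto simp: Z_def)
      have "\<alpha> y1 a \<otimes> (b \<otimes> z) \<ominus> (b \<otimes> \<beta>) \<otimes> y1 a = b \<otimes> (\<alpha> y1 a \<otimes> z \<ominus> \<beta> \<otimes> y1 a)"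
        using *(1-2) b y1c ya by algebra
      then show "b \<otimes> z \<in> Z"
        using ideal.I_l_closed[OF K *(3) b] *(1,2) b by (intro ZI[of _ "b \<otimes> \<beta>"]) auto
    qed
    moreover have "y a \<in> Z" if "y \<in> Y" for y
    proof (rule ZI[of _ "\<alpha> y a"])
      show "y a \<in> carrier A" using Yt[OF that a] ideal_subset_carrier[OF N] by auto
      show "\<alpha> y a \<in> carrier A" by (rule \<alpha>c[OF that a])
      show "\<alpha> y1 a \<otimes> y a \<ominus> \<alpha> y a \<otimes> y1 a \<in> K"
        unfolding e[OF that a, symmetric] using LK that by auto
    qed
    ultimately have "N \<subseteq> Z" using NY LZ genideal_minimal[of Z "L \<union> (\<lambda>y. y a) ` Y"] by auto
    have "M \<subseteq> K"
    proof
      fix z assume z: "z \<in> M"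
      then have "z \<in> Z" using MN \<open>N \<subseteq> Z\<close> by auto
      then obtain \<beta> where zc: "z \<in> carrier A" and \<beta>: "\<beta> \<in> carrier A"
        "\<alpha> y1 a \<otimes> z \<ominus> \<beta> \<otimes> y1 a \<in> K" by (auto simp: Z_def)
      have "\<alpha> y1 a \<otimes> z \<in> M" using ideal.I_l_closed[OF M z ya] .
      moreover have "\<beta> \<otimes> y1 a = \<alpha> y1 a \<otimes> z \<ominus> (\<alpha> y1 a \<otimes> z \<ominus> \<beta> \<otimes> y1 a)"
        using zc \<beta>(1) ya y1c by algebra
      ultimately have "\<beta> \<otimes> y1 a \<in> M" using ideal_minus_closed[OF M _ subsetD[OF KM \<beta>(2)]] by metis
      then have "\<beta> \<in> \<mm>"
        using ideal_unit_cancel[OF M Units_if_notin_maximal[OF \<beta>(1)] y1c] y1(2) by blast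
      then have "\<beta> \<otimes> y1 a \<in> K" using mN Yt[OF y1(1) a] LK by auto
      moreover have "\<alpha> y1 a \<otimes> z = (\<alpha> y1 a \<otimes> z \<ominus> \<beta> \<otimes> y1 a) \<oplus> \<beta> \<otimes> y1 a"
        using zc \<beta>(1) ya y1c by algebra
      ultimately have "\<alpha> y1 a \<otimes> z \<in> K" using ideal_add_closed[OF K \<beta>(2)] by metis
      then show "z \<in> K" using ideal_unit_cancel[OF K Units_if_notin_maximal[OF ya y1a] zc] by blast
    qed
    then have "small {t \<in> carrier A. \<not> M \<subseteq> Idl (L \<union> (\<lambda>y. y t) ` e ` Y)}"
      using insert.IH[of "e ` Y"] insert.prems(1) eM mN MN unfolding M_def K_def by blast
    \<comment> \<open>There are two sources of bad parameters: the pivot coefficient ceases to be a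
      unit, or the reduced family fails to generate \<open>M\<close>. Off both sets, first
      \<open>M\<close> and then \<open>s\<close> are recovered from the values at
      \<open>t\<close>.\<close>
    then have "small ({t \<in> carrier A. \<alpha> y1 t \<in> \<mm>} \<union>
        {t \<in> carrier A. \<not> M \<subseteq> Idl (L \<union> (\<lambda>y. y t) ` e ` Y)})"
      by (intro small_Un poly_funs_roots_small[OF a \<alpha>[OF y1(1)] y1a])
    moreover have "N \<subseteq> Idl (L \<union> (\<lambda>y. y t) ` Y)"
      if t: "t \<in> carrier A" "\<alpha> y1 t \<notin> \<mm>" "M \<subseteq> Idl (L \<union> (\<lambda>y. y t) ` e ` Y)" for t
    proof -
      define G where "G = Idl (L \<union> (\<lambda>y. y t) ` Y)"
      have G: "ideal G A" unfolding G_def by (rule genideal_ideal[OF Yc[OF t(1)]])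
      have YG: "L \<union> (\<lambda>y. y t) ` Y \<subseteq> G" unfolding G_def by (rule genideal_self[OF Yc[OF t(1)]])
      have "e y t \<in> G" if "y \<in> Y" for y
        unfolding e[OF that t(1)]
        using that y1(1) YG \<alpha>c t(1) by (intro ideal_minus_closed[OF G] ideal.I_l_closed[OF G]) auto
      then have "Idl (L \<union> (\<lambda>y. y t) ` e ` Y) \<subseteq> G" using YG by (intro genideal_minimal[OF G]) auto
      then have MG: "M \<subseteq> G" using t(3) by auto
      have "\<alpha> y1 t \<otimes> s = y1 t \<ominus> g y1 t"
      proof -
        have "\<alpha> y1 t \<otimes> s = (\<alpha> y1 t \<otimes> s \<oplus> g y1 t) \<ominus> g y1 t"
          using \<alpha>c[OF y1(1) t(1)] gc[OF y1(1) t(1)] sc by algebra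
        then show ?thesis using yt[OF y1(1) t(1)] by simp
      qed
      moreover have "y1 t \<ominus> g y1 t \<in> G"
        using YG y1(1) gM[OF y1(1) t(1)] MG by (intro ideal_minus_closed[OF G]) auto
      ultimately have "\<alpha> y1 t \<otimes> s \<in> G" by simp
      then have "s \<in> G"
        using ideal_unit_cancel[OF G Units_if_notin_maximal[OF \<alpha>c[OF y1(1) t(1)] t(2)] sc] by blast
      then show ?thesis
        unfolding N_def G_def[symmetric] using LM MG by (intro genideal_minimal[OF G]) auto
    qed
    ultimately show ?thesis unfolding N_def[symmetric] by (elim small_mono) blast
  qed
qed

end

lemma (in cring) mem_Idl_finite:
  assumes "B \<subseteq> carrier R" "x \<in> Idl B"
  shows "\<exists>F. finite F \<and> F \<subseteq> B \<and> x \<in> Idl F"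
proof -
  define Z where "Z = {x \<in> carrier R. \<exists>F. finite F \<and> F \<subseteq> B \<and> x \<in> Idl F}"
  have I: "ideal (Idl F) R" if "F \<subseteq> B" for F
    using that assms(1) by (intro genideal_ideal) auto
  have "ideal Z R"
  proof (rule cring_idealI)
    show "Z \<subseteq> carrier R" by (auto simp: Z_def)
    show "\<zero> \<in> Z" using ideal_zero_closed[OF I[of "{}"]] by (auto simp: Z_def)
  next
    fix x y assume "x \<in> Z" "y \<in> Z"
    then obtain F G where F: "finite F" "F \<subseteq> B" "x \<in> Idl F" "x \<in> carrier R"
      and G: "finite G" "G \<subseteq> B" "y \<in> Idl G" "y \<in> carrier R" by (auto simp: Z_def)
    have "F \<union> G \<subseteq> carrier R" using F G assms(1) by auto
    then have "Idl F \<subseteq> Idl (F \<union> G)" "Idl G \<subseteq> Idl (F \<union> G)" by (intro subset_Idl_subset; simp)+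
    then have "x \<oplus> y \<in> Idl (F \<union> G)" using F G I[of "F \<union> G"] by (auto intro!: ideal_add_closed)
    then show "x \<oplus> y \<in> Z" unfolding Z_def using F G by (auto intro!: exI[of _ "F \<union> G"])
  next
    fix a x assume a: "a \<in> carrier R" and "x \<in> Z"
    then obtain F where F: "finite F" "F \<subseteq> B" "x \<in> Idl F" "x \<in> carrier R" by (auto simp: Z_def)
    then show "a \<otimes> x \<in> Z"
      using ideal.I_l_closed[OF I[OF F(2)] F(3) a] a by (auto simp: Z_def)
  qed
  moreover have "B \<subseteq> Z"
    using assms(1) genideal_self' by (auto simp: Z_def intro!: exI[of _ "{_}"])
  ultimately have "Idl B \<subseteq> Z" by (rule genideal_minimal)
  then show ?thesis using assms(2) by (auto simp: Z_def)
qed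

lemma (in cring) subset_Idl_finite:
  assumes "B \<subseteq> carrier R" "finite S" "S \<subseteq> Idl B"
  shows "\<exists>F. finite F \<and> F \<subseteq> B \<and> S \<subseteq> Idl F"
proof -
  obtain F where F: "\<And>s. s \<in> S \<Longrightarrow> finite (F s) \<and> F s \<subseteq> B \<and> s \<in> Idl (F s)"
    using mem_Idl_finite[OF assms(1)] assms(3) by (metis subsetD)
  have "Idl (F s) \<subseteq> Idl (\<Union>s\<in>S. F s)" if "s \<in> S" for s
    using F that assms(1) by (intro subset_Idl_subset) blast+
  then show ?thesis using F assms(2) by (intro exI[of _ "\<Union>s\<in>S. F s"]) blast
qed

section \<open>Generic sequences\<close>

text \<open>The elements of \<open>V\<close> play the role of generic linear forms; connectedness of \<open>V\<close> by
  polynomial paths replaces the irreducibility of a parameter space.\<close>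

locale polynomially_connected = local_ring +
  fixes I V
  assumes infinite_residue_field: "infinite (carrier (A Quot \<mm>))"
    and I_ideal: "ideal I A"
    and V_nonempty: "V \<noteq> {}"
    and V_subset: "V \<subseteq> I"
    and path: "v \<in> V \<Longrightarrow> w \<in> V \<Longrightarrow> \<exists>f\<in>poly_funs I. f \<zero> = v \<and> f \<one> = w \<and> (\<forall>t\<in>carrier A. f t \<in> V)"
begin

lemma V_carrier: "v \<in> V \<Longrightarrow> v \<in> carrier A"
  using V_subset ideal_subset_carrier[OF I_ideal] by auto

lemma V_prod_carrier: "C \<subseteq> carrier A \<Longrightarrow> V <#> C \<subseteq> carrier A"
  using V_carrier by (intro set_mult_closed) auto

lemma mem_prodI: "x \<in> B \<Longrightarrow> y \<in> C \<Longrightarrow> x \<otimes> y \<in> B <#> C"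
  by (auto simp: set_mult_def)

text \<open>The products of path values with elements of \<open>P\<close> form a polynomial family
  in \<open>N\<close>, to which \<open>spanning_open\<close> applies. The set \<open>P\<close> may
  be infinite; finiteness is required of N / L only.\<close>

lemma good_tuples_open:
  assumes N: "ideal N A" and L: "ideal L A" "L \<subseteq> N"
    and mN: "\<And>c y. c \<in> \<mm> \<Longrightarrow> y \<in> N \<Longrightarrow> c \<otimes> y \<in> L"
    and gen: "gen_mod L N n"
    and P: "P \<subseteq> carrier A" "\<And>x y. x \<in> I \<Longrightarrow> y \<in> P \<Longrightarrow> x \<otimes> y \<in> N"
    and f: "\<And>j. j < p \<Longrightarrow> f j \<in> poly_funs I"
    and a: "a \<in> carrier A" "N \<subseteq> Idl (L \<union> ((\<lambda>j. f j a) ` {..<p} <#> P))"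
  shows "small {t \<in> carrier A. \<not> N \<subseteq> Idl (L \<union> ((\<lambda>j. f j t) ` {..<p} <#> P))}"
proof -
  obtain S where S: "finite S" "S \<subseteq> N" "N \<subseteq> Idl (L \<union> S)"
    using gen by (auto simp: gen_mod_def)
  have Sc: "S \<subseteq> carrier A" using S(2) ideal_subset_carrier[OF N] by auto
  have NS: "Idl (L \<union> S) = N"
    using S L by (intro equalityI genideal_minimal[OF N]) auto
  define Y where "Y = {\<lambda>t. f j t \<otimes> y |j y. j < p \<and> y \<in> P}"
  have Yt: "(\<lambda>y. y t) ` Y = (\<lambda>j. f j t) ` {..<p} <#> P" for t
    unfolding Y_def set_mult_def by (auto simp: image_iff) blast+
  have "(\<lambda>t. f j t \<otimes> y) \<in> poly_funs N" if j: "j < p" and y: "y \<in> P" for j y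
  proof -
    have yc: "y \<in> carrier A" using P(1) y by auto
    obtain d where "f j \<in> poly_fun I d" using f[OF j] by (auto simp: poly_funs_def)
    then have "(\<lambda>t. y \<otimes> f j t) \<in> poly_fun N d"
    proof (rule poly_fun_cmult[OF N I_ideal yc, rotated])
      fix x assume x: "x \<in> I"
      then show "y \<otimes> x \<in> N"
        using P(2)[OF x y] m_comm[OF yc, of x] ideal_subset_carrier[OF I_ideal] by auto
    qed
    then have "(\<lambda>t. f j t \<otimes> y) \<in> poly_fun N d"
    proof (rule poly_fun_cong)
      fix t assume "t \<in> carrier A"
      then have "f j t \<in> carrier A"
        using poly_funs_closed[OF I_ideal f] j ideal_subset_carrier[OF I_ideal] by auto
      then show "f j t \<otimes> y = y \<otimes> f j t" using yc m_comm by simp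
    qed
    then show ?thesis by (auto simp: poly_funs_def)
  qed
  then have "Y \<subseteq> poly_funs (Idl (L \<union> S))" unfolding NS by (auto simp: Y_def)
  from spanning_open[OF L(1) a(1) S(1) Sc this] show ?thesis
    unfolding NS Yt using mN a(2) by blast
qed

text \<open>Takes the place of the fact that finitely many nonempty open subsets of an irreducible
  space have a common point. A tuple good for the earlier indices is joined, entry by entry and with
  one common parameter, to a tuple good for the new index. Each index excludes a small set of
  parameters, and an infinite residue field leaves some parameter over.\<close>

lemma common_good_tuple:
  assumes "finite H"
    and N: "\<And>k. k \<in> H \<Longrightarrow> ideal (N k) A" and L: "\<And>k. k \<in> H \<Longrightarrow> ideal (L k) A" "\<And>k. k \<in> H \<Longrightarrow> L k \<subseteq> N k"
    and mN: "\<And>k c y. k \<in> H \<Longrightarrow> c \<in> \<mm> \<Longrightarrow> y \<in> N k \<Longrightarrow> c \<otimes> y \<in> L k"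
    and gen: "\<And>k. k \<in> H \<Longrightarrow> \<exists>n. gen_mod (L k) (N k) n"
    and P: "\<And>k. k \<in> H \<Longrightarrow> P k \<subseteq> carrier A" "\<And>k x y. k \<in> H \<Longrightarrow> x \<in> I \<Longrightarrow> y \<in> P k \<Longrightarrow> x \<otimes> y \<in> N k"
    and good: "\<And>k. k \<in> H \<Longrightarrow>
      \<exists>v. (\<forall>j<p. v j \<in> V) \<and> N k \<subseteq> Idl (L k \<union> (v ` {..<p} <#> P k))"
  shows "\<exists>v. (\<forall>j<p. v j \<in> V) \<and> (\<forall>k\<in>H. N k \<subseteq> Idl (L k \<union> (v ` {..<p} <#> P k)))"
  using assms
proof (induction H rule: finite_induct)
  case empty
  obtain v where "v \<in> V" using V_nonempty by blast
  then show ?case by (intro exI[of _ "\<lambda>_. v"]) auto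
next
  case (insert k H)
  obtain v where v: "\<forall>j<p. v j \<in> V" "\<forall>k\<in>H. N k \<subseteq> Idl (L k \<union> (v ` {..<p} <#> P k))"
    using insert.IH insert.prems by auto
  obtain w where w: "\<forall>j<p. w j \<in> V" "N k \<subseteq> Idl (L k \<union> (w ` {..<p} <#> P k))"
    using insert.prems(8)[of k] by blast
  have "\<forall>j. \<exists>f. j < p \<longrightarrow> f \<in> poly_funs I \<and> f \<zero> = v j \<and> f \<one> = w j \<and> (\<forall>t\<in>carrier A. f t \<in> V)"
    using path v(1) w(1) by blast
  then obtain f where f: "\<And>j. j < p \<Longrightarrow> f j \<in> poly_funs I" "\<And>j. j < p \<Longrightarrow> f j \<zero> = v j"
    "\<And>j. j < p \<Longrightarrow> f j \<one> = w j" "\<And>j t. j < p \<Longrightarrow> t \<in> carrier A \<Longrightarrow> f j t \<in> V"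
    by metis
  have f0: "(\<lambda>j. f j \<zero>) ` {..<p} = v ` {..<p}" and f1: "(\<lambda>j. f j \<one>) ` {..<p} = w ` {..<p}"
    using f(2,3) by auto
  define B where "B k' = {t \<in> carrier A. \<not> N k' \<subseteq> Idl (L k' \<union> ((\<lambda>j. f j t) ` {..<p} <#> P k'))}" for k'
  have "small (B k')" if k': "k' \<in> insert k H" for k'
  proof -
    \<comment> \<open>The paths start at the old tuple and end at the new one, so the parameter
      \<open>\<one>\<close> is good for \<open>k\<close> and the parameter \<open>\<zero>\<close> is
      good for every other index.\<close>
    have "\<exists>a\<in>carrier A. N k' \<subseteq> Idl (L k' \<union> ((\<lambda>j. f j a) ` {..<p} <#> P k'))"
    proof (cases "k' = k")
      case True
      then show ?thesis using w(2) f1 by (intro bexI[of _ \<one>]) auto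
    next
      case False
      then show ?thesis using v(2) f0 k' by (intro bexI[of _ \<zero>]) auto
    qed
    then obtain a where a: "a \<in> carrier A" "N k' \<subseteq> Idl (L k' \<union> ((\<lambda>j. f j a) ` {..<p} <#> P k'))" by blast
    obtain n where "gen_mod (L k') (N k') n" using insert.prems(5)[OF k'] by blast
    from good_tuples_open[OF insert.prems(1-3)[OF k'] _ this insert.prems(6)[OF k'] _ f(1) a]
    show ?thesis unfolding B_def using insert.prems(4,7)[OF k'] by blast
  qed
  then have "small (\<Union>k'\<in>insert k H. B k')"
    using insert.hyps by (intro small_UN) auto
  then have "\<not> carrier A \<subseteq> (\<Union>k'\<in>insert k H. B k')"
    using carrier_not_small[OF infinite_residue_field] small_mono by blast
  then obtain t where "t \<in> carrier A" "t \<notin> (\<Union>k'\<in>insert k H. B k')" by blast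
  then show ?case using f(4) by (intro exI[of _ "\<lambda>j. f j t"]) (auto simp: B_def)
qed

text \<open>\<open>N k / L k\<close> are the components of a graded module over the fiber cone of \<open>I\<close>, generated in
  degree \<open>0\<close>.\<close>

definition graded_quot :: "(nat \<Rightarrow> 'a set) \<Rightarrow> (nat \<Rightarrow> 'a set) \<Rightarrow> bool"
  where "graded_quot N L \<longleftrightarrow>
    (\<forall>k. ideal (N k) A \<and> ideal (L k) A \<and> L k \<subseteq> N k \<and>
      (\<forall>c\<in>\<mm>. \<forall>y\<in>N k. c \<otimes> y \<in> L k) \<and>
      (\<forall>x\<in>I. \<forall>y\<in>N k. x \<otimes> y \<in> N (Suc k)) \<and>
      (\<forall>x\<in>I. \<forall>y\<in>L k. x \<otimes> y \<in> L (Suc k)) \<and>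
      N (Suc k) \<subseteq> Idl\<^bsub>A\<^esub> (L (Suc k) \<union> (V <#>\<^bsub>A\<^esub> N k)))"

lemma graded_quotD:
  assumes "graded_quot N L"
  shows "ideal (N k) A" "ideal (L k) A" "L k \<subseteq> N k"
    "\<And>c y. c \<in> \<mm> \<Longrightarrow> y \<in> N k \<Longrightarrow> c \<otimes> y \<in> L k"
    "\<And>x y. x \<in> I \<Longrightarrow> y \<in> N k \<Longrightarrow> x \<otimes> y \<in> N (Suc k)"
    "\<And>x y. x \<in> I \<Longrightarrow> y \<in> L k \<Longrightarrow> x \<otimes> y \<in> L (Suc k)"
    "N (Suc k) \<subseteq> Idl (L (Suc k) \<union> (V <#> N k))"
  using assms unfolding graded_quot_def by blast+

text \<open>Modulo \<open>L (Suc k)\<close> this is the component of v M of degree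
  \<open>Suc k\<close>. It plays two roles: numerator of v M, regraded to start in degree 0, and
  denominator of M / v M in degree \<open>Suc k\<close>.\<close>

definition mult_part :: "'a \<Rightarrow> (nat \<Rightarrow> 'a set) \<Rightarrow> (nat \<Rightarrow> 'a set) \<Rightarrow> nat \<Rightarrow> 'a set"
  where "mult_part v N L k = Idl\<^bsub>A\<^esub> (L (Suc k) \<union> ({v} <#>\<^bsub>A\<^esub> N k))"

context
  fixes N L v
  assumes NL: "graded_quot N L" and v: "v \<in> V"
begin

lemma N_carrier: "N k \<subseteq> carrier A" and L_carrier: "L k \<subseteq> carrier A"
  using graded_quotD(1,2)[OF NL, of k] ideal_subset_carrier by auto

lemma mult_part_gens_carrier: "L (Suc k) \<union> ({v} <#> N k) \<subseteq> carrier A"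
  using N_carrier L_carrier V_carrier[OF v] by (auto simp: set_mult_def)

lemma mult_part_ideal: "ideal (mult_part v N L k) A"
  unfolding mult_part_def by (rule genideal_ideal[OF mult_part_gens_carrier])

lemma mult_part_self: "L (Suc k) \<union> ({v} <#> N k) \<subseteq> mult_part v N L k"
  unfolding mult_part_def by (rule genideal_self[OF mult_part_gens_carrier])

lemma mult_part_subset: "mult_part v N L k \<subseteq> N (Suc k)"
  unfolding mult_part_def
  using graded_quotD[OF NL] V_subset v by (intro genideal_minimal) (auto simp: set_mult_def)

lemma mult_part_I:
  assumes x: "x \<in> I" and z: "z \<in> mult_part v N L k"
  shows "x \<otimes> z \<in> mult_part v N L (Suc k)"
proof -
  have xc: "x \<in> carrier A" using x ideal_subset_carrier[OF I_ideal] by auto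
  let ?Z = "{z \<in> carrier A. x \<otimes> z \<in> mult_part v N L (Suc k)}"
  have "L (Suc k) \<union> ({v} <#> N k) \<subseteq> ?Z"
  proof
    fix u assume u: "u \<in> L (Suc k) \<union> ({v} <#> N k)"
    show "u \<in> ?Z"
    proof (cases "u \<in> L (Suc k)")
      case True
      then have "x \<otimes> u \<in> L (Suc (Suc k))" using graded_quotD(6)[OF NL x] by blast
      then show ?thesis using True L_carrier mult_part_self[of "Suc k"] by blast
    next
      case False
      then obtain y where y: "y \<in> N k" "u = v \<otimes> y" using u by (auto simp: set_mult_def)
      have yc: "y \<in> carrier A" using y N_carrier by auto
      have "x \<otimes> u = v \<otimes> (x \<otimes> y)" using y(2) yc xc V_carrier[OF v] by (simp add: m_lcomm)
      moreover have "v \<otimes> (x \<otimes> y) \<in> {v} <#> N (Suc k)"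
        using graded_quotD(5)[OF NL x y(1)] by (intro mem_prodI) auto
      ultimately show ?thesis
        using mult_part_self[of "Suc k"] y(2) yc V_carrier[OF v] by auto
    qed
  qed
  then have "mult_part v N L k \<subseteq> ?Z"
    unfolding mult_part_def[of v N L k]
    by (intro genideal_minimal ideal_colon mult_part_ideal xc)
  then show ?thesis using z by auto
qed

text \<open>The regraded v M is again generated in degree 0, since v (w y) = w (v y) moves the
  multiplier \<open>w\<close> outside.\<close>

lemma graded_quot_mult: "graded_quot (mult_part v N L) (\<lambda>k. L (Suc k))"
  unfolding graded_quot_def
proof (intro allI conjI ballI)
  fix k
  show "ideal (mult_part v N L k) A" by (rule mult_part_ideal)
  show "ideal (L (Suc k)) A" by (rule graded_quotD(2)[OF NL])
  show "L (Suc k) \<subseteq> mult_part v N L k" using mult_part_self by blast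
  show "c \<otimes> y \<in> L (Suc k)" if "c \<in> \<mm>" "y \<in> mult_part v N L k" for c y
    using graded_quotD(4)[OF NL that(1)] that(2) mult_part_subset by blast
  show "x \<otimes> y \<in> mult_part v N L (Suc k)" if "x \<in> I" "y \<in> mult_part v N L k" for x y
    using mult_part_I that by blast
  show "x \<otimes> y \<in> L (Suc (Suc k))" if "x \<in> I" "y \<in> L (Suc k)" for x y
    using graded_quotD(6)[OF NL] that by blast
  have vI: "v \<in> I" using v V_subset by auto
  let ?G = "L (Suc (Suc k)) \<union> (V <#> mult_part v N L k)"
  have Gc: "?G \<subseteq> carrier A"
    using L_carrier V_prod_carrier ideal_subset_carrier[OF mult_part_ideal] by simp
  have G: "ideal (Idl ?G) A" by (rule genideal_ideal[OF Gc])
  let ?Z = "{z \<in> carrier A. v \<otimes> z \<in> Idl ?G}"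
  have "L (Suc k) \<union> (V <#> N k) \<subseteq> ?Z"
  proof
    fix u assume u: "u \<in> L (Suc k) \<union> (V <#> N k)"
    show "u \<in> ?Z"
    proof (cases "u \<in> L (Suc k)")
      case True
      then have "v \<otimes> u \<in> L (Suc (Suc k))" using graded_quotD(6)[OF NL vI] by blast
      then show ?thesis using True L_carrier genideal_self[OF Gc] by blast
    next
      case False
      then obtain w y where y: "w \<in> V" "y \<in> N k" "u = w \<otimes> y" using u by (auto simp: set_mult_def)
      have yc: "y \<in> carrier A" "w \<in> carrier A" using y N_carrier V_carrier by auto
      have "v \<otimes> u = w \<otimes> (v \<otimes> y)" using y(3) yc V_carrier[OF v] by (simp add: m_lcomm)
      moreover have "v \<otimes> y \<in> mult_part v N L k"
        using mult_part_self mem_prodI[of v "{v}" y "N k"] y(2) by auto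
      then have "w \<otimes> (v \<otimes> y) \<in> V <#> mult_part v N L k" by (intro mem_prodI y)
      ultimately show ?thesis using genideal_self[OF Gc] y(3) yc by auto
    qed
  qed
  then have "Idl (L (Suc k) \<union> (V <#> N k)) \<subseteq> ?Z"
    by (intro genideal_minimal ideal_colon G V_carrier v)
  then have "N (Suc k) \<subseteq> ?Z" using graded_quotD(7)[OF NL] by blast
  then have "{v} <#> N (Suc k) \<subseteq> Idl ?G" by (auto simp: set_mult_def)
  then show "mult_part v N L (Suc k) \<subseteq> Idl ?G"
    unfolding mult_part_def[of v N L "Suc k"]
    using genideal_self[OF Gc] by (intro genideal_minimal[OF G]) auto
qed

text \<open>M / v M keeps the numerators of M. As v M starts in degree 1, the denominator in degree
  0 stays \<open>L 0\<close>, which explains \<open>case_nat\<close>.\<close>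

lemma graded_quot_mod: "graded_quot N (case_nat (L 0) (mult_part v N L))"
  (is "graded_quot N ?L")
  unfolding graded_quot_def
proof (intro allI conjI ballI)
  fix k
  show L': "ideal (?L k) A" for k
    using graded_quotD(2)[OF NL] mult_part_ideal by (auto split: nat.split)
  have LL: "L k \<subseteq> ?L k" for k using mult_part_self by (auto split: nat.split)
  show N: "ideal (N k) A" by (rule graded_quotD(1)[OF NL])
  show "?L k \<subseteq> N k"
    using graded_quotD(3)[OF NL] mult_part_subset by (auto split: nat.split)
  show "c \<otimes> y \<in> ?L k" if "c \<in> \<mm>" "y \<in> N k" for c y
    using graded_quotD(4)[OF NL that] LL by blast
  show "x \<otimes> y \<in> N (Suc k)" if "x \<in> I" "y \<in> N k" for x y
    using graded_quotD(5)[OF NL that] .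
  show "x \<otimes> y \<in> ?L (Suc k)" if "x \<in> I" "y \<in> ?L k" for x y
  proof (cases k)
    case 0
    then have "x \<otimes> y \<in> L (Suc k)" using graded_quotD(6)[OF NL that(1)] that(2) by auto
    then show ?thesis using LL by blast
  next
    case (Suc j)
    then show ?thesis using mult_part_I that by simp
  qed
  have "L (Suc k) \<union> (V <#> N k) \<subseteq> ?L (Suc k) \<union> (V <#> N k)" using LL by blast
  moreover have "?L (Suc k) \<union> (V <#> N k) \<subseteq> carrier A"
    using ideal_subset_carrier[OF L'[of "Suc k"]] V_prod_carrier[OF N_carrier[of k]]
    by (intro Un_least)
  ultimately have "Idl (L (Suc k) \<union> (V <#> N k)) \<subseteq> Idl (?L (Suc k) \<union> (V <#> N k))"
    by (intro subset_Idl_subset)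
  then show "N (Suc k) \<subseteq> Idl (?L (Suc k) \<union> (V <#> N k))"
    using graded_quotD(7)[OF NL] by blast
qed

end

text \<open>The empty set in degree 0 stands for the missing component of degree -1. The bases are i
  = 0 and p = 0, where the binomial coefficient is 1 and the bound says that the component
  vanishes.\<close>

theorem generic_generation:
  assumes "graded_quot N L" "gen_mod (L i) (N i) n" "n < (i + p) choose i"
  shows "\<exists>v. (\<forall>j<p. v j \<in> V) \<and>
    N i \<subseteq> Idl (L i \<union> (v ` {..<p} <#> (case i of 0 \<Rightarrow> {} | Suc k \<Rightarrow> N k)))"
  using assms
proof (induction i arbitrary: p N L n)
  case 0
  obtain v where "v \<in> V" using V_nonempty by blast
  moreover have "gen_mod (L 0) (N 0) 0" using 0 by simp
  then have "N 0 \<subseteq> Idl (L 0)" by (auto simp: gen_mod_def)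
  ultimately show ?case by (intro exI[of _ "\<lambda>_. v"]) (auto simp: set_mult_def)
next
  case (Suc k)
  \<comment> \<open>Induction on i + p becomes a nested one: \<open>outer\<close> handles v M, in
    one degree less with the same length of sequence, and the inner hypothesis handles M / v M, in
    the same degree with a sequence shorter by one.\<close>
  note outer = Suc.IH
  from Suc.prems show ?case
  proof (induction p arbitrary: N L n)
    case 0
    then have "gen_mod (L (Suc k)) (N (Suc k)) 0" by simp
    then show ?case by (auto simp: gen_mod_def set_mult_def)
  next
    case (Suc q)
    note NL = Suc.prems(1) and gen = Suc.prems(2)
    note D = graded_quotD[OF NL]
    have Nc: "N j \<subseteq> carrier A" and Lc: "L j \<subseteq> carrier A" for j
      using D(1,2)[of j] ideal_subset_carrier by auto
    show ?case
    proof (cases "\<exists>v\<in>V. \<exists>a < (Suc k + q) choose Suc k. gen_mod (mult_part v N L k) (N (Suc k)) a")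
      case True
      then obtain v a where v: "v \<in> V" and a: "a < (Suc k + q) choose Suc k"
        "gen_mod (mult_part v N L k) (N (Suc k)) a" by blast
      obtain w where w: "\<forall>j<q. w j \<in> V" "N (Suc k) \<subseteq> Idl (mult_part v N L k \<union> (w ` {..<q} <#> N k))"
        using Suc.IH[OF graded_quot_mod[OF NL v] _ a(1)] a(2) by auto
      \<comment> \<open>The denominators of M and M / v M differ by multiples of \<open>v\<close>,
        which the additional entry supplies.\<close>
      define u where "u = w(q := v)"
      have u: "\<forall>j<Suc q. u j \<in> V" using w(1) v by (auto simp: u_def less_Suc_eq)
      have uc: "L (Suc k) \<union> (u ` {..<Suc q} <#> N k) \<subseteq> carrier A"
      proof -
        have "u ` {..<Suc q} \<subseteq> carrier A" using u V_carrier by auto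
        then show ?thesis using Nc Lc by (auto simp: set_mult_def)
      qed
      have "w ` {..<q} \<subseteq> u ` {..<Suc q}" "{v} \<subseteq> u ` {..<Suc q}" by (auto simp: u_def)
      then have "w ` {..<q} <#> N k \<subseteq> u ` {..<Suc q} <#> N k"
        "{v} <#> N k \<subseteq> u ` {..<Suc q} <#> N k"
        by (meson mono_set_mult order_refl)+
      moreover from this(2) have "mult_part v N L k \<subseteq> Idl (L (Suc k) \<union> (u ` {..<Suc q} <#> N k))"
        unfolding mult_part_def by (intro subset_Idl_subset[OF uc]) auto
      ultimately have "Idl (mult_part v N L k \<union> (w ` {..<q} <#> N k)) \<subseteq>
          Idl (L (Suc k) \<union> (u ` {..<Suc q} <#> N k))"
        using genideal_self[OF uc] by (intro Idl_mono[OF uc]) auto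
      then show ?thesis using w(2) u by (intro exI[of _ u]) auto
    next
      case False
      \<comment> \<open>Upper bounds for the two dimensions suffice, because
        \<open>gen_mod_split\<close> makes them add up to exactly \<open>n\<close>: as
        \<open>a\<close> is not below the first summand of Pascal's rule, \<open>b\<close> is below
        the second.\<close>
      have gen_mult: "\<exists>b < (k + Suc q) choose k. gen_mod (L (Suc k)) (mult_part v N L k) b" if v: "v \<in> V" for v
      proof -
        have "L (Suc k) \<subseteq> mult_part v N L k" using mult_part_self[OF NL v] by blast
        then obtain a b where ab: "a + b = n" "gen_mod (mult_part v N L k) (N (Suc k)) a"
          "gen_mod (L (Suc k)) (mult_part v N L k) b"
          using gen_mod_split[OF mult_part_ideal[OF NL v] D(1) mult_part_subset[OF NL v] D(2) _ D(4) gen]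
          by blast
        have "(Suc k + Suc q) choose Suc k = ((k + Suc q) choose k) + ((Suc k + q) choose Suc k)"
          by simp
        moreover have "\<not> a < (Suc k + q) choose Suc k" using False ab(2) v by blast
        ultimately have "b < (k + Suc q) choose k" using Suc.prems(3) ab(1) by linarith
        then show ?thesis using ab(3) by blast
      qed
      obtain S where S: "finite S" "S \<subseteq> N (Suc k)" "N (Suc k) \<subseteq> Idl (L (Suc k) \<union> S)"
        using gen by (auto simp: gen_mod_def)
      have VNc: "L (Suc k) \<union> (V <#> N k) \<subseteq> carrier A"
        using Lc Nc V_prod_carrier by simp
      \<comment> \<open>The component is spanned by finitely many elements, so finitely many
        products of \<open>V\<close> with \<open>N k\<close>, together with elements of
        \<open>L (Suc k)\<close>, already generate it. Only the members of \<open>V\<close>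
        occurring in these products have to be treated simultaneously.\<close>
      obtain F where F: "finite F" "F \<subseteq> L (Suc k) \<union> (V <#> N k)" "S \<subseteq> Idl F"
        using subset_Idl_finite[OF VNc S(1)] S(2) D(7) by blast
      have "\<forall>x\<in>F - L (Suc k). \<exists>v\<in>V. x \<in> {v} <#> N k"
      proof
        fix x assume "x \<in> F - L (Suc k)"
        then have "x \<in> V <#> N k" using F(2) by blast
        then show "\<exists>v\<in>V. x \<in> {v} <#> N k" by (auto simp: set_mult_def)
      qed
      then obtain h where h: "\<And>x. x \<in> F - L (Suc k) \<Longrightarrow> h x \<in> V \<and> x \<in> {h x} <#> N k" by metis
      define H where "H = h ` (F - L (Suc k))"
      have H: "finite H" "H \<subseteq> V" using F(1) h by (auto simp: H_def)
      have "\<exists>w. (\<forall>j<Suc q. w j \<in> V) \<and> (\<forall>v\<in>H. mult_part v N L k \<subseteq>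
        Idl (L (Suc k) \<union> (w ` {..<Suc q} <#> (case k of 0 \<Rightarrow> {} | Suc j \<Rightarrow> mult_part v N L j))))"
      proof (rule common_good_tuple[OF H(1)])
        fix v assume "v \<in> H"
        then have v: "v \<in> V" using H(2) by auto
        note G = graded_quotD[OF graded_quot_mult[OF NL v]]
        show "ideal (mult_part v N L k) A" "ideal (L (Suc k)) A" "L (Suc k) \<subseteq> mult_part v N L k"
          by (rule G(1), rule G(2), rule G(3))
        show "c \<otimes> y \<in> L (Suc k)" if "c \<in> \<mm>" "y \<in> mult_part v N L k" for c y
          using G(4) that by blast
        obtain b where b: "b < (k + Suc q) choose k" "gen_mod (L (Suc k)) (mult_part v N L k) b"
          using gen_mult[OF v] by blast
        then show "\<exists>n. gen_mod (L (Suc k)) (mult_part v N L k) n" by blast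
        show "(case k of 0 \<Rightarrow> {} | Suc j \<Rightarrow> mult_part v N L j) \<subseteq> carrier A"
          using ideal_subset_carrier[OF G(1)] by (auto split: nat.split)
        show "x \<otimes> y \<in> mult_part v N L k"
          if "x \<in> I" "y \<in> (case k of 0 \<Rightarrow> {} | Suc j \<Rightarrow> mult_part v N L j)" for x y
          using G(5)[OF that(1)] that(2) by (cases k) auto
        show "\<exists>w. (\<forall>j<Suc q. w j \<in> V) \<and> mult_part v N L k \<subseteq>
            Idl (L (Suc k) \<union> (w ` {..<Suc q} <#> (case k of 0 \<Rightarrow> {} | Suc j \<Rightarrow> mult_part v N L j)))"
          using outer[OF graded_quot_mult[OF NL v] b(2,1)] .
      qed
      then obtain w where w: "\<forall>j<Suc q. w j \<in> V" and wH: "\<And>v. v \<in> H \<Longrightarrow> mult_part v N L k \<subseteq>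
        Idl (L (Suc k) \<union> (w ` {..<Suc q} <#> (case k of 0 \<Rightarrow> {} | Suc j \<Rightarrow> mult_part v N L j)))"
        by blast
      let ?G = "L (Suc k) \<union> (w ` {..<Suc q} <#> N k)"
      have Gc: "?G \<subseteq> carrier A"
      proof -
        have "w ` {..<Suc q} \<subseteq> carrier A" using w V_carrier by auto
        then show ?thesis using Nc Lc by (auto simp: set_mult_def)
      qed
      have G: "ideal (Idl ?G) A" by (rule genideal_ideal[OF Gc])
      have MG: "mult_part v N L k \<subseteq> Idl ?G" if "v \<in> H" for v
      proof -
        \<comment> \<open>The preceding component of v M has its numerator inside
          \<open>N k\<close>. So generation within v M by the sequence is generation by multiples of
          elements of \<open>N k\<close>, and it no longer refers to \<open>v\<close>.\<close>
        have "(case k of 0 \<Rightarrow> {} | Suc j \<Rightarrow> mult_part v N L j) \<subseteq> N k"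
          using mult_part_subset[OF NL] that H(2) by (auto split: nat.split)
        then have "w ` {..<Suc q} <#> (case k of 0 \<Rightarrow> {} | Suc j \<Rightarrow> mult_part v N L j) \<subseteq>
          w ` {..<Suc q} <#> N k" by (meson mono_set_mult order_refl)
        then have "Idl (L (Suc k) \<union> (w ` {..<Suc q} <#> (case k of 0 \<Rightarrow> {} | Suc j \<Rightarrow> mult_part v N L j)))
          \<subseteq> Idl ?G" by (intro subset_Idl_subset[OF Gc]) auto
        then show ?thesis using wH[OF that] by blast
      qed
      have "F \<subseteq> Idl ?G"
      proof
        fix x assume x: "x \<in> F"
        show "x \<in> Idl ?G"
        proof (cases "x \<in> L (Suc k)")
          case True
          then show ?thesis using genideal_self[OF Gc] by blast
        next
          case False
          then have "h x \<in> H" "x \<in> {h x} <#> N k" using h[of x] x by (auto simp: H_def)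
          then show ?thesis using MG mult_part_self[OF NL, of "h x" k] H(2) by blast
        qed
      qed
      then have "Idl F \<subseteq> Idl ?G" by (rule genideal_minimal[OF G])
      then have "Idl (L (Suc k) \<union> S) \<subseteq> Idl ?G"
        using F(3) genideal_self[OF Gc] by (intro genideal_minimal[OF G]) auto
      then show ?thesis using w S(3) by (intro exI[of _ w]) auto
    qed
  qed
qed

end

section \<open>Powers of ideals and the passage from the fiber cone to the ring\<close>

lemma min_gens_less_iff:
  "min_gens R H < enat n \<longleftrightarrow>
    (\<exists>S. finite S \<and> S \<subseteq> carrier R \<and> Idl\<^bsub>R\<^esub> S = H \<and> card S < n)"
  by (auto simp: min_gens_def INF_less_iff)

context cring
begin

lemma carrier_ideals_set: "carrier (ideals_set R) = {Y. ideal Y R}"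
  by (simp add: ideals_set_def)

lemma one_ideals_set: "\<one>\<^bsub>ideals_set R\<^esub> = carrier R"
  by (simp add: ideals_set_def)

lemma mult_ideals_set: "Y \<otimes>\<^bsub>ideals_set R\<^esub> Z = Y \<cdot> Z"
  by (simp add: ideals_set_def)

lemma ideal_power_0: "Y [^]\<^bsub>ideals_set R\<^esub> (0::nat) = carrier R"
  by (simp add: one_ideals_set)

lemma ideal_power_Suc: "Y [^]\<^bsub>ideals_set R\<^esub> Suc n = (Y [^]\<^bsub>ideals_set R\<^esub> n) \<cdot> Y"
  by (simp add: mult_ideals_set)

lemma ideal_power_ideal:
  fixes n :: nat
  assumes "ideal Y R" shows "ideal (Y [^]\<^bsub>ideals_set R\<^esub> n) R"
  using assms
  by (induction n) (simp_all only: ideal_power_0 ideal_power_Suc oneideal ideal_prod_is_ideal)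

lemma ideal_prod_minimal:
  assumes "ideal E R" "\<And>x y. x \<in> Y \<Longrightarrow> y \<in> Z \<Longrightarrow> x \<otimes> y \<in> E"
  shows "Y \<cdot> Z \<subseteq> E"
proof
  fix x assume "x \<in> Y \<cdot> Z"
  then show "x \<in> E"
    by induction (use assms ideal_add_closed[OF assms(1)] in auto)
qed

end

text \<open>With N k = I^k and L k = \<open>\<mm>\<close> I^k the graded quotient is the fiber cone,
  generated in degree 0 because \<open>V\<close> generates I. Generic generation yields I^i = (h_1,
  ..., h_p) I^{i-1} + \<open>\<mm>\<close> I^i. The bound on \<open>min_gens\<close> also makes I^i
  finitely generated, so that Nakayama's lemma removes the last term.\<close>

theorem (in polynomially_connected) power_reduction:
  assumes VI: "Idl V = I" and i: "i \<ge> 1"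
    and small: "min_gens A (I [^]\<^bsub>ideals_set A\<^esub> i) < enat ((i + p) choose i)"
  shows "\<exists>h \<in> {1..p} \<rightarrow> V.
    I [^]\<^bsub>ideals_set A\<^esub> i = (Idl (h ` {1..p})) \<cdot> (I [^]\<^bsub>ideals_set A\<^esub> (i - 1))"
proof -
  define N where "N k = I [^]\<^bsub>ideals_set A\<^esub> k" for k :: nat
  have N: "ideal (N k) A" for k unfolding N_def by (rule ideal_power_ideal[OF I_ideal])
  have Nc: "N k \<subseteq> carrier A" for k by (rule ideal_subset_carrier[OF N])
  have NSuc: "N (Suc k) = I \<cdot> N k" for k
    unfolding N_def by (simp only: ideal_power_Suc ideal_prod_commute I_ideal ideal_power_ideal)
  define L where "L k = \<mm> \<cdot> N k" for k
  have L: "ideal (L k) A" for k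
    unfolding L_def by (rule ideal_prod_is_ideal[OF is_ideal N])
  have LN: "L k \<subseteq> N k" for k
    unfolding L_def using ideal_prod_inter[OF is_ideal N] by blast
  have gens: "L k \<union> B \<subseteq> carrier A" if "B \<subseteq> carrier A" for k B
    using that ideal_subset_carrier[OF L] by simp
  have "graded_quot N L"
    unfolding graded_quot_def
  proof (intro allI conjI ballI N L LN)
    fix k
    show "c \<otimes> y \<in> L k" if "c \<in> \<mm>" "y \<in> N k" for c y
      unfolding L_def using that by (rule ideal_prod.prod)
    show IN: "x \<otimes> y \<in> N (Suc k)" if "x \<in> I" "y \<in> N k" for x y k
      unfolding NSuc using that by (rule ideal_prod.prod)
    show "x \<otimes> y \<in> L (Suc k)" if x: "x \<in> I" and y: "y \<in> L k" for x y
    proof -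
      have xc: "x \<in> carrier A" using x ideal_subset_carrier[OF I_ideal] by auto
      have "L k \<subseteq> {y \<in> carrier A. x \<otimes> y \<in> L (Suc k)}"
        unfolding L_def[of k]
      proof (rule ideal_prod_minimal[OF ideal_colon[OF L xc]])
        fix c z assume c: "c \<in> \<mm>" and z: "z \<in> N k"
        have "z \<in> carrier A" using z Nc by auto
        then have "x \<otimes> (c \<otimes> z) = c \<otimes> (x \<otimes> z)" using m_lcomm[OF xc Icarr[OF c]] by simp
        also have "\<dots> \<in> L (Suc k)" unfolding L_def using c IN[OF x z] by (rule ideal_prod.prod)
        finally show "c \<otimes> z \<in> {y \<in> carrier A. x \<otimes> y \<in> L (Suc k)}"
          using Icarr[OF c] \<open>z \<in> carrier A\<close> by simp
      qed
      then show ?thesis using y by auto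
    qed
    have VNc: "V <#> N k \<subseteq> carrier A" by (rule V_prod_carrier[OF Nc])
    have E: "ideal (Idl (L (Suc k) \<union> (V <#> N k))) A" by (rule genideal_ideal[OF gens[OF VNc]])
    show "N (Suc k) \<subseteq> Idl (L (Suc k) \<union> (V <#> N k))"
      unfolding NSuc
    proof (rule ideal_prod_minimal[OF E])
      fix x y assume x: "x \<in> I" and y: "y \<in> N k"
      have yc: "y \<in> carrier A" using y Nc by auto
      have "V \<subseteq> {x \<in> carrier A. y \<otimes> x \<in> Idl (L (Suc k) \<union> (V <#> N k))}"
      proof
        fix v assume v: "v \<in> V"
        then have "v \<otimes> y \<in> V <#> N k" using y by (rule mem_prodI)
        then have "v \<otimes> y \<in> Idl (L (Suc k) \<union> (V <#> N k))" using genideal_self[OF gens[OF VNc]] by blast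
        then show "v \<in> {x \<in> carrier A. y \<otimes> x \<in> Idl (L (Suc k) \<union> (V <#> N k))}"
          using V_carrier[OF v] yc m_comm[of y v] by simp
      qed
      then have "Idl V \<subseteq> {x \<in> carrier A. y \<otimes> x \<in> Idl (L (Suc k) \<union> (V <#> N k))}"
        by (rule genideal_minimal[OF ideal_colon[OF E yc]])
      then have "x \<in> carrier A" "y \<otimes> x \<in> Idl (L (Suc k) \<union> (V <#> N k))" using x VI by auto
      then show "x \<otimes> y \<in> Idl (L (Suc k) \<union> (V <#> N k))" using m_comm[of x y] yc by simp
    qed
  qed
  moreover obtain S where S: "finite S" "S \<subseteq> carrier A" "Idl S = N i" "card S < (i + p) choose i"
    using small unfolding min_gens_less_iff N_def by blast
  have SN: "S \<subseteq> N i" using genideal_self[OF S(2)] S(3) by simp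
  have "gen_mod (L i) (N i) (card S)"
    unfolding gen_mod_def using S SN subset_Idl_subset[OF gens[OF S(2)], of S i] by blast
  moreover obtain k where k: "i = Suc k" using i by (cases i) auto
  ultimately obtain v where v: "\<forall>j<p. v j \<in> V" "N i \<subseteq> Idl (L i \<union> (v ` {..<p} <#> N k))"
    using generic_generation[of N L i "card S" p] S(4) by auto
  \<comment> \<open>Shifts the index range from \<open>{..<p}\<close> to
    \<open>{1..p}\<close>.\<close>
  define h where "h j = v (j - 1)" for j
  have hv: "h ` {1..p} = v ` {..<p}"
  proof -
    have "h ` {1..p} = h ` Suc ` {..<p}" by (simp add: image_Suc_lessThan)
    then show ?thesis by (simp add: h_def image_image)
  qed
  have h: "h \<in> {1..p} \<rightarrow> V" using v(1) by (auto simp: h_def)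
  then have hI: "h ` {1..p} \<subseteq> I" using V_subset by auto
  then have hc: "h ` {1..p} \<subseteq> carrier A" using ideal_subset_carrier[OF I_ideal] by auto
  define Q where "Q = (Idl (h ` {1..p})) \<cdot> N k"
  have Q: "ideal Q A"
    unfolding Q_def by (intro ideal_prod_is_ideal genideal_ideal hc N)
  have "Q \<subseteq> N i"
    unfolding Q_def k NSuc using genideal_minimal[OF I_ideal hI]
    by (intro ideal_prod_minimal ideal_prod_is_ideal I_ideal N ideal_prod.prod) auto
  moreover have "N i \<subseteq> Q"
  proof (rule nakayama[OF N Q _ S(1) SN])
    have Qc: "Q \<union> B \<subseteq> carrier A" if "B \<subseteq> carrier A" for B
      using that ideal_subset_carrier[OF Q] by simp
    let ?mN = "{c \<otimes> y |c y. c \<in> \<mm> \<and> y \<in> N i}"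
    have mNc: "?mN \<subseteq> carrier A" using subsetD[OF Nc] by auto
    have E: "ideal (Idl (Q \<union> ?mN)) A" by (rule genideal_ideal[OF Qc[OF mNc]])
    have self: "Q \<union> ?mN \<subseteq> Idl (Q \<union> ?mN)" by (rule genideal_self[OF Qc[OF mNc]])
    have "L i \<subseteq> Idl (Q \<union> ?mN)"
      unfolding L_def using self by (intro ideal_prod_minimal[OF E]) blast
    moreover have "v ` {..<p} <#> N k \<subseteq> Q"
      unfolding Q_def using genideal_self[OF hc]
      by (auto simp: set_mult_def simp flip: hv intro!: ideal_prod.prod)
    ultimately have "Idl (L i \<union> (v ` {..<p} <#> N k)) \<subseteq> Idl (Q \<union> ?mN)"
      using self by (intro genideal_minimal[OF E]) auto
    then show "N i \<subseteq> Idl (Q \<union> ?mN)" using v(2) by blast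
    show "N i \<subseteq> Idl (Q \<union> S)"
      using subset_Idl_subset[OF Qc[OF S(2)], of S] S(3) by auto
  qed
  ultimately show ?thesis using h unfolding Q_def N_def k by (intro bexI[of _ h]) auto
qed

section \<open>Products of sums of ideals\<close>

context cring
begin

lemma finsum_ideals_set_empty: "finsum (ideals_set R) J {} = {\<zero>}"
proof -
  interpret IS: semiring "ideals_set R" by (rule ideals_set_is_semiring)
  show ?thesis unfolding IS.finsum_empty by (simp add: ideals_set_def)
qed

lemma finsum_ideals_set_insert:
  assumes "finite U" "u \<notin> U" "\<And>u'. u' \<in> insert u U \<Longrightarrow> ideal (J u') R"
  shows "finsum (ideals_set R) J (insert u U) = J u <+> finsum (ideals_set R) J U"
proof -
  interpret IS: semiring "ideals_set R" by (rule ideals_set_is_semiring)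
  have "finsum (ideals_set R) J (insert u U) = J u \<oplus>\<^bsub>ideals_set R\<^esub> finsum (ideals_set R) J U"
    using assms by (intro IS.finsum_insert) (auto simp: carrier_ideals_set)
  then show ?thesis by (simp add: ideals_set_def)
qed

lemma finsum_ideals_set_ideal:
  assumes "\<And>u. u \<in> U \<Longrightarrow> ideal (J u) R"
  shows "ideal (finsum (ideals_set R) J U) R"
proof -
  interpret IS: semiring "ideals_set R" by (rule ideals_set_is_semiring)
  have "finsum (ideals_set R) J U \<in> carrier (ideals_set R)"
    using assms by (intro IS.finsum_closed) (auto simp: carrier_ideals_set)
  then show ?thesis by (simp add: carrier_ideals_set)
qed

lemma finsum_ideals_set_upper:
  assumes "finite U" "\<And>u. u \<in> U \<Longrightarrow> ideal (J u) R" "u \<in> U"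
  shows "J u \<subseteq> finsum (ideals_set R) J U"
proof -
  have eq: "finsum (ideals_set R) J U = J u <+> finsum (ideals_set R) J (U - {u})"
    using finsum_ideals_set_insert[of "U - {u}" u J] assms by (simp add: insert_absorb)
  have "ideal (finsum (ideals_set R) J (U - {u})) R"
    using assms by (intro finsum_ideals_set_ideal) auto
  then have z: "\<zero> \<in> finsum (ideals_set R) J (U - {u})" by (rule ideal_zero_closed)
  show ?thesis
  proof
    fix x assume x: "x \<in> J u"
    then have "x = x \<oplus> \<zero>" using ideal_subset_carrier[OF assms(2)[OF assms(3)]] by auto
    then show "x \<in> finsum (ideals_set R) J U" unfolding eq set_add_def' using x z by blast
  qed
qed

lemma finsum_ideals_set_least:
  assumes E: "ideal E R" and "finite U"
  shows "(\<And>u. u \<in> U \<Longrightarrow> ideal (J u) R) \<Longrightarrow> (\<And>u. u \<in> U \<Longrightarrow> J u \<subseteq> E) \<Longrightarrow>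
    finsum (ideals_set R) J U \<subseteq> E"
  using assms(2)
proof (induction U rule: finite_induct)
  case empty
  then show ?case by (simp add: finsum_ideals_set_empty ideal_zero_closed[OF E])
next
  case (insert u U)
  then have "J u \<subseteq> E" "finsum (ideals_set R) J U \<subseteq> E" by auto
  then have "J u <+> finsum (ideals_set R) J U \<subseteq> E"
    using ideal_add_closed[OF E] by (auto simp: set_add_def')
  then show ?case using insert by (subst finsum_ideals_set_insert) auto
qed

lemma finprod_ideals_set_empty: "finprod (ideals_set R) K {} = carrier R"
proof -
  interpret IS: comm_monoid "ideals_set R" by (rule ideals_set_is_comm_monoid)
  show ?thesis by (simp add: one_ideals_set)
qed

lemma finprod_ideals_set_insert:
  assumes "finite T" "t \<notin> T" "\<And>t'. t' \<in> insert t T \<Longrightarrow> ideal (K t') R"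
  shows "finprod (ideals_set R) K (insert t T) = K t \<cdot> finprod (ideals_set R) K T"
proof -
  interpret IS: comm_monoid "ideals_set R" by (rule ideals_set_is_comm_monoid)
  have "finprod (ideals_set R) K (insert t T) = K t \<otimes>\<^bsub>ideals_set R\<^esub> finprod (ideals_set R) K T"
    using assms by (intro IS.finprod_insert) (auto simp: carrier_ideals_set)
  then show ?thesis by (simp add: mult_ideals_set)
qed

lemma finprod_ideals_set_ideal:
  assumes "\<And>t. t \<in> T \<Longrightarrow> ideal (K t) R"
  shows "ideal (finprod (ideals_set R) K T) R"
proof -
  interpret IS: comm_monoid "ideals_set R" by (rule ideals_set_is_comm_monoid)
  have "finprod (ideals_set R) K T \<in> carrier (ideals_set R)"
    using assms by (intro IS.finprod_closed) (auto simp: carrier_ideals_set)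
  then show ?thesis by (simp add: carrier_ideals_set)
qed

text \<open>That \<open>K t\<close> is generated by \<open>C t\<close> is expressed by a universal
  property, so generators can be replaced factor by factor through colon ideals. The element
  \<open>g\<close> collects the factors already chosen and is needed for the induction.\<close>

lemma finprod_ideals_set_least:
  assumes E: "ideal E R" and "finite T"
  shows "g \<in> carrier R \<Longrightarrow> (\<And>t. t \<in> T \<Longrightarrow> ideal (K t) R) \<Longrightarrow>
    (\<And>t. t \<in> T \<Longrightarrow> C t \<subseteq> K t) \<Longrightarrow>
    (\<And>t F. t \<in> T \<Longrightarrow> ideal F R \<Longrightarrow> C t \<subseteq> F \<Longrightarrow> K t \<subseteq> F) \<Longrightarrow>
    (\<And>x. (\<And>t. t \<in> T \<Longrightarrow> x t \<in> C t) \<Longrightarrow> g \<otimes> (\<Otimes>t\<in>T. x t) \<in> E) \<Longrightarrow>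
    y \<in> finprod (ideals_set R) K T \<Longrightarrow> g \<otimes> y \<in> E"
  using assms(2)
proof (induction T arbitrary: g y rule: finite_induct)
  case empty
  then have "g \<in> E" "y \<in> carrier R" by (auto simp: finprod_ideals_set_empty)
  then show ?case using ideal.I_r_closed[OF E] by blast
next
  case (insert s T)
  note K = insert.prems(2) and CK = insert.prems(3)
  have Cc: "C t \<subseteq> carrier R" if "t \<in> insert s T" for t
    using CK[OF that] ideal_subset_carrier[OF K[OF that]] by blast
  have PT: "ideal (finprod (ideals_set R) K T) R"
    using K by (intro finprod_ideals_set_ideal) auto
  have CT: "g \<otimes> (z \<otimes> y') \<in> E" if z: "z \<in> C s" and y': "y' \<in> finprod (ideals_set R) K T" for z y'
  proof -
    have zc: "z \<in> carrier R" using z Cc by blast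
    have *: "(g \<otimes> z) \<otimes> (\<Otimes>t\<in>T. x t) \<in> E" if x: "\<And>t. t \<in> T \<Longrightarrow> x t \<in> C t" for x
    proof -
      have xc: "x \<in> T \<rightarrow> carrier R" using x Cc by auto
      have eq: "(\<Otimes>t\<in>T. (x(s := z)) t) = (\<Otimes>t\<in>T. x t)"
        using insert.hyps xc by (intro finprod_cong') auto
      have "(\<Otimes>t\<in>insert s T. (x(s := z)) t) = z \<otimes> (\<Otimes>t\<in>T. (x(s := z)) t)"
        using insert.hyps xc zc by (subst finprod_insert) auto
      moreover have "g \<otimes> (\<Otimes>t\<in>insert s T. (x(s := z)) t) \<in> E"
        using x z by (intro insert.prems(5)) auto
      ultimately show ?thesis
        using insert.prems(1) zc xc unfolding eq by (simp add: m_assoc)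
    qed
    have "(g \<otimes> z) \<otimes> y' \<in> E"
    proof (rule insert.IH[OF _ _ _ _ * y'])
      show "g \<otimes> z \<in> carrier R" using insert.prems(1) zc by simp
      show "ideal (K t) R" "C t \<subseteq> K t" if "t \<in> T" for t
        using K CK that by simp_all
      show "K t \<subseteq> F" if "t \<in> T" "ideal F R" "C t \<subseteq> F" for t F
        using insert.prems(4)[of t F] that by simp
    qed
    then show ?thesis
      using insert.prems(1) zc y' ideal_subset_carrier[OF PT] by (auto simp: m_assoc)
  qed
  have eq: "finprod (ideals_set R) K (insert s T) = K s \<cdot> finprod (ideals_set R) K T"
    by (rule finprod_ideals_set_insert[OF insert.hyps]) (rule K)
  have "finprod (ideals_set R) K (insert s T) \<subseteq> {y \<in> carrier R. g \<otimes> y \<in> E}"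
    unfolding eq
  proof (rule ideal_prod_minimal[OF ideal_colon[OF E insert.prems(1)]])
    fix z y' assume z: "z \<in> K s" and y': "y' \<in> finprod (ideals_set R) K T"
    have y'c: "y' \<in> carrier R" using y' ideal_subset_carrier[OF PT] by auto
    have zc: "z \<in> carrier R" using z ideal_subset_carrier[OF K[of s]] by auto
    have comm: "(g \<otimes> y') \<otimes> z = g \<otimes> (z \<otimes> y')" if "z \<in> carrier R" for z
    proof -
      have "y' \<otimes> z = z \<otimes> y'" by (rule m_comm[OF y'c that])
      then show ?thesis using insert.prems(1) y'c that by (simp add: m_assoc)
    qed
    have "C s \<subseteq> {z \<in> carrier R. (g \<otimes> y') \<otimes> z \<in> E}"
    proof
      fix z assume z: "z \<in> C s"
      then have "z \<in> carrier R" using Cc by blast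
      then show "z \<in> {z \<in> carrier R. (g \<otimes> y') \<otimes> z \<in> E}" using comm CT[OF z y'] by simp
    qed
    then have "K s \<subseteq> {z \<in> carrier R. (g \<otimes> y') \<otimes> z \<in> E}"
      using insert.prems(4)[of s] ideal_colon[OF E, of "g \<otimes> y'"] insert.prems(1) y'c by simp
    then show "z \<otimes> y' \<in> {y \<in> carrier R. g \<otimes> y \<in> E}" using z zc y'c comm by auto
  qed
  then show ?case using insert.prems(6) by auto
qed

lemma poly_funs_mono:
  assumes "ideal N R" "ideal M R" "N \<subseteq> M" "f \<in> poly_funs N"
  shows "f \<in> poly_funs M"
proof -
  have "f \<in> poly_fun N d \<Longrightarrow> f \<in> poly_fun M d" for d f
  proof (induction d arbitrary: f)
    case 0
    then show ?case using assms(3) by auto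
  next
    case (Suc d)
    then obtain c g where "c \<in> N" "g \<in> poly_fun N d" "\<forall>t\<in>carrier R. f t = c \<oplus> t \<otimes> g t" by auto
    then show ?case using Suc.IH assms(3) by (intro poly_fun_SucI[of c _ g]) auto
  qed
  then show ?thesis using assms(4) by (auto simp: poly_funs_def)
qed

lemma poly_funs_finsum:
  assumes N: "ideal N R" and "finite U" "\<And>u. u \<in> U \<Longrightarrow> f u \<in> poly_funs N"
  shows "(\<lambda>t. \<Oplus>u\<in>U. f u t) \<in> poly_funs N"
  using assms(2,3)
proof (induction U rule: finite_induct)
  case empty
  then show ?case using poly_funs_const[OF N ideal_zero_closed[OF N]] by simp
next
  case (insert u U)
  have "(\<lambda>t. f u t \<oplus> (\<Oplus>u\<in>U. f u t)) \<in> poly_funs N"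
    using insert by (intro poly_funs_add N) auto
  then show ?case
  proof (rule poly_funs_cong)
    fix t assume "t \<in> carrier R"
    then have "f u' t \<in> carrier R" if "u' \<in> insert u U" for u'
      using poly_funs_closed[OF N insert.prems[OF that]] ideal_subset_carrier[OF N] by auto
    then show "(\<Oplus>u\<in>insert u U. f u t) = f u t \<oplus> (\<Oplus>u\<in>U. f u t)"
      using insert.hyps by (intro finsum_insert) auto
  qed
qed

lemma poly_funs_finprod:
  assumes "finite T"
  shows "(\<And>t. t \<in> T \<Longrightarrow> ideal (K t) R) \<Longrightarrow> (\<And>t. t \<in> T \<Longrightarrow> f t \<in> poly_funs (K t)) \<Longrightarrow>
    (\<lambda>a. \<Otimes>t\<in>T. f t a) \<in> poly_funs (finprod (ideals_set R) K T)"
  using assms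
proof (induction T rule: finite_induct)
  case empty
  then show ?case by (simp add: finprod_ideals_set_empty poly_funs_const[OF oneideal])
next
  case (insert s T)
  have K: "ideal (K s) R" "ideal (finprod (ideals_set R) K T) R"
    using insert.prems by (auto intro: finprod_ideals_set_ideal)
  have "(\<lambda>a. f s a \<otimes> (\<Otimes>t\<in>T. f t a)) \<in> poly_funs (K s \<cdot> finprod (ideals_set R) K T)"
    by (rule poly_funs_mult[OF K ideal_prod_is_ideal[OF K] ideal_prod.prod])
      (use insert in auto)
  then have "(\<lambda>a. \<Otimes>t\<in>insert s T. f t a) \<in> poly_funs (K s \<cdot> finprod (ideals_set R) K T)"
  proof (rule poly_funs_cong)
    fix a assume a: "a \<in> carrier R"
    have "f t a \<in> carrier R" if "t \<in> insert s T" for t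
      using poly_funs_closed[OF insert.prems(1)[OF that] insert.prems(2)[OF that] a]
        ideal_subset_carrier[OF insert.prems(1)[OF that]] by auto
    then show "(\<Otimes>t\<in>insert s T. f t a) = f s a \<otimes> (\<Otimes>t\<in>T. f t a)"
      using insert.hyps by (intro finprod_insert) auto
  qed
  then show ?case
    using finprod_ideals_set_insert[OF insert.hyps insert.prems(1)] by simp
qed

text \<open>The common shape of all prescribed elements, with variables that may occur in several
  factors: singletons \<open>U t\<close> give products, repeated singletons give powers, and initial
  segments give products of partial sums.\<close>

definition prod_sums :: "('t \<Rightarrow> 'u set) \<Rightarrow> 't set \<Rightarrow> ('u \<Rightarrow> 'a) \<Rightarrow> 'a"
  where "prod_sums U T l = (\<Otimes>\<^bsub>R\<^esub>t\<in>T. \<Oplus>\<^bsub>R\<^esub>u\<in>U t. l u)"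

end

text \<open>Straight lines in the variables \<open>l\<close> become polynomial paths between values
  of \<open>prod_sums\<close>. What remains is that these values generate I. By multilinearity this
  may be tested on products with each factor taken from a single \<open>J u\<close>, which is the
  content of \<open>gen\<close>; it is immediate if no variable is shared and comes from
  polarization otherwise.\<close>

theorem (in local_ring) prod_sums_reduction:
  fixes U :: "'t \<Rightarrow> 'u set" and i p :: nat
  assumes inf: "infinite (carrier (A Quot \<mm>))"
    and T: "finite T" and U: "\<And>t. t \<in> T \<Longrightarrow> finite (U t)" "\<And>t. t \<in> T \<Longrightarrow> U t \<subseteq> D"
    and J: "\<And>u. u \<in> D \<Longrightarrow> ideal (J u) A"
    and I: "I = (\<Otimes>\<^bsub>ideals_set A\<^esub>t\<in>T. \<Oplus>\<^bsub>ideals_set A\<^esub>u\<in>U t. J u)"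
    and gen: "\<And>w x E. ideal E A \<Longrightarrow> (\<And>l. (\<And>u. u \<in> D \<Longrightarrow> l u \<in> J u) \<Longrightarrow> prod_sums U T l \<in> E) \<Longrightarrow>
      (\<And>t. t \<in> T \<Longrightarrow> w t \<in> U t) \<Longrightarrow> (\<And>t. t \<in> T \<Longrightarrow> x t \<in> J (w t)) \<Longrightarrow> (\<Otimes>t\<in>T. x t) \<in> E"
    and i: "i \<ge> 1"
    and small: "min_gens A (I [^]\<^bsub>ideals_set A\<^esub> i) < enat ((i + p) choose i)"
  shows "\<exists>h \<in> {1..p} \<rightarrow> I.
    I [^]\<^bsub>ideals_set A\<^esub> i = (Idl (h ` {1..p})) \<cdot> (I [^]\<^bsub>ideals_set A\<^esub> (i - 1)) \<and>
    (\<forall>j\<in>{1..p}. \<exists>l. (\<forall>u\<in>D. l u \<in> J u) \<and> h j = prod_sums U T l)"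
proof -
  define K where "K t = (\<Oplus>\<^bsub>ideals_set A\<^esub>u\<in>U t. J u)" for t
  have JU: "ideal (J u) A" if "t \<in> T" "u \<in> U t" for t u using that U J by blast
  have K: "ideal (K t) A" if "t \<in> T" for t
    unfolding K_def by (rule finsum_ideals_set_ideal) (rule JU[OF that])
  have JK: "J u \<subseteq> K t" if "t \<in> T" "u \<in> U t" for t u
    unfolding K_def using U JU that by (intro finsum_ideals_set_upper) auto
  have IK: "I = finprod (ideals_set A) K T"
    unfolding I K_def ..
  have I_ideal: "ideal I A" unfolding IK by (rule finprod_ideals_set_ideal[OF K])
  define V where "V = {prod_sums U T l |l. \<forall>u\<in>D. l u \<in> J u}"
  have lines: "(\<lambda>a. prod_sums U T (\<lambda>u. f u a)) \<in> poly_funs I"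
    if f: "\<And>u. u \<in> D \<Longrightarrow> f u \<in> poly_funs (J u)" for f :: "'u \<Rightarrow> 'a \<Rightarrow> 'a"
    unfolding IK prod_sums_def
  proof (rule poly_funs_finprod[OF T K])
    fix t assume t: "t \<in> T"
    show "(\<lambda>a. \<Oplus>u\<in>U t. f u a) \<in> poly_funs (K t)"
      using poly_funs_mono[OF JU K JK] t U f by (intro poly_funs_finsum K) blast+
  qed
  have path: "\<exists>f\<in>poly_funs I. f \<zero> = v \<and> f \<one> = w \<and> (\<forall>t\<in>carrier A. f t \<in> V)"
    if "v \<in> V" "w \<in> V" for v w
  proof -
    obtain l l' where l: "\<forall>u\<in>D. l u \<in> J u" "v = prod_sums U T l"
      and l': "\<forall>u\<in>D. l' u \<in> J u" "w = prod_sums U T l'"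
      using \<open>v \<in> V\<close> \<open>w \<in> V\<close> by (auto simp: V_def)
    \<comment> \<open>The segment from \<open>l\<close> to \<open>l'\<close>; each variable stays in
      its ideal \<open>J u\<close> along the way.\<close>
    define f where "f u a = l u \<oplus> a \<otimes> (l' u \<ominus> l u)" for u a
    have lc: "l u \<in> carrier A" "l' u \<in> carrier A" if "u \<in> D" for u
      using l l' ideal_subset_carrier[OF J[OF that]] that by auto
    have fJ: "f u \<in> poly_funs (J u)" if "u \<in> D" for u
      unfolding f_def using that l l'
      by (intro poly_funs_add poly_funs_mult_left J poly_funs_id poly_funs_const
          ideal_minus_closed) auto
    have fa: "f u a \<in> J u" if "u \<in> D" "a \<in> carrier A" for u a
      using poly_funs_closed[OF J fJ] that by blast
    have eq: "prod_sums U T (\<lambda>u. f u a) = prod_sums U T m"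
      if m: "\<And>u. u \<in> D \<Longrightarrow> m u \<in> carrier A" "\<And>u. u \<in> D \<Longrightarrow> f u a = m u" for m a
    proof -
      have "(\<Oplus>u\<in>U t. f u a) = (\<Oplus>u\<in>U t. m u)" if t: "t \<in> T" for t
        using m U(2)[OF t] by (intro finsum_cong') auto
      moreover have "(\<Oplus>u\<in>U t. m u) \<in> carrier A" if t: "t \<in> T" for t
        using m(1) U(2)[OF t] by (intro finsum_closed) auto
      ultimately show ?thesis unfolding prod_sums_def by (intro finprod_cong') auto
    qed
    have "prod_sums U T (\<lambda>u. f u \<zero>) = v"
      unfolding l(2) by (rule eq) (use lc in \<open>auto simp: f_def\<close>)
    moreover have "prod_sums U T (\<lambda>u. f u \<one>) = w"
      unfolding l'(2)
    proof (rule eq)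
      fix u assume "u \<in> D"
      then show "f u \<one> = l' u" unfolding f_def using lc[of u] by algebra
    qed (use lc in auto)
    moreover have "prod_sums U T (\<lambda>u. f u a) \<in> V" if "a \<in> carrier A" for a
      using fa that by (auto simp: V_def)
    ultimately show ?thesis
      using lines[of f, OF fJ] by (intro bexI[of _ "\<lambda>a. prod_sums U T (\<lambda>u. f u a)"]) auto
  qed
  have VI: "V \<subseteq> I"
  proof
    fix v assume "v \<in> V"
    then obtain l where l: "\<forall>u\<in>D. l u \<in> J u" "v = prod_sums U T l" by (auto simp: V_def)
    have "(\<lambda>a. prod_sums U T (\<lambda>u. (\<lambda>_. l u) a)) \<in> poly_funs I"
      using l(1) by (intro lines poly_funs_const J) auto
    then show "v \<in> I" using poly_funs_closed[OF I_ideal _ one_closed] l(2) by auto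
  qed
  then have Vc: "V \<subseteq> carrier A" using ideal_subset_carrier[OF I_ideal] by auto
  have E: "ideal (Idl V) A" by (rule genideal_ideal[OF Vc])
  have VE: "prod_sums U T l \<in> Idl V" if "\<And>u. u \<in> D \<Longrightarrow> l u \<in> J u" for l
    using genideal_self[OF Vc] that by (auto simp: V_def)
  have "I \<subseteq> Idl V"
  proof
    fix y assume y: "y \<in> I"
    have "\<one> \<otimes> y \<in> Idl V"
    \<comment> \<open>The sum \<open>K t\<close> is generated by the union of its summands. An
      element of the union lies in one summand, and \<open>w t\<close> below names it.\<close>
    proof (rule finprod_ideals_set_least[OF E T, where K = K and C = "\<lambda>t. \<Union>u\<in>U t. J u"])
      show "y \<in> finprod (ideals_set A) K T" using y IK by simp
      show "(\<Union>u\<in>U t. J u) \<subseteq> K t" if "t \<in> T" for t using JK[OF that] by blast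
      show "K t \<subseteq> F" if "t \<in> T" "ideal F A" "(\<Union>u\<in>U t. J u) \<subseteq> F" for t F
        unfolding K_def using that JU U by (intro finsum_ideals_set_least) auto
      fix x assume "\<And>t. t \<in> T \<Longrightarrow> x t \<in> (\<Union>u\<in>U t. J u)"
      then have "\<forall>t\<in>T. \<exists>u\<in>U t. x t \<in> J u" by auto
      then obtain w where w: "\<And>t. t \<in> T \<Longrightarrow> w t \<in> U t" "\<And>t. t \<in> T \<Longrightarrow> x t \<in> J (w t)" by metis
      have "(\<Otimes>t\<in>T. x t) \<in> Idl V" by (rule gen[OF E VE w])
      then show "\<one> \<otimes> (\<Otimes>t\<in>T. x t) \<in> Idl V"
        using ideal_subset_carrier[OF E] by auto
    qed (use K in auto)
    then show "y \<in> Idl V" using y ideal_subset_carrier[OF I_ideal] by auto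
  qed
  then have V_gen: "Idl V = I" using genideal_minimal[OF I_ideal VI] by blast
  have "V \<noteq> {}"
    using ideal_zero_closed[OF J] by (auto simp: V_def intro!: exI[of _ "\<lambda>_. \<zero>"])
  then interpret polynomially_connected A \<mm> I V
    by (intro polynomially_connected.intro polynomially_connected_axioms.intro
        local_ring_axioms inf I_ideal VI path)
  obtain h where h: "h \<in> {1..p} \<rightarrow> V"
    "I [^]\<^bsub>ideals_set A\<^esub> i = (Idl (h ` {1..p})) \<cdot> (I [^]\<^bsub>ideals_set A\<^esub> (i - 1))"
    using power_reduction[OF V_gen i small] by blast
  have "\<exists>l. (\<forall>u\<in>D. l u \<in> J u) \<and> h j = prod_sums U T l" if "j \<in> {1..p}" for j
    using funcset_mem[OF h(1) that] by (auto simp: V_def)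
  then show ?thesis using h VI by (intro bexI[of _ h]) auto
qed

text \<open>Turns powers into repeated factors. It is stated for commutative monoids so as to apply
  both to ring elements and to ideals.\<close>

lemma (in comm_monoid) finprod_Sigma_const:
  fixes b :: "'t \<Rightarrow> nat"
  assumes "finite S" "f \<in> S \<rightarrow> carrier G"
  shows "(\<Otimes>x\<in>Sigma S (\<lambda>t. {..<b t}). f (fst x)) = (\<Otimes>t\<in>S. f t [^] b t)"
  using assms
proof (induction S rule: finite_induct)
  case (insert s S)
  have fs: "f s \<in> carrier G" using insert.prems by auto
  have "(\<Otimes>x\<in>{s} \<times> {..<b s}. f (fst x)) = (\<Otimes>x\<in>{s} \<times> {..<b s}. f s)"
    using fs by (intro finprod_cong') auto
  also have "\<dots> = f s [^] b s"
    using finprod_const[OF fs, of "{s} \<times> {..<b s}"] by (simp add: card_cartesian_product)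
  finally have s: "(\<Otimes>x\<in>{s} \<times> {..<b s}. f (fst x)) = f s [^] b s" .
  have "Sigma (insert s S) (\<lambda>t. {..<b t}) = ({s} \<times> {..<b s}) \<union> Sigma S (\<lambda>t. {..<b t})" by auto
  moreover have "(\<Otimes>x\<in>({s} \<times> {..<b s}) \<union> Sigma S (\<lambda>t. {..<b t}). f (fst x)) =
      (\<Otimes>x\<in>{s} \<times> {..<b s}. f (fst x)) \<otimes> (\<Otimes>x\<in>Sigma S (\<lambda>t. {..<b t}). f (fst x))"
    using insert by (intro finprod_Un_disjoint) auto
  moreover have "(\<Otimes>t\<in>insert s S. f t [^] b t) = f s [^] b s \<otimes> (\<Otimes>t\<in>S. f t [^] b t)"
    using insert by (intro finprod_insert) auto
  ultimately show ?case using insert s by auto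
qed simp

lemma (in cring) finsum_ideals_set_singleton:
  assumes "ideal (J u) R"
  shows "(\<Oplus>\<^bsub>ideals_set R\<^esub>v\<in>{u}. J v) = J u"
proof -
  interpret IS: semiring "ideals_set R" by (rule ideals_set_is_semiring)
  have "J u \<in> carrier (ideals_set R)" using assms by (simp add: carrier_ideals_set)
  then show ?thesis by (simp add: IS.finsum_insert)
qed

section \<open>Polarization\<close>

text \<open>\<open>polar U [(u\<^sub>1, x\<^sub>1), \<dots>, (u\<^sub>n, x\<^sub>n)] T l\<close> is the derivative of \<open>prod_sums U T\<close> at \<open>l\<close> in the
  directions \<open>x\<^sub>k\<close> of the variables \<open>u\<^sub>k\<close>.\<close>

primrec (in ring) polar ::
  "('t \<Rightarrow> 'u set) \<Rightarrow> ('u \<times> 'a) list \<Rightarrow> 't set \<Rightarrow> ('u \<Rightarrow> 'a) \<Rightarrow> 'a"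
  where
    "polar U [] T l = (\<Otimes>t\<in>T. \<Oplus>u\<in>U t. l u)"
  | "polar U (d # ds) T l = (\<Oplus>t\<in>{t \<in> T. fst d \<in> U t}. snd d \<otimes> polar U ds (T - {t}) l)"

text \<open>Counts the ways to assign distinct factors to the listed variables, each factor
  containing its variable. For \<open>b\<close> factors that are all the same singleton, and that
  variable listed \<open>b\<close> times, the count is b!.\<close>

primrec polar_count :: "('t \<Rightarrow> 'u set) \<Rightarrow> 'u list \<Rightarrow> 't set \<Rightarrow> nat"
  where
    "polar_count U [] T = 1"
  | "polar_count U (u # us) T = (\<Sum>t\<in>{t \<in> T. u \<in> U t}. polar_count U us (T - {t}))"

text \<open>Assigning the factor \<open>t\<close> to the variable \<open>w t\<close> is one of the
  ways counted.\<close>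

lemma polar_count_pos:
  "distinct ts \<Longrightarrow> (\<And>t. t \<in> set ts \<Longrightarrow> w t \<in> U t) \<Longrightarrow> polar_count U (map w ts) (set ts) \<ge> 1"
proof (induction ts)
  case (Cons t ts)
  have "1 \<le> polar_count U (map w ts) (set ts)" using Cons by auto
  also have "\<dots> = polar_count U (map w ts) (set (t # ts) - {t})" using Cons.prems by simp
  also have "\<dots> \<le> (\<Sum>t'\<in>{t' \<in> set (t # ts). w t \<in> U t'}. polar_count U (map w ts) (set (t # ts) - {t'}))"
    by (rule member_le_sum) (use Cons.prems in auto)
  finally show ?case by simp
qed simp

context cring
begin

lemma polar_closed:
  assumes "\<And>u. l u \<in> carrier R"
  shows "snd ` set ds \<subseteq> carrier R \<Longrightarrow> polar U ds T l \<in> carrier R"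
proof (induction ds arbitrary: T)
  case Nil
  then show ?case using assms by (auto intro!: finprod_closed finsum_closed)
next
  case (Cons d ds)
  then show ?case by (auto intro!: finsum_closed)
qed

text \<open>Taylor expansion to first order in one variable. Of the coefficient of the square of
  \<open>a\<close> it only matters that it is polynomial in \<open>a\<close>.\<close>

lemma polar_expand_prod:
  assumes l: "\<And>u. l u \<in> carrier R" and x: "x \<in> carrier R"
    and "finite T"
  shows "(\<And>t. t \<in> T \<Longrightarrow> finite (U t)) \<Longrightarrow> \<exists>r\<in>poly_funs (carrier R). \<forall>a\<in>carrier R.
    polar U [] T (l(v := l v \<oplus> a \<otimes> x)) =
    polar U [] T l \<oplus> a \<otimes> (polar U [(v, x)] T l \<oplus> a \<otimes> r a)"
  using assms(3)
proof (induction T rule: finite_induct)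
  case empty
  then show ?case using poly_funs_const[OF oneideal zero_closed] by (intro bexI[of _ "\<lambda>_. \<zero>"]) auto
next
  case (insert s T)
  obtain r where r: "r \<in> poly_funs (carrier R)"
    and eq: "\<And>a. a \<in> carrier R \<Longrightarrow> polar U [] T (l(v := l v \<oplus> a \<otimes> x)) =
      polar U [] T l \<oplus> a \<otimes> (polar U [(v, x)] T l \<oplus> a \<otimes> r a)"
    using insert.IH insert.prems by auto
  have l': "(l(v := l v \<oplus> a \<otimes> x)) u \<in> carrier R" if "a \<in> carrier R" for a u
    using l x that by auto
  define S where "S = (\<Oplus>u\<in>U s. l u)"
  define d where "d = (if v \<in> U s then x else \<zero>)"
  define P where "P = polar U [] T l"
  define H where "H = polar U [(v, x)] T l"
  have c: "S \<in> carrier R" "d \<in> carrier R" "P \<in> carrier R" "H \<in> carrier R"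
    unfolding S_def d_def P_def H_def
    using l x polar_closed[of l "[]" U T, OF l] polar_closed[of l "[(v, x)]" U T, OF l]
    by (auto intro!: finsum_closed simp del: polar.simps)
  have rc: "r a \<in> carrier R" if "a \<in> carrier R" for a
    using poly_funs_closed[OF oneideal r that] .
  have S': "(\<Oplus>u\<in>U s. (l(v := l v \<oplus> a \<otimes> x)) u) = S \<oplus> a \<otimes> d" if a: "a \<in> carrier R" for a
  proof (cases "v \<in> U s")
    case True
    have fin: "finite (U s - {v})" "v \<notin> U s - {v}" using insert.prems by auto
    have U: "U s = insert v (U s - {v})" using True by auto
    have "(\<Oplus>u\<in>U s - {v}. (l(v := l v \<oplus> a \<otimes> x)) u) = (\<Oplus>u\<in>U s - {v}. l u)"
      using l by (intro finsum_cong') auto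
    moreover have "(\<Oplus>u\<in>insert v (U s - {v}). (l(v := l v \<oplus> a \<otimes> x)) u) =
        (l v \<oplus> a \<otimes> x) \<oplus> (\<Oplus>u\<in>U s - {v}. (l(v := l v \<oplus> a \<otimes> x)) u)"
      using l'[OF a] l x a fin by (subst finsum_insert) auto
    moreover have "S = l v \<oplus> (\<Oplus>u\<in>U s - {v}. l u)"
      unfolding S_def using l fin U finsum_insert[OF fin, of l] by auto
    moreover have "(\<Oplus>u\<in>U s - {v}. l u) \<in> carrier R" using l by (intro finsum_closed) auto
    ultimately show ?thesis using U True l[of v] a x by (simp add: d_def a_ac)
  next
    case False
    then have "(\<Oplus>u\<in>U s. (l(v := l v \<oplus> a \<otimes> x)) u) = S"
      unfolding S_def using l by (intro finsum_cong') auto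
    then show ?thesis using False a c by (simp add: d_def)
  qed
  have ins: "polar U [] (insert s T) m = (\<Oplus>u\<in>U s. m u) \<otimes> polar U [] T m"
    if "\<And>u. m u \<in> carrier R" for m
    using that insert.hyps by (auto intro!: finprod_insert finsum_closed)
  have insT: "polar U [] (insert s T - {t}) l = S \<otimes> polar U [] (T - {t}) l" if "t \<in> T" for t
  proof -
    have "insert s T - {t} = insert s (T - {t})" "s \<notin> T - {t}" using that insert.hyps by auto
    then show ?thesis
      unfolding S_def using l insert.hyps by (auto intro!: finprod_insert finsum_closed)
  qed
  let ?T = "{t \<in> T. v \<in> U t}"
  have "H = (\<Oplus>t\<in>?T. x \<otimes> polar U [] (T - {t}) l)" by (simp add: H_def)
  then have SH: "S \<otimes> H = (\<Oplus>t\<in>?T. S \<otimes> (x \<otimes> polar U [] (T - {t}) l))"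
    using insert.hyps c x polar_closed[of l "[]", OF l]
    by (auto intro!: finsum_rdistr simp del: polar.simps)
  also have "\<dots> = (\<Oplus>t\<in>?T. x \<otimes> polar U [] (insert s T - {t}) l)"
    using c x polar_closed[of l "[]", OF l]
    by (intro finsum_cong') (auto simp: insT m_lcomm simp del: polar.simps)
  finally have SH: "(\<Oplus>t\<in>?T. x \<otimes> polar U [] (insert s T - {t}) l) = S \<otimes> H" ..
  \<comment> \<open>The Leibniz rule: \<open>S\<close> is the new factor, and \<open>d\<close> is
    its derivative in the direction \<open>x\<close> of the variable \<open>v\<close>.\<close>
  have H': "polar U [(v, x)] (insert s T) l = S \<otimes> H \<oplus> d \<otimes> P"
  proof (cases "v \<in> U s")
    case True
    have "{t \<in> insert s T. v \<in> U t} = insert s ?T" using True by auto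
    then have "polar U [(v, x)] (insert s T) l =
      (\<Oplus>t\<in>insert s ?T. x \<otimes> polar U [] (insert s T - {t}) l)" by simp
    also have "\<dots> = x \<otimes> polar U [] (insert s T - {s}) l \<oplus> (\<Oplus>t\<in>?T. x \<otimes> polar U [] (insert s T - {t}) l)"
      using insert.hyps x polar_closed[of l "[]", OF l]
      by (intro finsum_insert) (auto simp del: polar.simps)
    also have "insert s T - {s} = T" using insert.hyps by auto
    finally show ?thesis unfolding SH using c True x by (simp add: d_def P_def a_comm del: polar.simps)
  next
    case False
    then have "{t \<in> insert s T. v \<in> U t} = ?T" by auto
    then have "polar U [(v, x)] (insert s T) l = (\<Oplus>t\<in>?T. x \<otimes> polar U [] (insert s T - {t}) l)" by simp
    then show ?thesis unfolding SH using c False by (simp add: d_def)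
  qed
  \<comment> \<open>What remains of (S + a d) (P + a (H + a r)) after removal of the terms of degree
    0 and 1 and division by the square of \<open>a\<close>.\<close>
  define r' where "r' a = S \<otimes> r a \<oplus> d \<otimes> (H \<oplus> a \<otimes> r a)" for a
  have "r' \<in> poly_funs (carrier R)"
    unfolding r'_def using c r
    by (intro poly_funs_add poly_funs_mult_left oneideal poly_funs_const poly_funs_id) auto
  moreover have "polar U [] (insert s T) (l(v := l v \<oplus> a \<otimes> x)) =
      polar U [] (insert s T) l \<oplus> a \<otimes> (polar U [(v, x)] (insert s T) l \<oplus> a \<otimes> r' a)"
    if a: "a \<in> carrier R" for a
  proof -
    have "polar U [] (insert s T) (l(v := l v \<oplus> a \<otimes> x)) = (S \<oplus> a \<otimes> d) \<otimes> (P \<oplus> a \<otimes> (H \<oplus> a \<otimes> r a))"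
      unfolding ins[of "l(v := l v \<oplus> a \<otimes> x)", OF l'[OF a]] S'[OF a] eq[OF a] P_def H_def ..
    also have "\<dots> = S \<otimes> P \<oplus> a \<otimes> (S \<otimes> H \<oplus> d \<otimes> P \<oplus> a \<otimes> r' a)"
      unfolding r'_def using c a rc[OF a] by algebra
    also have "\<dots> = polar U [] (insert s T) l \<oplus> a \<otimes> (polar U [(v, x)] (insert s T) l \<oplus> a \<otimes> r' a)"
      unfolding H' ins[of l, OF l] S_def P_def ..
    finally show ?thesis .
  qed
  ultimately show ?case by (intro bexI[of _ r'] ballI)
qed

text \<open>The recursion of \<open>polar\<close> takes derivatives from the front of the list and
  reaches the product itself last. Hence a further derivative of that product is appended at the
  end.\<close>

lemma polar_expand:
  assumes l: "\<And>u. l u \<in> carrier R" and x: "x \<in> carrier R"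
  shows "finite T \<Longrightarrow> (\<And>t. t \<in> T \<Longrightarrow> finite (U t)) \<Longrightarrow> snd ` set ds \<subseteq> carrier R \<Longrightarrow>
    \<exists>r\<in>poly_funs (carrier R). \<forall>a\<in>carrier R.
      polar U ds T (l(v := l v \<oplus> a \<otimes> x)) =
      polar U ds T l \<oplus> a \<otimes> (polar U (ds @ [(v, x)]) T l \<oplus> a \<otimes> r a)"
proof (induction ds arbitrary: T)
  case Nil
  then show ?case using polar_expand_prod[of l x T U v, OF l x Nil(1,2)] by (simp only: append_Nil)
next
  case (Cons d ds)
  define y where "y = snd d"
  have y: "y \<in> carrier R" using Cons.prems(3) by (simp add: y_def)
  let ?Q = "{t \<in> T. fst d \<in> U t}"
  have fin: "finite ?Q" using Cons.prems(1) by simp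
  have "\<exists>r\<in>poly_funs (carrier R). \<forall>a\<in>carrier R.
      polar U ds (T - {t}) (l(v := l v \<oplus> a \<otimes> x)) =
      polar U ds (T - {t}) l \<oplus> a \<otimes> (polar U (ds @ [(v, x)]) (T - {t}) l \<oplus> a \<otimes> r a)" for t
    using Cons.prems by (intro Cons.IH) auto
  then obtain r where r: "\<And>t. r t \<in> poly_funs (carrier R)"
    and eq: "\<And>t a. a \<in> carrier R \<Longrightarrow> polar U ds (T - {t}) (l(v := l v \<oplus> a \<otimes> x)) =
      polar U ds (T - {t}) l \<oplus> a \<otimes> (polar U (ds @ [(v, x)]) (T - {t}) l \<oplus> a \<otimes> r t a)"
    by metis
  define P where "P t = polar U ds (T - {t}) l" for t
  define H where "H t = polar U (ds @ [(v, x)]) (T - {t}) l" for t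
  have c: "P t \<in> carrier R" "H t \<in> carrier R" for t
    unfolding P_def H_def using Cons.prems(3) x by (intro polar_closed[of l, OF l]; simp)+
  have rc: "r t a \<in> carrier R" if "a \<in> carrier R" for t a
    using poly_funs_closed[OF oneideal r that] .
  define r' where "r' a = (\<Oplus>t\<in>?Q. y \<otimes> r t a)" for a
  have "r' \<in> poly_funs (carrier R)"
    unfolding r'_def using y r fin
    by (intro poly_funs_finsum poly_funs_mult_left oneideal poly_funs_const) auto
  moreover have "polar U (d # ds) T (l(v := l v \<oplus> a \<otimes> x)) =
      polar U (d # ds) T l \<oplus> a \<otimes> (polar U ((d # ds) @ [(v, x)]) T l \<oplus> a \<otimes> r' a)"
    if a: "a \<in> carrier R" for a
  proof -
    have "polar U (d # ds) T (l(v := l v \<oplus> a \<otimes> x)) = (\<Oplus>t\<in>?Q. y \<otimes> (P t \<oplus> a \<otimes> (H t \<oplus> a \<otimes> r t a)))"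
      by (simp add: eq[OF a] P_def H_def y_def)
    also have "\<dots> = (\<Oplus>t\<in>?Q. y \<otimes> P t \<oplus> a \<otimes> (y \<otimes> H t \<oplus> a \<otimes> (y \<otimes> r t a)))"
    proof (rule finsum_cong')
      fix t
      show "y \<otimes> (P t \<oplus> a \<otimes> (H t \<oplus> a \<otimes> r t a)) = y \<otimes> P t \<oplus> a \<otimes> (y \<otimes> H t \<oplus> a \<otimes> (y \<otimes> r t a))"
        using y a c[of t] rc[OF a, of t] by algebra
    qed (use y a c rc in auto)
    also have "\<dots> = (\<Oplus>t\<in>?Q. y \<otimes> P t) \<oplus> (\<Oplus>t\<in>?Q. a \<otimes> (y \<otimes> H t \<oplus> a \<otimes> (y \<otimes> r t a)))"
      using y a c rc by (intro finsum_addf) auto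
    also have "(\<Oplus>t\<in>?Q. a \<otimes> (y \<otimes> H t \<oplus> a \<otimes> (y \<otimes> r t a))) = a \<otimes> (\<Oplus>t\<in>?Q. y \<otimes> H t \<oplus> a \<otimes> (y \<otimes> r t a))"
      using y a c rc fin by (intro finsum_rdistr[symmetric]) auto
    also have "(\<Oplus>t\<in>?Q. y \<otimes> H t \<oplus> a \<otimes> (y \<otimes> r t a)) =
        (\<Oplus>t\<in>?Q. y \<otimes> H t) \<oplus> (\<Oplus>t\<in>?Q. a \<otimes> (y \<otimes> r t a))"
      using y a c rc by (intro finsum_addf) auto
    also have "(\<Oplus>t\<in>?Q. a \<otimes> (y \<otimes> r t a)) = a \<otimes> r' a"
      unfolding r'_def using y a rc fin by (intro finsum_rdistr[symmetric]) auto
    finally show ?thesis by (simp add: P_def H_def y_def fun_upd_def)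
  qed
  ultimately show ?case by (intro bexI[of _ r'] ballI)
qed

lemma finsum_add_pow:
  assumes "finite Q" "z \<in> carrier R"
  shows "(\<Oplus>t\<in>Q. [(n t :: nat)] \<cdot> z) = [(\<Sum>t\<in>Q. n t)] \<cdot> z"
  using assms(1)
proof (induction Q rule: finite_induct)
  case (insert t Q)
  then have "(\<Oplus>t\<in>insert t Q. [n t] \<cdot> z) = [n t] \<cdot> z \<oplus> (\<Oplus>t\<in>Q. [n t] \<cdot> z)"
    using assms(2) by (intro finsum_insert) auto
  then show ?case using insert assms(2) by (simp add: add.nat_pow_mult)
qed simp

text \<open>With as many derivatives as factors no factor is left to depend on \<open>l\<close>, and
  every admissible assignment contributes the product of the directions once.\<close>

lemma polar_full:
  assumes "snd ` set ds \<subseteq> carrier R" "finite T" "card T = length ds"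
  shows "polar U ds T l = [polar_count U (map fst ds) T] \<cdot> foldr (\<lambda>d. (\<otimes>) (snd d)) ds \<one>"
  using assms
proof (induction ds arbitrary: T)
  case Nil
  then show ?case by simp
next
  case (Cons d ds)
  define P where "P = foldr (\<lambda>d. (\<otimes>) (snd d)) ds \<one>"
  have "foldr (\<lambda>d. (\<otimes>) (snd d)) es \<one> \<in> carrier R" if "snd ` set es \<subseteq> carrier R" for es
    using that by (induction es) auto
  then have c: "snd d \<in> carrier R" "P \<in> carrier R" using Cons.prems(1) by (auto simp: P_def)
  let ?Q = "{t \<in> T. fst d \<in> U t}"
  have "polar U (d # ds) T l = (\<Oplus>t\<in>?Q. [polar_count U (map fst ds) (T - {t})] \<cdot> (snd d \<otimes> P))"
    unfolding polar.simps
  proof (rule finsum_cong')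
    fix t assume "t \<in> ?Q"
    then have "polar U ds (T - {t}) l = [polar_count U (map fst ds) (T - {t})] \<cdot> P"
      unfolding P_def using Cons.prems by (intro Cons.IH) auto
    then show "snd d \<otimes> polar U ds (T - {t}) l = [polar_count U (map fst ds) (T - {t})] \<cdot> (snd d \<otimes> P)"
      using c by (simp add: add_pow_rdistr)
  qed (use c in auto)
  then show ?case using Cons.prems(2) c by (simp add: finsum_add_pow P_def)
qed

end

section \<open>From derivatives to membership in an ideal\<close>

context local_ring
begin

text \<open>The derivative at \<open>\<zero>\<close> of a polynomial with values in \<open>E\<close>
  is again in \<open>E\<close>. The constant term is the value at \<open>\<zero>\<close>; after
  subtracting it, division by \<open>a\<close> is possible for units \<open>a\<close>, and
  interpolation recovers the quotient at \<open>\<zero>\<close>. This works in any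
  characteristic.\<close>

lemma linear_coeff_mem:
  assumes inf: "infinite (carrier (A Quot \<mm>))" and E: "ideal E A"
    and c: "c0 \<in> carrier A" "c1 \<in> carrier A" and r: "r \<in> poly_funs (carrier A)"
    and mem: "\<And>a. a \<in> carrier A \<Longrightarrow> c0 \<oplus> a \<otimes> (c1 \<oplus> a \<otimes> r a) \<in> E"
  shows "c1 \<in> E"
proof -
  define g where "g a = c1 \<oplus> a \<otimes> r a" for a
  have "g \<in> poly_funs (carrier A)"
    unfolding g_def using c r by (intro poly_funs_add poly_funs_mult_left oneideal poly_funs_const poly_funs_id) auto
  then obtain d where d: "g \<in> poly_fun (carrier A) d" by (auto simp: poly_funs_def)
  have z: "\<zero> \<in> carrier A" by auto
  have gc: "g a \<in> carrier A" if "a \<in> carrier A" for a using poly_fun_carrier[OF oneideal d that] .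
  have c0: "c0 \<in> E" using mem[OF z] gc[OF z] c by (simp add: g_def)
  have "g \<zero> \<in> E"
  proof (rule poly_fun_mem_ideal[OF inf E d small_coset[OF z] _ z])
    fix a assume a: "a \<in> carrier A" "a \<notin> {t \<in> carrier A. t \<ominus> \<zero> \<in> \<mm>}"
    moreover have "a \<ominus> \<zero> = a" using a(1) by algebra
    ultimately have "a \<in> Units A" by (intro Units_if_notin_maximal) auto
    moreover have "a \<otimes> g a \<in> E"
    proof -
      have "(c0 \<oplus> a \<otimes> g a) \<ominus> c0 \<in> E"
        using mem[OF a(1)] c0 by (intro ideal_minus_closed[OF E]) (auto simp: g_def)
      moreover have "(c0 \<oplus> a \<otimes> g a) \<ominus> c0 = a \<otimes> g a" using c a(1) gc[OF a(1)] by algebra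
      ultimately show ?thesis by simp
    qed
    ultimately show "g a \<in> E" using ideal_unit_cancel[OF E] gc[OF a(1)] by blast
  qed
  then show ?thesis using c r poly_funs_closed[OF oneideal r z] by (simp add: g_def)
qed

lemma char_zero_nat_unit:
  fixes n :: nat
  assumes "ring_char (A Quot \<mm>) = 0" "n \<ge> 1"
  shows "[n] \<cdot> \<one> \<in> Units A"
proof (rule Units_if_notin_maximal)
  interpret Q: ring "A Quot \<mm>" by (rule quotient_is_ring)
  interpret h: ring_hom_ring A "A Quot \<mm>" "(+>) \<mm>" by (rule rcos_ring_hom_ring)
  have hom: "\<mm> +> ([k] \<cdot> \<one>) = [k] \<cdot>\<^bsub>A Quot \<mm>\<^esub> \<one>\<^bsub>A Quot \<mm>\<^esub>" for k :: nat
    by (induction k) simp_all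
  show "[n] \<cdot> \<one> \<notin> \<mm>"
  proof
    assume n: "[n] \<cdot> \<one> \<in> \<mm>"
    have "\<zero>\<^bsub>A Quot \<mm>\<^esub> = \<mm>" by (simp only: FactRing_def ring.select_convs)
    then have "[n] \<cdot>\<^bsub>A Quot \<mm>\<^esub> \<one>\<^bsub>A Quot \<mm>\<^esub> = \<zero>\<^bsub>A Quot \<mm>\<^esub>"
      by (simp only: hom[symmetric] a_rcos_zero[OF is_ideal n])
    \<comment> \<open>Characteristic zero is encoded as order 0, and 0 divides only 0.\<close>
    then have "Q.add.ord \<one>\<^bsub>A Quot \<mm>\<^esub> dvd n"
      using Q.add.pow_eq_id[of "\<one>\<^bsub>A Quot \<mm>\<^esub>" n] by simp
    then show False using assms by (simp add: ring_char_def)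
  qed
qed auto

text \<open>Derivatives of a function with values in \<open>E\<close> stay in \<open>E\<close>.
  Differentiating once for each factor \<open>t\<close>, in the direction \<open>x t\<close> of the
  variable \<open>w t\<close>, leaves a positive integer multiple of the product of the
  \<open>x t\<close>; the integer is a unit in residue characteristic zero.\<close>

theorem polarization:
  assumes inf: "infinite (carrier (A Quot \<mm>))" and char: "ring_char (A Quot \<mm>) = 0"
    and T: "finite T" and U: "\<And>t. t \<in> T \<Longrightarrow> finite (U t)" "\<And>t. t \<in> T \<Longrightarrow> U t \<subseteq> D"
    and J: "\<And>u. u \<in> D \<Longrightarrow> ideal (J u) A"
    and E: "ideal E A" "\<And>l. (\<And>u. u \<in> D \<Longrightarrow> l u \<in> J u) \<Longrightarrow> prod_sums U T l \<in> E"
    and w: "\<And>t. t \<in> T \<Longrightarrow> w t \<in> U t" "\<And>t. t \<in> T \<Longrightarrow> x t \<in> J (w t)"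
  shows "(\<Otimes>t\<in>T. x t) \<in> E"
proof -
  have Jc: "y \<in> carrier A" if "u \<in> D" "y \<in> J u" for u y
    using subsetD[OF ideal_subset_carrier[OF J[OF that(1)]] that(2)] .
  have polar: "polar U ds T l \<in> E"
    if "\<And>u. l u \<in> carrier A" "\<And>u. u \<in> D \<Longrightarrow> l u \<in> J u" "\<And>d. d \<in> set ds \<Longrightarrow> fst d \<in> D \<and> snd d \<in> J (fst d)"
    for ds l
    using that
  proof (induction ds arbitrary: l rule: rev_induct)
    case Nil
    then show ?case using E(2) by (simp add: prod_sums_def)
  next
    case (snoc d ds)
    define v where "v = fst d"
    define x where "x = snd d"
    have vx: "v \<in> D" "x \<in> J v" "d = (v, x)" using snoc.prems(3)[of d] by (auto simp: v_def x_def)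
    have xc: "x \<in> carrier A" by (rule Jc[OF vx(1,2)])
    have dsc: "snd ` set ds \<subseteq> carrier A"
    proof
      fix y assume "y \<in> snd ` set ds"
      then obtain e where "e \<in> set ds" "y = snd e" by auto
      then show "y \<in> carrier A" using snoc.prems(3)[of e] Jc[of "fst e" y] by auto
    qed
    obtain r where r: "r \<in> poly_funs (carrier A)"
      and eq: "\<And>a. a \<in> carrier A \<Longrightarrow> polar U ds T (l(v := l v \<oplus> a \<otimes> x)) =
        polar U ds T l \<oplus> a \<otimes> (polar U (ds @ [d]) T l \<oplus> a \<otimes> r a)"
      using polar_expand[of l x T U ds v, OF snoc.prems(1) xc T U(1) dsc] vx(3) by auto
    show ?case
    proof (rule linear_coeff_mem[OF inf E(1) _ _ r])
      show "polar U ds T l \<in> carrier A" using polar_closed[of l, OF snoc.prems(1)] dsc by blast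
      show "polar U (ds @ [d]) T l \<in> carrier A"
        using dsc xc vx(3) by (intro polar_closed[of l, OF snoc.prems(1)]) auto
      fix a assume a: "a \<in> carrier A"
      \<comment> \<open>The direction lies in the ideal of its variable, so the shifted point is
        again admissible for the induction hypothesis.\<close>
      have "l v \<oplus> a \<otimes> x \<in> J v"
        using vx a snoc.prems(2) by (intro ideal_add_closed[OF J] ideal.I_l_closed[OF J]) auto
      then have "polar U ds T (l(v := l v \<oplus> a \<otimes> x)) \<in> E"
        using snoc.prems Jc[OF vx(1)] by (intro snoc.IH) (simp_all add: fun_upd_def)
      then show "polar U ds T l \<oplus> a \<otimes> (polar U (ds @ [d]) T l \<oplus> a \<otimes> r a) \<in> E"
        unfolding eq[OF a] .
    qed
  qed
  obtain ts where ts: "set ts = T" "distinct ts" using finite_distinct_list[OF T] by blast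
  define ds where "ds = map (\<lambda>t. (w t, x t)) ts"
  have xc: "x t \<in> carrier A" if "t \<in> T" for t
    using Jc[OF _ w(2)[OF that]] w(1)[OF that] U(2)[OF that] by auto
  have ds: "fst d \<in> D \<and> snd d \<in> J (fst d)" if "d \<in> set ds" for d
    using that w subsetD[OF U(2) w(1)] ts by (auto simp: ds_def)
  have dsc: "snd ` set ds \<subseteq> carrier A" using ts xc by (auto simp: ds_def)
  have "foldr (\<lambda>d. (\<otimes>) (snd d)) (map (\<lambda>t. (w t, x t)) rs) \<one> = (\<Otimes>t\<in>set rs. x t)"
    if "distinct rs" "set rs \<subseteq> T" for rs
    using that
  proof (induction rs)
    case (Cons t rs)
    then have "(\<Otimes>t\<in>insert t (set rs). x t) = x t \<otimes> (\<Otimes>t\<in>set rs. x t)"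
      using xc by (intro finprod_insert) auto
    then show ?case using Cons by simp
  qed simp
  then have fold: "foldr (\<lambda>d. (\<otimes>) (snd d)) ds \<one> = (\<Otimes>t\<in>T. x t)" using ts by (simp add: ds_def)
  define n where "n = polar_count U (map fst ds) T"
  have "n \<ge> 1"
    using polar_count_pos[of ts w U] ts w(1) by (simp add: n_def ds_def comp_def)
  have Pc: "(\<Otimes>t\<in>T. x t) \<in> carrier A" using xc by (intro finprod_closed) auto
  \<comment> \<open>The full derivative is constant in \<open>l\<close>, so it may be evaluated at
    the origin, which is admissible for all ideals \<open>J u\<close>.\<close>
  have "polar U ds T (\<lambda>_. \<zero>) = [n] \<cdot> (\<Otimes>t\<in>T. x t)"
    using polar_full[OF dsc T, of U] distinct_card[OF ts(2)] ts(1) fold by (simp add: n_def ds_def)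
  moreover have "polar U ds T (\<lambda>_. \<zero>) \<in> E"
    using ideal_zero_closed[OF J] ds by (intro polar) auto
  ultimately have "([n] \<cdot> \<one>) \<otimes> (\<Otimes>t\<in>T. x t) \<in> E"
    using Pc by (simp add: add_pow_ldistr)
  then show ?thesis
    using ideal_unit_cancel[OF E(1) char_zero_nat_unit[OF char \<open>n \<ge> 1\<close>] Pc] by blast
qed

end

text \<open>Parts (b), (d) and (e) are instances of \<open>prod_sums_reduction\<close>; part (a) is
  (b) for the single factor I, and part (c) is (d) for a single power.\<close>

theorem theorem2p1:
  fixes A :: "('a, 'b) ring_scheme" and \<mm> I :: "'a set" and i p :: nat
  assumes "local_ring A \<mm>"
    and "infinite (carrier (A Quot \<mm>))"
    and "ideal I A"
    and "i \<ge> 1" and "p \<ge> 1"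
    and "min_gens A (I [^]\<^bsub>ideals_set A\<^esub> i) < enat ((i + p) choose i)"
  shows
    "(\<exists>h \<in> {1..p} \<rightarrow> I.
        I [^]\<^bsub>ideals_set A\<^esub> i = (Idl\<^bsub>A\<^esub> (h ` {1..p})) \<cdot>\<^bsub>A\<^esub> (I [^]\<^bsub>ideals_set A\<^esub> (i - 1)))
   \<and> (\<forall>(s::nat) (J::nat \<Rightarrow> 'a set).
        s \<ge> 1 \<and> (\<forall>t\<in>{1..s}. ideal (J t) A)
        \<and> I = (\<Otimes>\<^bsub>ideals_set A\<^esub>t\<in>{1..s}. J t) \<longrightarrow>
        (\<exists>h \<in> {1..p} \<rightarrow> I.
          I [^]\<^bsub>ideals_set A\<^esub> i = (Idl\<^bsub>A\<^esub> (h ` {1..p})) \<cdot>\<^bsub>A\<^esub> (I [^]\<^bsub>ideals_set A\<^esub> (i - 1)) \<and>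
          (\<forall>j\<in>{1..p}. \<exists>l. (\<forall>t\<in>{1..s}. l t \<in> J t) \<and> h j = (\<Otimes>\<^bsub>A\<^esub>t\<in>{1..s}. l t))))
   \<and> (ring_char (A Quot \<mm>) = 0 \<longrightarrow>
      (\<forall>(J::'a set) (b::nat).
        ideal J A \<and> b \<ge> 1 \<and> I = J [^]\<^bsub>ideals_set A\<^esub> b \<longrightarrow>
        (\<exists>h \<in> {1..p} \<rightarrow> I.
          I [^]\<^bsub>ideals_set A\<^esub> i = (Idl\<^bsub>A\<^esub> (h ` {1..p})) \<cdot>\<^bsub>A\<^esub> (I [^]\<^bsub>ideals_set A\<^esub> (i - 1)) \<and>
          (\<forall>j\<in>{1..p}. \<exists>l\<in>J. h j = l [^]\<^bsub>A\<^esub> b))))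
   \<and> (ring_char (A Quot \<mm>) = 0 \<longrightarrow>
      (\<forall>(s::nat) (J::nat \<Rightarrow> 'a set) (b::nat \<Rightarrow> nat).
        s \<ge> 1 \<and> (\<forall>t\<in>{1..s}. ideal (J t) A \<and> b t \<ge> 1)
        \<and> I = (\<Otimes>\<^bsub>ideals_set A\<^esub>t\<in>{1..s}. J t [^]\<^bsub>ideals_set A\<^esub> b t) \<longrightarrow>
        (\<exists>h \<in> {1..p} \<rightarrow> I.
          I [^]\<^bsub>ideals_set A\<^esub> i = (Idl\<^bsub>A\<^esub> (h ` {1..p})) \<cdot>\<^bsub>A\<^esub> (I [^]\<^bsub>ideals_set A\<^esub> (i - 1)) \<and>
          (\<forall>j\<in>{1..p}. \<exists>l. (\<forall>t\<in>{1..s}. l t \<in> J t) \<and>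
            h j = (\<Otimes>\<^bsub>A\<^esub>t\<in>{1..s}. l t [^]\<^bsub>A\<^esub> b t)))))
   \<and> (ring_char (A Quot \<mm>) = 0 \<longrightarrow>
      (\<forall>(s::nat) (J::nat \<Rightarrow> 'a set).
        s \<ge> 1 \<and> (\<forall>t\<in>{1..s}. ideal (J t) A)
        \<and> I = (\<Otimes>\<^bsub>ideals_set A\<^esub>t\<in>{1..s}. \<Oplus>\<^bsub>ideals_set A\<^esub>u\<in>{1..t}. J u) \<longrightarrow>
        (\<exists>h \<in> {1..p} \<rightarrow> I.
          I [^]\<^bsub>ideals_set A\<^esub> i = (Idl\<^bsub>A\<^esub> (h ` {1..p})) \<cdot>\<^bsub>A\<^esub> (I [^]\<^bsub>ideals_set A\<^esub> (i - 1)) \<and>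
          (\<forall>j\<in>{1..p}. \<exists>l. (\<forall>t\<in>{1..s}. l t \<in> J t) \<and>
            h j = (\<Otimes>\<^bsub>A\<^esub>t\<in>{1..s}. \<Oplus>\<^bsub>A\<^esub>u\<in>{1..t}. l u)))))"
proof -
  interpret local_ring A \<mm> by fact
  interpret IS: comm_monoid "ideals_set A" by (rule ideals_set_is_comm_monoid)
  note inf = assms(2) and i = assms(4) and small = assms(6)
  let ?reduces = "\<lambda>h. I [^]\<^bsub>ideals_set A\<^esub> i = (Idl\<^bsub>A\<^esub> (h ` {1..p})) \<cdot>\<^bsub>A\<^esub> (I [^]\<^bsub>ideals_set A\<^esub> (i - 1))"
  have sing: "(\<Oplus>\<^bsub>A\<^esub>u\<in>{t}. l u) = l t" if "l t \<in> carrier A" for l :: "nat \<Rightarrow> 'a" and t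
    using that by (simp add: finsum_insert)
  have b: "\<exists>h \<in> {1..p} \<rightarrow> I. ?reduces h \<and>
      (\<forall>j\<in>{1..p}. \<exists>l. (\<forall>t\<in>{1..s}. l t \<in> J t) \<and> h j = (\<Otimes>\<^bsub>A\<^esub>t\<in>{1..s}. l t))"
    if J: "\<And>t. t \<in> {1..s} \<Longrightarrow> ideal (J t) A" and I: "I = (\<Otimes>\<^bsub>ideals_set A\<^esub>t\<in>{1..s}. J t)"
    for s :: nat and J :: "nat \<Rightarrow> 'a set"
  proof -
    have Jc: "l t \<in> carrier A" if "\<forall>t\<in>{1..s}. l t \<in> J t" "t \<in> {1..s}" for l t
      using that ideal_subset_carrier[OF J[OF that(2)]] by blast
    have eval: "prod_sums (\<lambda>t. {t}) {1..s} l = (\<Otimes>\<^bsub>A\<^esub>t\<in>{1..s}. l t)"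
      if "\<forall>t\<in>{1..s}. l t \<in> J t" for l
      unfolding prod_sums_def using sing Jc[OF that] by (intro finprod_cong') auto
    have I': "I = (\<Otimes>\<^bsub>ideals_set A\<^esub>t\<in>{1..s}. \<Oplus>\<^bsub>ideals_set A\<^esub>u\<in>{t}. J u)"
      unfolding I using J
      by (intro IS.finprod_cong') (auto simp: finsum_ideals_set_singleton carrier_ideals_set)
    have "\<exists>h \<in> {1..p} \<rightarrow> I. ?reduces h \<and>
      (\<forall>j\<in>{1..p}. \<exists>l. (\<forall>u\<in>{1..s}. l u \<in> J u) \<and> h j = prod_sums (\<lambda>t. {t}) {1..s} l)"
    proof (rule prod_sums_reduction[OF inf _ _ _ J I' _ i small])
      fix w :: "nat \<Rightarrow> nat" and x E
      assume mem: "\<And>l. (\<And>u. u \<in> {1..s} \<Longrightarrow> l u \<in> J u) \<Longrightarrow> prod_sums (\<lambda>t. {t}) {1..s} l \<in> E"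
        and w: "\<And>t. t \<in> {1..s} \<Longrightarrow> w t \<in> {t}" "\<And>t. t \<in> {1..s} \<Longrightarrow> x t \<in> J (w t)"
      have x: "\<forall>t\<in>{1..s}. x t \<in> J t" using w by auto
      then show "(\<Otimes>\<^bsub>A\<^esub>t\<in>{1..s}. x t) \<in> E" using mem[of x] eval[OF x] by auto
    qed auto
    then obtain h where h: "h \<in> {1..p} \<rightarrow> I" "?reduces h"
      and l: "\<forall>j\<in>{1..p}. \<exists>l. (\<forall>u\<in>{1..s}. l u \<in> J u) \<and> h j = prod_sums (\<lambda>t. {t}) {1..s} l" by blast
    have "\<exists>l. (\<forall>t\<in>{1..s}. l t \<in> J t) \<and> h j = (\<Otimes>\<^bsub>A\<^esub>t\<in>{1..s}. l t)" if j: "j \<in> {1..p}" for j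
    proof -
      obtain l where l: "\<forall>t\<in>{1..s}. l t \<in> J t" "h j = prod_sums (\<lambda>t. {t}) {1..s} l"
        using bspec[OF l j] by blast
      then show ?thesis using eval[OF l(1)] by (intro exI[of _ l]) simp
    qed
    then show ?thesis using h by (intro bexI[of _ h]) simp_all
  qed
  have d: "\<exists>h \<in> {1..p} \<rightarrow> I. ?reduces h \<and>
      (\<forall>j\<in>{1..p}. \<exists>l. (\<forall>t\<in>{1..s}. l t \<in> J t) \<and> h j = (\<Otimes>\<^bsub>A\<^esub>t\<in>{1..s}. l t [^]\<^bsub>A\<^esub> b t))"
    if char: "ring_char (A Quot \<mm>) = 0" and J: "\<And>t. t \<in> {1..s} \<Longrightarrow> ideal (J t) A"
      and I: "I = (\<Otimes>\<^bsub>ideals_set A\<^esub>t\<in>{1..s}. J t [^]\<^bsub>ideals_set A\<^esub> b t)"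
    for s :: nat and J :: "nat \<Rightarrow> 'a set" and b :: "nat \<Rightarrow> nat"
  proof -
    \<comment> \<open>One factor for each of the \<open>b t\<close> copies of the variable
      \<open>t\<close>; all copies share the value \<open>l t\<close>, which produces the
      power.\<close>
    let ?T = "Sigma {1..s} (\<lambda>t. {..<b t})"
    have Jc: "l t \<in> carrier A" if "\<forall>t\<in>{1..s}. l t \<in> J t" "t \<in> {1..s}" for l t
      using that ideal_subset_carrier[OF J[OF that(2)]] by blast
    have eval: "prod_sums (\<lambda>x. {fst x}) ?T l = (\<Otimes>\<^bsub>A\<^esub>t\<in>{1..s}. l t [^]\<^bsub>A\<^esub> b t)"
      if "\<forall>t\<in>{1..s}. l t \<in> J t" for l
    proof -
      have "prod_sums (\<lambda>x. {fst x}) ?T l = (\<Otimes>\<^bsub>A\<^esub>x\<in>?T. l (fst x))"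
        unfolding prod_sums_def using sing Jc[OF that] by (intro finprod_cong') auto
      also have "\<dots> = (\<Otimes>\<^bsub>A\<^esub>t\<in>{1..s}. l t [^]\<^bsub>A\<^esub> b t)"
        using Jc[OF that] by (intro finprod_Sigma_const) auto
      finally show ?thesis .
    qed
    have "(\<Otimes>\<^bsub>ideals_set A\<^esub>x\<in>?T. J (fst x)) = I"
      unfolding I using J by (intro IS.finprod_Sigma_const) (auto simp: carrier_ideals_set)
    moreover have "(\<Otimes>\<^bsub>ideals_set A\<^esub>x\<in>?T. \<Oplus>\<^bsub>ideals_set A\<^esub>u\<in>{fst x}. J u) =
        (\<Otimes>\<^bsub>ideals_set A\<^esub>x\<in>?T. J (fst x))"
      using J by (intro IS.finprod_cong') (auto simp: finsum_ideals_set_singleton carrier_ideals_set)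
    ultimately have I': "I = (\<Otimes>\<^bsub>ideals_set A\<^esub>x\<in>?T. \<Oplus>\<^bsub>ideals_set A\<^esub>u\<in>{fst x}. J u)" by simp
    have "\<exists>h \<in> {1..p} \<rightarrow> I. ?reduces h \<and>
      (\<forall>j\<in>{1..p}. \<exists>l. (\<forall>u\<in>{1..s}. l u \<in> J u) \<and> h j = prod_sums (\<lambda>x. {fst x}) ?T l)"
    proof (rule prod_sums_reduction[OF inf _ _ _ J I' _ i small])
      fix w :: "nat \<times> nat \<Rightarrow> nat" and x E
      assume "ideal E A" "\<And>l. (\<And>u. u \<in> {1..s} \<Longrightarrow> l u \<in> J u) \<Longrightarrow> prod_sums (\<lambda>x. {fst x}) ?T l \<in> E"
        "\<And>t. t \<in> ?T \<Longrightarrow> w t \<in> (\<lambda>x. {fst x}) t" "\<And>t. t \<in> ?T \<Longrightarrow> x t \<in> J (w t)"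
      then show "(\<Otimes>\<^bsub>A\<^esub>t\<in>?T. x t) \<in> E"
        using J by (intro polarization[OF inf char, where T = "?T" and U = "\<lambda>x. {fst x}" and J = J and D = "{1..s}"
            and w = w and x = x and E = E]) auto
    qed auto
    then obtain h where h: "h \<in> {1..p} \<rightarrow> I" "?reduces h"
      and l: "\<forall>j\<in>{1..p}. \<exists>l. (\<forall>u\<in>{1..s}. l u \<in> J u) \<and> h j = prod_sums (\<lambda>x. {fst x}) ?T l" by blast
    have "\<exists>l. (\<forall>t\<in>{1..s}. l t \<in> J t) \<and> h j = (\<Otimes>\<^bsub>A\<^esub>t\<in>{1..s}. l t [^]\<^bsub>A\<^esub> b t)" if j: "j \<in> {1..p}" for j
    proof -
      obtain l where l: "\<forall>t\<in>{1..s}. l t \<in> J t" "h j = prod_sums (\<lambda>x. {fst x}) ?T l"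
        using bspec[OF l j] by blast
      then show ?thesis using eval[OF l(1)] by (intro exI[of _ l]) simp
    qed
    then show ?thesis using h by (intro bexI[of _ h]) simp_all
  qed
  have e: "\<exists>h \<in> {1..p} \<rightarrow> I. ?reduces h \<and>
      (\<forall>j\<in>{1..p}. \<exists>l. (\<forall>t\<in>{1..s}. l t \<in> J t) \<and> h j = (\<Otimes>\<^bsub>A\<^esub>t\<in>{1..s}. \<Oplus>\<^bsub>A\<^esub>u\<in>{1..t}. l u))"
    if char: "ring_char (A Quot \<mm>) = 0" and J: "\<And>t. t \<in> {1..s} \<Longrightarrow> ideal (J t) A"
      and I: "I = (\<Otimes>\<^bsub>ideals_set A\<^esub>t\<in>{1..s}. \<Oplus>\<^bsub>ideals_set A\<^esub>u\<in>{1..t}. J u)"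
    for s :: nat and J :: "nat \<Rightarrow> 'a set"
  proof -
    have "\<exists>h \<in> {1..p} \<rightarrow> I. ?reduces h \<and>
      (\<forall>j\<in>{1..p}. \<exists>l. (\<forall>u\<in>{1..s}. l u \<in> J u) \<and> h j = prod_sums (\<lambda>t. {1..t}) {1..s} l)"
    proof (rule prod_sums_reduction[OF inf _ _ _ J I _ i small])
      fix w :: "nat \<Rightarrow> nat" and x E
      assume "ideal E A" "\<And>l. (\<And>u. u \<in> {1..s} \<Longrightarrow> l u \<in> J u) \<Longrightarrow> prod_sums (\<lambda>t. {1..t}) {1..s} l \<in> E"
        "\<And>t. t \<in> {1..s} \<Longrightarrow> w t \<in> (\<lambda>t. {1..t}) t" "\<And>t. t \<in> {1..s} \<Longrightarrow> x t \<in> J (w t)"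
      then show "(\<Otimes>\<^bsub>A\<^esub>t\<in>{1..s}. x t) \<in> E"
        using J by (intro polarization[OF inf char, where T = "{1..s}" and U = "\<lambda>t. {1..t}" and J = J and D = "{1..s}"
            and w = w and x = x and E = E]) auto
    qed auto
    then show ?thesis by (simp only: prod_sums_def)
  qed
  have one: "(\<Otimes>\<^bsub>ideals_set A\<^esub>t\<in>{1..1::nat}. K) = K" if "ideal K A" for K
    using that IS.finprod_insert[of "{}" "1::nat" "\<lambda>_. K"] by (simp add: carrier_ideals_set)
  have a: "\<exists>h \<in> {1..p} \<rightarrow> I. ?reduces h"
    using b[of 1 "\<lambda>_. I"] one[OF assms(3)] assms(3) by auto
  have c: "\<exists>h \<in> {1..p} \<rightarrow> I. ?reduces h \<and> (\<forall>j\<in>{1..p}. \<exists>l\<in>J. h j = l [^]\<^bsub>A\<^esub> b)"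
    if char: "ring_char (A Quot \<mm>) = 0" and J: "ideal J A" and I: "I = J [^]\<^bsub>ideals_set A\<^esub> b"
    for J and b :: nat
  proof -
    have "I = (\<Otimes>\<^bsub>ideals_set A\<^esub>t\<in>{1..1::nat}. J [^]\<^bsub>ideals_set A\<^esub> b)"
      using one[OF ideal_power_ideal[OF J, of b]] I by simp
    from d[OF char J this] obtain h where h: "h \<in> {1..p} \<rightarrow> I" "?reduces h"
      and l: "\<forall>j\<in>{1..p}. \<exists>l. (\<forall>t\<in>{1..1::nat}. l t \<in> J) \<and> h j = (\<Otimes>\<^bsub>A\<^esub>t\<in>{1..1::nat}. l t [^]\<^bsub>A\<^esub> b)"
      by blast
    have "\<exists>l\<in>J. h j = l [^]\<^bsub>A\<^esub> b" if j: "j \<in> {1..p}" for j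
    proof -
      obtain l where l: "l 1 \<in> J" "h j = (\<Otimes>\<^bsub>A\<^esub>t\<in>{1..1::nat}. l t [^]\<^bsub>A\<^esub> b)" using bspec[OF l j] by auto
      moreover have "l 1 \<in> carrier A" using l(1) ideal_subset_carrier[OF J] by blast
      ultimately have "h j = l 1 [^]\<^bsub>A\<^esub> b" by simp
      then show ?thesis using l(1) by blast
    qed
    then show ?thesis using h by blast
  qed
  show ?thesis
    by (intro conjI allI impI) (fact a, (rule b; blast), (rule c; blast), (rule d; blast), (rule e; blast))
qed

end
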